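(* For every $n\ge 1$, the map $\Psi$ is a bijection between the set of realizers of triangulations of size $n$ and the set of pairs $(P,Q)$ of Dyck paths of size $n$ such that $P$ stays below $Q$ (i.e. $e_i(P)\le e_i(Q)$ for all $0\le i\le n$).
   Context: Dyck paths: a Dyck path of size $n$ is a word in the letters $N$ (step $+1$) and $S$ (step $-1$) with $n$ letters of each kind such that every prefix contains at least as many $N$ as $S$. It can be written uniquely as $P=NS^{\alpha_1}NS^{\alpha_2}\cdots NS^{\alpha_n}$ with $\alpha_i\ge 0$; for $0\le i\le n$ put $e_i(P)=i-\sum_{j\le i}\alpha_j$. Maps: a planar map is an embedding of a connected finite planar graph without loops or multiple edges in the sphere, considered up to continuous deformation. A corner is a pair of consecutive half-edges around a vertex. A map is rooted by choosing a corner; its vertex is the root vertex and its face is the root face. Vertices/edges incident to the root face are external, the others internal. A triangulation is a rooted planar map all of whose faces have degree 3; its size is its number of internal vertices. Let $v_0$ be the root vertex, $v_1,v_2$ the other external vertices, with $v_0,v_1,v_2$ in counterclockwise order around the root face, and $U$ the set of internal vertices. For an oriented edge, its tail is the half-edge at its origin and its head the half-edge at its end. Realizers: a realizer $R=(T_0,T_1,T_2)$ of a triangulation $M$ is a coloring of the internal edges of $M$ with colors $0,1,2$ such that (i) for each $i$, the edges of color $i$ form a tree $T_i$ with vertex set $U\cup\{v_i\}$, rooted at $v_i$, whose edges are oriented toward $v_i$; (ii) in clockwise order around each internal vertex one finds: exactly one $0$-tail, some (possibly no) $1$-heads, exactly one $2$-tail, some $0$-heads, exactly one $1$-tail, some $2$-heads.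 The size of $R$ is the size of $M$. Plane trees: a plane tree is a rooted planar map whose graph is a tree. Its tour follows its border in clockwise direction starting and ending at the root corner; $\omega(T)$ is the word obtained by writing $N$ the first time an edge is followed and $S$ the second time. The clockwise order of the vertices is the order in which they are first encountered during the tour. The map $\Psi$: let $R=(T_0,T_1,T_2)$ be a realizer of a triangulation $M$ of size $n$. Regard $T_0$ as a plane tree rooted at the root corner of $M$, and let $u_0,\dots,u_{n-1}$ be the internal vertices in clockwise order around $T_0$. For $1\le i\le n-1$ let $\beta_i$ be the number of $1$-heads incident to $u_i$, and let $\beta_n$ be the number of $1$-heads incident to $v_1$. Then $\Psi(R)=(P,Q)$ with $P=\omega(T_0)$ and $Q=NS^{\beta_1}\cdots NS^{\beta_n}$. *)

theory Defs
  imports "HOL-Combinatorics.Orbits"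
begin

section \<open>Dyck paths\<close>

datatype letter = N | S

definition dyck_path :: "nat \<Rightarrow> letter list \<Rightarrow> bool" where
  "dyck_path n w \<longleftrightarrow> count_list w N = n \<and> count_list w S = n \<and>
     (\<forall>k\<le>length w. count_list (take k w) S \<le> count_list (take k w) N)"

definition ns_word :: "nat list \<Rightarrow> letter list" where
  "ns_word as = concat (map (\<lambda>a. N # replicate a S) as)"

definition exponents :: "letter list \<Rightarrow> nat list" where
  "exponents w = (THE as. w = ns_word as)"

definition height :: "letter list \<Rightarrow> nat \<Rightarrow> int" where
  "height w i = int i - int (sum_list (take i (exponents w)))"

definition stays_below :: "nat \<Rightarrow> letter list \<Rightarrow> letter list \<Rightarrow> bool" where
  "stays_below n P Q \<longleftrightarrow> (\<forall>i\<le>n. height P i \<le> height Q i)"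


section \<open>Rooted planar maps\<close>

text \<open>
  A map on an oriented surface, up to orientation-preserving homeomorphism, is encoded by its
  half-edges (darts): \<open>rot\<close> sends a dart to the next dart in clockwise order around its
  origin, \<open>opp\<close> sends a dart to the other half of its edge. The dart \<open>root\<close> stands for the
  corner between \<open>root\<close> and its clockwise successor \<open>rot root\<close>. This corner lies to the right of
  the dart \<open>root\<close> directed away from its origin. The map without edges
  has no dart and hence no encoding; it is not a triangulation.
\<close>

record 'h rooted_map =
  darts :: "'h set"
  rot :: "'h \<Rightarrow> 'h"
  opp :: "'h \<Rightarrow> 'h"
  root :: 'h

definition vert :: "'h rooted_map \<Rightarrow> 'h \<Rightarrow> 'h set" where
  "vert M h = orbit (rot M) h"

definition edge :: "'h rooted_map \<Rightarrow> 'h \<Rightarrow> 'h set" where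
  "edge M h = {h, opp M h}"

text \<open>
  \<open>face_next\<close> walks along the boundary of a face, keeping the face on the right: the
  corner between \<open>h\<close> and \<open>rot M h\<close> is followed by the one between \<open>face_next M h\<close> and \<open>opp M h\<close>.
\<close>

definition face_next :: "'h rooted_map \<Rightarrow> 'h \<Rightarrow> 'h" where
  "face_next M h = inv (rot M) (opp M h)"

definition face :: "'h rooted_map \<Rightarrow> 'h \<Rightarrow> 'h set" where
  "face M h = orbit (face_next M) h"

definition vertices :: "'h rooted_map \<Rightarrow> 'h set set" where
  "vertices M = vert M ` darts M"

definition edges :: "'h rooted_map \<Rightarrow> 'h set set" where
  "edges M = edge M ` darts M"

definition faces :: "'h rooted_map \<Rightarrow> 'h set set" where
  "faces M = face M ` darts M"

definition adjacency :: "'h rooted_map \<Rightarrow> 'h set \<Rightarrow> ('h set \<times> 'h set) set" where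
  "adjacency M D = (\<lambda>h. (vert M h, vert M (opp M h))) ` D"

definition connected_graph :: "'v set \<Rightarrow> ('v \<times> 'v) set \<Rightarrow> bool" where
  "connected_graph V A \<longleftrightarrow> V \<noteq> {} \<and> A \<subseteq> V \<times> V \<and> (\<forall>u\<in>V. \<forall>v\<in>V. (u, v) \<in> A\<^sup>*)"

text \<open>The equation between the cardinalities is Euler's formula for the sphere.\<close>

definition planar_map :: "'h rooted_map \<Rightarrow> bool" where
  "planar_map M \<longleftrightarrow>
     finite (darts M) \<and> root M \<in> darts M \<and>
     rot M permutes darts M \<and> opp M permutes darts M \<and>
     (\<forall>h\<in>darts M. opp M h \<noteq> h \<and> opp M (opp M h) = h) \<and>
     connected_graph (vertices M) (adjacency M (darts M)) \<and>
     card (vertices M) + card (faces M) = card (edges M) + 2 \<and>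
     (\<forall>h\<in>darts M. vert M h \<noteq> vert M (opp M h)) \<and>
     (\<forall>h\<in>darts M. \<forall>k\<in>darts M.
        vert M h = vert M k \<and> vert M (opp M h) = vert M (opp M k) \<longrightarrow> h = k)"

definition triangulation :: "'h rooted_map \<Rightarrow> bool" where
  "triangulation M \<longleftrightarrow> planar_map M \<and> (\<forall>f\<in>faces M. card f = 3)"

definition root_face :: "'h rooted_map \<Rightarrow> 'h set" where
  "root_face M = face M (root M)"

text \<open>
  The vertices \<open>v\<^sub>0, v\<^sub>1, v\<^sub>2\<close> of a triangulation. They are in counterclockwise order in a plane drawing
  whose unbounded face is the root face, i.e. in the order of a walk with the root face on the right.
\<close>

definition ext_vertex :: "'h rooted_map \<Rightarrow> nat \<Rightarrow> 'h set" where
  "ext_vertex M i = vert M ((face_next M ^^ i) (root M))"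

definition internal_vertices :: "'h rooted_map \<Rightarrow> 'h set set" where
  "internal_vertices M = vertices M - vert M ` root_face M"

definition internal_edges :: "'h rooted_map \<Rightarrow> 'h set set" where
  "internal_edges M = {e \<in> edges M. e \<inter> root_face M = {}}"

definition size_tri :: "'h rooted_map \<Rightarrow> nat" where
  "size_tri M = card (internal_vertices M)"


section \<open>Realizers\<close>

text \<open>
  Simple graphs are given by symmetric adjacency relations. (The predicate \<open>tree\<close> of the
  AFP entry \<open>Graph_Theory\<close> excludes directed cycles only, so it does not apply.)
\<close>

definition is_path :: "('v \<times> 'v) set \<Rightarrow> 'v list \<Rightarrow> bool" where
  "is_path A p \<longleftrightarrow> p \<noteq> [] \<and> distinct p \<and> successively (\<lambda>u v. (u, v) \<in> A) p"

definition is_cycle :: "('v \<times> 'v) set \<Rightarrow> 'v list \<Rightarrow> bool" where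
  "is_cycle A p \<longleftrightarrow> is_path A p \<and> 3 \<le> length p \<and> (last p, hd p) \<in> A"

definition is_tree :: "'v set \<Rightarrow> ('v \<times> 'v) set \<Rightarrow> bool" where
  "is_tree V A \<longleftrightarrow> connected_graph V A \<and> (\<nexists>p. is_cycle A p)"

text \<open>A coloring assigns a color to each edge; its values outside \<open>internal_edges M\<close> are irrelevant.\<close>

type_synonym 'h coloring = "'h set \<Rightarrow> nat"

definition color_darts :: "'h rooted_map \<Rightarrow> 'h coloring \<Rightarrow> nat \<Rightarrow> 'h set" where
  "color_darts M c i = {h \<in> darts M. edge M h \<in> internal_edges M \<and> c (edge M h) = i}"

abbreviation color_graph :: "'h rooted_map \<Rightarrow> 'h coloring \<Rightarrow> nat \<Rightarrow> ('h set \<times> 'h set) set" where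
  "color_graph M c i \<equiv> adjacency M (color_darts M c i)"

text \<open>
  The edges of \<open>T\<^sub>i\<close> are oriented toward \<open>v\<^sub>i\<close>: a dart \<open>h\<close> of color \<open>i\<close> is a tail iff
  the path in \<open>T\<^sub>i\<close> from the origin of \<open>h\<close> to \<open>v\<^sub>i\<close> starts along \<open>h\<close>.
\<close>

definition is_tail :: "'h rooted_map \<Rightarrow> 'h coloring \<Rightarrow> nat \<Rightarrow> 'h \<Rightarrow> bool" where
  "is_tail M c i h \<longleftrightarrow> h \<in> color_darts M c i \<and>
     (\<exists>p. is_path (color_graph M c i) (vert M h # vert M (opp M h) # p) \<and>
          last (vert M h # vert M (opp M h) # p) = ext_vertex M i)"

definition is_head :: "'h rooted_map \<Rightarrow> 'h coloring \<Rightarrow> nat \<Rightarrow> 'h \<Rightarrow> bool" where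
  "is_head M c i h \<longleftrightarrow> h \<in> color_darts M c i \<and> is_tail M c i (opp M h)"

definition clockwise_from :: "'h rooted_map \<Rightarrow> 'h \<Rightarrow> 'h list" where
  "clockwise_from M h = map (\<lambda>k. (rot M ^^ k) h) [0..<card (vert M h)]"

definition realizer :: "'h rooted_map \<Rightarrow> 'h coloring \<Rightarrow> bool" where
  "realizer M c \<longleftrightarrow>
     (\<forall>e\<in>internal_edges M. c e \<in> {0, 1, 2}) \<and>
     (\<forall>i\<in>{0, 1, 2}. is_tree (insert (ext_vertex M i) (internal_vertices M)) (color_graph M c i)) \<and>
     (\<forall>u\<in>internal_vertices M. \<exists>t0\<in>u. \<exists>H1 t2 H0 t1 H2.
        clockwise_from M t0 = [t0] @ H1 @ [t2] @ H0 @ [t1] @ H2 \<and>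
        is_tail M c 0 t0 \<and> is_tail M c 1 t1 \<and> is_tail M c 2 t2 \<and>
        (\<forall>h\<in>set H0. is_head M c 0 h) \<and>
        (\<forall>h\<in>set H1. is_head M c 1 h) \<and>
        (\<forall>h\<in>set H2. is_head M c 2 h))"

text \<open>
  Realizers are considered up to isomorphism of the underlying rooted map. Since every finite
  map can be encoded with natural numbers as darts, these suffice.
\<close>

definition realizer_set :: "nat \<Rightarrow> (nat rooted_map \<times> nat coloring) set" where
  "realizer_set n = {(M, c). triangulation M \<and> size_tri M = n \<and> realizer M c}"

definition rooted_map_iso :: "('h \<Rightarrow> 'k) \<Rightarrow> 'h rooted_map \<Rightarrow> 'k rooted_map \<Rightarrow> bool" where
  "rooted_map_iso f M M' \<longleftrightarrow> bij_betw f (darts M) (darts M') \<and> f (root M) = root M' \<and>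
     (\<forall>h\<in>darts M. f (rot M h) = rot M' (f h) \<and> f (opp M h) = opp M' (f h))"

definition realizer_iso ::
    "nat \<Rightarrow> ((nat rooted_map \<times> nat coloring) \<times> (nat rooted_map \<times> nat coloring)) set" where
  "realizer_iso n = {((M, c), (M', c')). (M, c) \<in> realizer_set n \<and> (M', c') \<in> realizer_set n \<and>
     (\<exists>f. rooted_map_iso f M M' \<and> (\<forall>e\<in>internal_edges M. c' (f ` e) = c e))}"


section \<open>The tour of a plane tree\<close>

text \<open>
  The tour starts from the root corner with its clockwise neighbour \<open>rot T (root T)\<close> and
  has the tree on its right. Each dart records the traversal of its edge away from its origin.
\<close>

definition tour :: "'h rooted_map \<Rightarrow> 'h list" where
  "tour T = map (\<lambda>k. ((\<lambda>h. rot T (opp T h)) ^^ k) (rot T (root T))) [0..<card (darts T)]"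

definition omega :: "'h rooted_map \<Rightarrow> letter list" where
  "omega T = map (\<lambda>k. if opp T (tour T ! k) \<in> set (take k (tour T)) then S else N)
     [0..<length (tour T)]"

definition first_hit :: "('h \<Rightarrow> 'h) \<Rightarrow> 'h set \<Rightarrow> 'h \<Rightarrow> 'h" where
  "first_hit f D h = (f ^^ (LEAST k. (f ^^ k) h \<in> D)) h"

text \<open>
  The submap of \<open>M\<close> formed by the edges with darts in \<open>D\<close>, rooted at its corner that
  contains the root corner of \<open>M\<close>; here \<open>D\<close> contains some dart at the root vertex.
\<close>

definition submap :: "'h rooted_map \<Rightarrow> 'h set \<Rightarrow> 'h rooted_map" where
  "submap M D =
     \<lparr> darts = D,
       rot = (\<lambda>h. if h \<in> D then first_hit (rot M) D (rot M h) else h),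
       opp = (\<lambda>h. if h \<in> D then opp M h else h),
       root = first_hit (inv (rot M)) D (root M) \<rparr>"


section \<open>The map \<open>Psi\<close>\<close>

definition T0 :: "'h rooted_map \<Rightarrow> 'h coloring \<Rightarrow> 'h rooted_map" where
  "T0 M c = submap M (color_darts M c 0)"

text \<open>\<open>remdups\<close> keeps last occurrences, hence the two reversals.\<close>

definition first_occurrences :: "'a list \<Rightarrow> 'a list" where
  "first_occurrences xs = rev (remdups (rev xs))"

definition clockwise_vertices :: "'h rooted_map \<Rightarrow> 'h coloring \<Rightarrow> 'h set list" where
  "clockwise_vertices M c =
     filter (\<lambda>v. v \<in> internal_vertices M) (first_occurrences (map (vert M) (tour (T0 M c))))"

definition beta :: "'h rooted_map \<Rightarrow> 'h coloring \<Rightarrow> nat \<Rightarrow> nat" where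
  "beta M c i =
     card {h \<in> (if i < size_tri M then clockwise_vertices M c ! i else ext_vertex M 1).
           is_head M c 1 h}"

fun Psi :: "'h rooted_map \<times> 'h coloring \<Rightarrow> letter list \<times> letter list" where
  "Psi (M, c) = (omega (T0 M c), ns_word (map (beta M c) [1..<Suc (size_tri M)]))"

end

theory Submission
  imports Defs "HOL-Library.Nat_Bijection"
begin

text \<open>
  Extend \<open>T\<^sub>0\<close> by the external edges from \<open>v\<^sub>2\<close> and from \<open>v\<^sub>1\<close> to \<open>v\<^sub>0\<close>, as the first and the last
  child of the root, and follow its tour. The region swept by the tour is at any time bounded by a path
  from \<open>v\<^sub>0\<close> along the ancestors of the current vertex to the cursor, and from there on to \<open>v\<^sub>2\<close>.
  The local rule and the triangular faces force a new vertex \<open>u\<close> to be joined at the cursor, by a fan of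
  triangles, to consecutive vertices of this path: its \<open>0\<close>-parent, the origins of its \<open>1\<close>-heads, which
  disappear from the path, and its \<open>2\<close>-parent. Hence the word of \<open>T\<^sub>0\<close> and the numbers of \<open>1\<close>-heads
  determine the realizer, and a pair of words comes from a realizer iff the path never runs out of
  vertices after the cursor. Before the letter \<open>N\<close> of \<open>u\<^sub>i\<close> (or of \<open>v\<^sub>1\<close>, for \<open>i = n\<close>) that path
  carries, besides \<open>v\<^sub>2\<close>, one vertex for each earlier letter \<open>S\<close> and has lost one for each earlier
  \<open>1\<close>-head, so the condition reads \<open>\<beta>\<^sub>1 + \<dots> + \<beta>\<^sub>i \<le> \<alpha>\<^sub>1 + \<dots> + \<alpha>\<^sub>i\<close>, i.e. \<open>e\<^sub>i(P) \<le> e\<^sub>i(Q)\<close>.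

  Conversely, the fans prescribed by such a pair define a permutation of darts whose cycles are
  triangles. The numbers of vertices, edges and faces then satisfy Euler's formula, and the map is
  simple because each vertex is joined to distinct earlier vertices.
\<close>

text \<open>The map is built from its faces, not from its vertices. Each triangle except the root
  face is known as soon as its fan is glued, whereas the rotation at a vertex collects half-edges
  from many moments of the tour. So the rotation is defined from the triangles, and it is a theorem
  that its cycles are the vertices and follow the local rule (\<open>orbit_rot\<close>,
  \<open>rotation_list\<close>). Both directions meet in the locale \<open>presented\<close>, a map
  whose half-edges are labelled by those of a code; all properties of the map and its value of
  \<open>Psi\<close> are computed there. Injectivity then amounts to composing two labellings,
  surjectivity to writing one down. Labelling a given realizer has two obstacles. A fan might run
  past the end of the path; but the triangle before a \<open>1\<close>-head shows that the next path
  vertex has a \<open>1\<close>-tail, so it is not \<open>v\<^sub>2\<close>. And the tour, an orbit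
  of a permutation, might close before it has met all vertices; the paths in
  \<open>T\<^sub>0\<close> exclude this. The external edges get colors so that
  \<open>v\<^sub>1\<close> is attached by one more fan, like an internal vertex.\<close>

section \<open>The zipper run of a code\<close>

text \<open>
  \<open>Tl i k\<close> and \<open>Hd i k\<close> are the tail and the head of the edge of color \<open>i\<close> that leaves the vertex \<open>k\<close>.
  The vertices are numbered along the tour: \<open>v\<^sub>0\<close> is \<open>0\<close>, \<open>v\<^sub>2\<close> is \<open>1\<close>, the internal vertex \<open>u\<^sub>k\<close> is
  \<open>k + 2\<close> and \<open>v\<^sub>1\<close> is \<open>n + 2\<close>. The external edges are colored as well: \<open>v\<^sub>2 v\<^sub>0\<close> and \<open>v\<^sub>1 v\<^sub>0\<close> get color
  \<open>0\<close>, and \<open>v\<^sub>1 v\<^sub>2\<close> gets color \<open>2\<close>.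
\<close>

datatype dart = Tl nat nat | Hd nat nat

primrec flip :: "dart \<Rightarrow> dart" where
  "flip (Tl i k) = Hd i k"
| "flip (Hd i k) = Tl i k"

lemma flip_flip [simp]: "flip (flip d) = d"
  by (cases d) auto

lemma flip_neq [simp]: "flip d \<noteq> d" "d \<noteq> flip d"
  by (cases d; simp)+

lemma flip_eq_iff [simp]: "flip d = flip e \<longleftrightarrow> d = e"
  by (metis flip_flip)

locale walk =
  fixes w :: "nat \<Rightarrow> letter" and b :: "nat \<Rightarrow> nat"
begin

text \<open>The number that the next new vertex receives. It starts at 2, because
  \<open>v\<^sub>0\<close> and \<open>v\<^sub>2\<close> hold 0 and 1.\<close>

primrec cnt :: "nat \<Rightarrow> nat" where
  "cnt 0 = 2"
| "cnt (Suc j) = (if w j = N then Suc (cnt j) else cnt j)"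

text \<open>
  After \<open>j\<close> letters the region swept so far is bounded by the path \<open>rev (stk j) @ sky j\<close> from \<open>v\<^sub>0\<close> to
  \<open>v\<^sub>2\<close>, where \<open>stk j\<close> lists the ancestors at the cursor. A letter \<open>N\<close> attaches a new vertex at the cursor
  and covers the first \<open>b k\<close> vertices of \<open>sky j\<close>; a letter \<open>S\<close> moves the cursor down by one.
\<close>

primrec stk :: "nat \<Rightarrow> nat list" where
  "stk 0 = [0]"
| "stk (Suc j) = (if w j = N then cnt j # stk j else tl (stk j))"

primrec sky :: "nat \<Rightarrow> nat list" where
  "sky 0 = [1]"
| "sky (Suc j) = (if w j = N then drop (b (cnt j)) (sky j) else hd (stk j) # sky j)"

text \<open>The part of the boundary path from the cursor on. Every fan is glued to an initial
  segment of it.\<close>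

definition front :: "nat \<Rightarrow> nat list" where
  "front j = hd (stk j) # sky j"

text \<open>At a letter N one vertex of \<open>sky j\<close> must stay uncovered to become the
  \<open>2\<close>-parent; at a letter S the root must stay on the stack.\<close>

definition ok :: "nat \<Rightarrow> bool" where
  "ok j \<longleftrightarrow> (if w j = N then b (cnt j) < length (sky j) else 2 \<le> length (stk j))"

definition tm :: "nat \<Rightarrow> nat" where
  "tm k = (THE j. w j = N \<and> cnt j = k)"

definition p0 :: "nat \<Rightarrow> nat" where
  "p0 k = (if k = 1 then 0 else hd (stk (tm k)))"

text \<open>The first path vertex that the fan of \<open>k\<close> leaves uncovered; the last spoke
  ends there.\<close>

definition p2 :: "nat \<Rightarrow> nat" where
  "p2 k = sky (tm k) ! b k"

definition adj :: "nat \<Rightarrow> nat \<Rightarrow> bool" where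
  "adj x y \<longleftrightarrow> x < y \<and> p0 y = x \<or> y < x \<and> p2 x = y"

text \<open>The half-edge at \<open>x\<close> of the path edge from \<open>x\<close> to
  \<open>y\<close>. By \<open>adj\<close> this is the \<open>0\<close>-edge of \<open>y\<close> if
  it climbs and the \<open>2\<close>-edge of \<open>x\<close> if it descends.\<close>

definition frontier_dart :: "nat \<Rightarrow> nat \<Rightarrow> dart" where
  "frontier_dart x y = (if x < y then Hd 0 y else Tl 2 x)"

text \<open>The half-edges of a fan at its new vertex in clockwise order, as in the local rule.
  Spoke \<open>i\<close> leads to entry \<open>i\<close> of \<open>front j\<close>.\<close>

definition spoke :: "nat \<Rightarrow> nat \<Rightarrow> dart" where
  "spoke j i = (if i = 0 then Tl 0 (cnt j) else if i \<le> b (cnt j) then Hd 1 (front j ! i)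
     else Tl 2 (cnt j))"

text \<open>The half-edge that follows the path edge at the cursor in clockwise order, see
  \<open>rot_junction\<close>.\<close>

definition turn :: "nat \<Rightarrow> dart" where
  "turn j = (if w j = N then Hd 0 (cnt j) else Tl 1 (hd (stk j)))"

definition popped :: "nat \<Rightarrow> nat \<Rightarrow> bool" where
  "popped x j \<longleftrightarrow> w j = N \<and> x \<in> set (take (b (cnt j)) (sky j))"

section \<open>Invariants of the run\<close>

lemma letter_cases: "w j = N \<or> w j = S"
  by (cases "w j") auto

lemma cnt_ge: "2 \<le> cnt j"
  by (induction j) auto

lemma cnt_mono: "i \<le> j \<Longrightarrow> cnt i \<le> cnt j"
  by (rule lift_Suc_mono_le[of cnt]) auto

lemma cnt_strict: "w i = N \<Longrightarrow> i < j \<Longrightarrow> cnt i < cnt j"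
  using cnt_mono[of "Suc i" j] by simp

lemma cnt_inj: "w i = N \<Longrightarrow> w j = N \<Longrightarrow> cnt i = cnt j \<Longrightarrow> i = j"
  using cnt_strict[of i j] cnt_strict[of j i] by (cases i j rule: linorder_cases) simp_all

lemma tm_cnt: "w j = N \<Longrightarrow> tm (cnt j) = j"
  unfolding tm_def by (rule the_equality) (auto intro: cnt_inj)

lemma cnt_surj: "2 \<le> k \<Longrightarrow> k < cnt j \<Longrightarrow> \<exists>i<j. w i = N \<and> cnt i = k"
proof (induction j)
  case (Suc j)
  show ?case
  proof (cases "k < cnt j")
    case True
    then show ?thesis using Suc.IH[OF Suc.prems(1)] less_SucI by blast
  next
    case False
    then have "w j = N" "cnt j = k" using Suc.prems by (auto split: if_splits)
    then show ?thesis by blast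
  qed
qed auto

lemma tm_props: "2 \<le> k \<Longrightarrow> k < cnt j \<Longrightarrow> w (tm k) = N \<and> cnt (tm k) = k \<and> tm k < j"
  using cnt_surj[of k j] tm_cnt by fastforce

text \<open>A letter N adds only a fresh vertex to the path, and a letter S only carries a vertex
  over from the stack to \<open>sky\<close>, so the path stays simple. \<open>ok\<close> keeps
  \<open>v\<^sub>0\<close> and \<open>v\<^sub>2\<close> at its ends.\<close>

lemma run_invariant:
  assumes "\<forall>i<j. ok i"
  shows "stk j \<noteq> [] \<and> last (stk j) = 0 \<and> sky j \<noteq> [] \<and> last (sky j) = 1 \<and>
    sorted_wrt (>) (stk j) \<and> distinct (stk j @ sky j) \<and> set (stk j @ sky j) \<subseteq> {..<cnt j}"
  using assms
proof (induction j)
  case (Suc j)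
  then have IH: "stk j \<noteq> []" "last (stk j) = 0" "sky j \<noteq> []" "last (sky j) = 1"
    "sorted_wrt (>) (stk j)" "distinct (stk j @ sky j)" "set (stk j @ sky j) \<subseteq> {..<cnt j}"
    and ok: "ok j"
    by auto
  show ?case
  proof (cases "w j = N")
    case True
    have "set (drop (b (cnt j)) (sky j)) \<subseteq> set (sky j)" by (rule set_drop_subset)
    with IH ok True show ?thesis
      by (auto simp: ok_def)
  next
    case False
    obtain a c A where A: "stk j = a # c # A"
      using ok False IH(1) unfolding ok_def by (cases "stk j"; cases "tl (stk j)") auto
    with IH False show ?thesis by auto
  qed
qed auto

text \<open>A letter N exposes the \<open>2\<close>-edge of the new vertex. A letter S brings the
  \<open>0\<close>-edge of the vertex that it leaves from the stack into \<open>front\<close>. No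
  other edges enter \<open>front\<close>.\<close>

lemma frontier_adj:
  assumes "\<forall>i<j. ok i"
  shows "successively adj (front j) \<and> successively (\<lambda>x y. p0 x = y) (stk j)"
  using assms
proof (induction j)
  case 0
  then show ?case by (simp add: front_def adj_def p0_def)
next
  case (Suc j)
  then have IH: "successively adj (front j)" "successively (\<lambda>x y. p0 x = y) (stk j)"
    and ok: "ok j" and pre: "\<forall>i<j. ok i"
    by auto
  note inv = run_invariant[OF pre]
  show ?case
  proof (cases "w j = N")
    case True
    let ?k = "cnt j"
    obtain a A where A: "stk j = a # A" using inv by (cases "stk j") auto
    have "?k \<noteq> 1" using cnt_ge[of j] by simp
    then have p0: "p0 ?k = a" using A by (simp add: p0_def tm_cnt[OF True])
    have d: "drop (b ?k) (sky j) = (sky j ! b ?k) # drop (Suc (b ?k)) (sky j)"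
      using ok True by (simp add: ok_def Cons_nth_drop_Suc)
    have "sky j ! b ?k \<in> set (sky j)" using ok True by (simp add: ok_def)
    then have "sky j ! b ?k < ?k" using inv by auto
    then have "adj ?k (sky j ! b ?k)" by (simp add: adj_def p2_def tm_cnt[OF True])
    moreover have "successively adj (drop (b ?k) (sky j))"
    proof -
      have "successively adj (sky j)"
        using IH(1) unfolding front_def by (cases "sky j") auto
      then show ?thesis
        by (metis append_take_drop_id successively_append_iff)
    qed
    ultimately show ?thesis using True A IH p0 d by (auto simp: front_def)
  next
    case False
    obtain a c A where A: "stk j = a # c # A"
      using ok False inv unfolding ok_def by (cases "stk j"; cases "tl (stk j)") auto
    with inv have "c < a" by auto
    then have "adj c a" using IH(2) A by (simp add: adj_def)
    with IH A False show ?thesis by (auto simp: front_def)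
  qed
qed

lemma adj_nth:
  assumes "\<forall>i<j. ok i" "Suc i < length (front j)"
  shows "adj (front j ! i) (front j ! Suc i)"
  using frontier_adj[OF assms(1)] assms(2) by (simp add: successively_conv_nth)

text \<open>\<open>sky\<close> gains vertices from the stack only, and the stack gains only fresh
  ones, so a covered vertex never comes back. This makes the \<open>1\<close>-parent unique.\<close>

lemma popped_gone:
  assumes "\<forall>i<j. ok i" "popped x i" "i < j"
  shows "x < cnt j \<and> x \<notin> set (stk j) \<and> x \<notin> set (sky j)"
  using assms
proof (induction j)
  case (Suc j)
  have inv: "stk j \<noteq> []" "distinct (stk j @ sky j)" "set (stk j @ sky j) \<subseteq> {..<cnt j}"
    using run_invariant[of j] Suc.prems by auto
  have dr: "set (drop (b (cnt j)) (sky j)) \<subseteq> set (sky j)" by (rule set_drop_subset)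
  show ?case
  proof (cases "i = j")
    case True
    then have x: "x \<in> set (take (b (cnt j)) (sky j))" "w j = N" using Suc.prems by (auto simp: popped_def)
    then have "x \<in> set (sky j)" by (meson in_set_takeD)
    with x inv have "x \<notin> set (stk j)" "x < cnt j" by auto
    moreover have "x \<notin> set (drop (b (cnt j)) (sky j))"
      using inv(2) x(1) set_take_disj_set_drop_if_distinct[of "sky j" "b (cnt j)" "b (cnt j)"] by auto
    ultimately show ?thesis using x(2) by auto
  next
    case False
    then have "x < cnt j" "x \<notin> set (stk j)" "x \<notin> set (sky j)" using Suc by auto
    moreover have "hd (stk j) \<in> set (stk j)" "set (tl (stk j)) \<subseteq> set (stk j)"
      using inv by (auto dest: list.set_sel(2))
    ultimately show ?thesis using dr by (cases "w j = N") auto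
  qed
qed auto

lemma popped_unique:
  assumes "\<forall>m<i. ok m" "\<forall>m<j. ok m" "popped x i" "popped x j"
  shows "i = j"
proof -
  have mem: "x \<in> set (sky i)" "x \<in> set (sky j)"
    using assms(3,4) by (auto simp: popped_def dest: in_set_takeD)
  have "\<not> i < j" using popped_gone[OF assms(2,3)] mem(2) by blast
  moreover have "\<not> j < i" using popped_gone[OF assms(1,4)] mem(1) by blast
  ultimately show ?thesis by simp
qed

text \<open>A letter S moves one vertex from the stack to \<open>sky\<close>; a letter N adds one to
  the stack and takes \<open>b\<close> from \<open>sky\<close>. These equations turn
  \<open>ok\<close> into inequalities between prefix sums.\<close>

lemma length_balance:
  assumes "\<forall>i<j. ok i"
  shows "length (stk j) + card {i. i < j \<and> w i = S} = 1 + card {i. i < j \<and> w i = N} \<and>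
    cnt j = 2 + card {i. i < j \<and> w i = N} \<and>
    length (sky j) + (\<Sum>i<j. if w i = N then b (cnt i) else 0) = 1 + card {i. i < j \<and> w i = S}"
  using assms
proof (induction j)
  case (Suc j)
  have [simp]: "{i. i < Suc j \<and> w i = l} = (if w j = l then insert j {i. i < j \<and> w i = l} else {i. i < j \<and> w i = l})" for l
    by (auto simp: less_Suc_eq)
  have "ok j" "stk j \<noteq> []" using Suc.prems run_invariant[of j] by auto
  then show ?case
    using Suc letter_cases[of j] unfolding ok_def by (cases "stk j") auto
qed auto

end

text \<open>Position \<open>2 * n\<close> carries an extra letter N for \<open>v\<^sub>1\<close>. By
  \<open>b_end\<close> its fan covers the path up to \<open>v\<^sub>2\<close>, so only the root face
  stays open.\<close>

locale coding = walk +
  fixes n :: nat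
  assumes ok: "\<And>j. j \<le> 2 * n \<Longrightarrow> ok j"
    and cnt_end: "cnt (2 * n) = n + 2"
    and stk_end: "stk (2 * n) = [0]"
    and last_N: "w (2 * n) = N"
    and b_end: "Suc (b (n + 2)) = length (sky (2 * n))"
begin

lemma oks: "j \<le> 2 * n + 1 \<Longrightarrow> \<forall>i<j. ok i"
  using ok by auto

lemma run:
  assumes "j \<le> 2 * n"
  shows "stk j \<noteq> []" "last (stk j) = 0" "sky j \<noteq> []" "last (sky j) = 1"
    "sorted_wrt (>) (stk j)" "distinct (stk j @ sky j)" "set (stk j) \<subseteq> {..<cnt j}"
    "set (sky j) \<subseteq> {..<cnt j}"
  using run_invariant[of j] assms ok by auto

lemma zero_one_mem:
  assumes "j \<le> 2 * n"
  shows "0 \<in> set (stk j)" "1 \<in> set (sky j)" "1 \<notin> set (stk j)" "0 \<notin> set (sky j)"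
proof -
  show *: "0 \<in> set (stk j)" "1 \<in> set (sky j)"
    using run(1-4)[OF assms] last_in_set by metis+
  then show "1 \<notin> set (stk j)" "0 \<notin> set (sky j)" using run(6)[OF assms] by auto
qed

lemma S_step:
  assumes "j \<le> 2 * n" "w j \<noteq> N"
  obtains a c A where "stk j = a # c # A" "c < a" "2 \<le> a" "j < 2 * n" "w j = S"
proof -
  obtain a c A where A: "stk j = a # c # A"
    using ok[OF assms(1)] assms(2) unfolding ok_def by (cases "stk j"; cases "tl (stk j)") auto
  moreover have "c < a" using run(5)[OF assms(1)] A by auto
  moreover have "a \<noteq> 1" using zero_one_mem(3)[OF assms(1)] A by auto
  moreover have "j < 2 * n" using assms last_N by (cases "j = 2 * n") auto
  ultimately show thesis using that letter_cases[of j] assms(2) by simp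
qed

lemma cnt_le: "j \<le> 2 * n \<Longrightarrow> cnt j \<le> n + 2"
  using cnt_mono[of j "2 * n"] cnt_end by simp

lemma cnt_Suc_end: "cnt (Suc (2 * n)) = n + 3"
  using cnt_end last_N by simp

lemma tm:
  assumes "2 \<le> k" "k \<le> n + 2"
  shows "w (tm k) = N" "cnt (tm k) = k" "tm k \<le> 2 * n"
  using tm_props[of k "Suc (2 * n)"] cnt_Suc_end assms by auto

lemma tm_lt: "2 \<le> k \<Longrightarrow> k \<le> n + 1 \<Longrightarrow> tm k < 2 * n"
  using tm_props[of k "2 * n"] cnt_end by auto

section \<open>Triangles of the fans and their corners\<close>

definition valid :: "nat \<Rightarrow> nat \<Rightarrow> bool" where
  "valid i k \<longleftrightarrow> i = 0 \<and> 1 \<le> k \<and> k \<le> n + 2 \<or> i = 1 \<and> 2 \<le> k \<and> k \<le> n + 1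
     \<or> i = 2 \<and> 2 \<le> k \<and> k \<le> n + 2"

definition code_darts :: "dart set" where
  "code_darts = {d. case d of Tl i k \<Rightarrow> valid i k | Hd i k \<Rightarrow> valid i k}"

text \<open>The triangle between the spokes \<open>i\<close> and \<open>Suc i\<close>, as the
  half-edges met on a walk with the face on the right. \<open>Suc (2 * n)\<close> is not the
  position of a letter; it stands for the root face.\<close>

definition tri :: "nat \<Rightarrow> nat \<Rightarrow> dart list" where
  "tri j i = (if j = Suc (2 * n) then [Hd 0 (n + 2), Tl 2 (n + 2), Tl 0 1]
     else [spoke j i, frontier_dart (front j ! i) (front j ! Suc i), flip (spoke j (Suc i))])"

definition fan :: "(nat \<times> nat) set" where
  "fan = {(j, i). j \<le> 2 * n \<and> w j = N \<and> i \<le> b (cnt j)}"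

definition slots :: "((nat \<times> nat) \<times> nat) set" where
  "slots = insert (Suc (2 * n), 0) fan \<times> {..<3}"

definition at_slot :: "(nat \<times> nat) \<times> nat \<Rightarrow> dart" where
  "at_slot = (\<lambda>((j, i), m). tri j i ! m)"

lemma length_front: "length (front j) = Suc (length (sky j))"
  by (simp add: front_def)

lemma fan_length: "(j, i) \<in> fan \<Longrightarrow> Suc i < length (front j)"
  using ok[of j] by (auto simp: fan_def ok_def length_front)

text \<open>Two neighbours in \<open>sky\<close> stay neighbours until a fan covers the first of
  them, and the final fan covers all that is left. Entry \<open>i'\<close> of \<open>sky\<close> is
  entry \<open>Suc i'\<close> of \<open>front\<close>.\<close>

lemma sky_pair_consumed:
  assumes "j \<le> 2 * n" "Suc i < length (sky j)"
  shows "\<exists>j' i'. (j', Suc i') \<in> fan \<and> sky j' ! i' = sky j ! i \<and> sky j' ! Suc i' = sky j ! Suc i"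
  using assms
proof (induction arbitrary: i rule: inc_induct)
  case base
  then show ?case using last_N cnt_end b_end
    by (intro exI[of _ "2 * n"] exI[of _ i]) (auto simp: fan_def)
next
  case (step m)
  show ?case
  proof (cases "w m = N")
    case True
    show ?thesis
    proof (cases "i < b (cnt m)")
      case True
      then show ?thesis using step.hyps \<open>w m = N\<close>
        by (intro exI[of _ m] exI[of _ i]) (auto simp: fan_def)
    next
      case False
      let ?i = "i - b (cnt m)"
      have "sky (Suc m) ! ?i = sky m ! i" "sky (Suc m) ! Suc ?i = sky m ! Suc i"
        "Suc ?i < length (sky (Suc m))"
        using False step.prems True by auto
      then show ?thesis using step.IH[of ?i] by simp
    qed
  next
    case False
    then show ?thesis using step.IH[of "Suc i"] step.prems by simp
  qed
qed

text \<open>The stack ends as \<open>[0]\<close>, and only a letter S removes an entry.\<close>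

lemma stack_closes:
  assumes "j \<le> 2 * n" "x \<in> set (stk j)" "x \<noteq> 0"
  shows "\<exists>j'. j \<le> j' \<and> j' < 2 * n \<and> w j' = S \<and> hd (stk j') = x"
  using assms
proof (induction rule: inc_induct)
  case base
  then show ?case using stk_end by simp
next
  case (step m)
  show ?case
  proof (cases "w m = S \<and> hd (stk m) = x")
    case False
    have "x \<in> set (stk (Suc m))"
    proof (cases "w m = N")
      case True
      then show ?thesis using step.prems by simp
    next
      case w: False
      then have "hd (stk m) \<noteq> x" using False letter_cases[of m] by auto
      then show ?thesis using w step.prems by (cases "stk m") auto
    qed
    then show ?thesis using step by (meson Suc_leD)
  qed (use step.hyps in auto)
qed

text \<open>If the next letter is N, the path edge at the cursor is the base of the first triangle
  of the new fan. If it is S, the edge moves into \<open>sky\<close> and waits for the fan that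
  covers the cursor vertex; the spoke to this vertex is then its \<open>1\<close>-edge.\<close>

lemma junction:
  assumes "j \<le> 2 * n"
  shows "\<exists>j' i'. (j', i') \<in> fan \<and> frontier_dart (front j' ! i') (front j' ! Suc i') =
    frontier_dart (hd (stk j)) (hd (sky j)) \<and> flip (spoke j' i') = turn j"
proof (cases "w j = N")
  case True
  have "sky j ! 0 = hd (sky j)" using run(3)[OF assms] by (simp add: hd_conv_nth)
  with True assms show ?thesis
    by (intro exI[of _ j] exI[of _ 0]) (auto simp: fan_def front_def spoke_def turn_def)
next
  case False
  then obtain a c A where A: "stk j = a # c # A" "j < 2 * n" using S_step[OF assms] by metis
  have L: "sky (Suc j) = a # sky j" "sky j \<noteq> []" using A False run(3)[OF assms] by auto
  then obtain j' i' where *: "(j', Suc i') \<in> fan" "sky j' ! i' = a" "sky j' ! Suc i' = hd (sky j)"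
    using sky_pair_consumed[of "Suc j" 0] A by (auto simp: hd_conv_nth)
  then have "flip (spoke j' (Suc i')) = turn j"
    using A False by (auto simp: spoke_def turn_def fan_def front_def)
  with * A show ?thesis by (intro exI[of _ j'] exI[of _ "Suc i'"]) (auto simp: front_def)
qed

lemma closed_at:
  assumes "2 \<le> x" "x \<le> n + 1"
  shows "\<exists>j. tm x < j \<and> j < 2 * n \<and> w j = S \<and> hd (stk j) = x"
proof -
  have "x \<in> set (stk (Suc (tm x)))" using tm[of x] assms by simp
  then obtain j where "Suc (tm x) \<le> j" "j < 2 * n" "w j = S" "hd (stk j) = x"
    using stack_closes[of "Suc (tm x)" x] tm_lt[OF assms] assms(1) by auto
  then show ?thesis using Suc_le_lessD by blast
qed

text \<open>The letter S that leaves \<open>x\<close> puts it before a neighbour in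
  \<open>sky\<close>; consuming that pair covers \<open>x\<close>.\<close>

lemma popped_at:
  assumes "2 \<le> x" "x \<le> n + 1"
  shows "\<exists>j i. (j, Suc i) \<in> fan \<and> sky j ! i = x"
proof -
  obtain j where j: "j < 2 * n" "w j = S" "hd (stk j) = x" using closed_at[OF assms] by auto
  then have "sky (Suc j) = x # sky j" "sky j \<noteq> []" using run(3)[of j] by auto
  then show ?thesis using sky_pair_consumed[of "Suc j" 0] j by fastforce
qed

lemma hd0_junction:
  assumes "2 \<le> x" "x \<le> n + 1"
  shows "\<exists>j\<le>2 * n. frontier_dart (hd (stk j)) (hd (sky j)) = Hd 0 x"
proof -
  obtain j where j: "j < 2 * n" "w j = S" "hd (stk j) = x" using closed_at[OF assms] by auto
  then obtain a c A where "stk j = a # c # A" "c < a"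
    using S_step[of j] by (metis letter.distinct(1) less_imp_le)
  with j show ?thesis by (intro exI[of _ "Suc j"]) (auto simp: frontier_dart_def)
qed

lemma tl2_junction:
  assumes "2 \<le> x" "x \<le> n + 1"
  shows "frontier_dart (hd (stk (Suc (tm x)))) (hd (sky (Suc (tm x)))) = Tl 2 x"
proof -
  note t = tm[of x] tm_lt[OF assms]
  have "b x < length (sky (tm x))" using ok[of "tm x"] t assms by (auto simp: ok_def)
  then have "hd (drop (b x) (sky (tm x))) \<in> set (sky (tm x))"
    by (metis hd_drop_conv_nth nth_mem)
  then have "hd (drop (b x) (sky (tm x))) < x" using run(8)[of "tm x"] t assms by auto
  then show ?thesis using t assms by (simp add: frontier_dart_def)
qed

text \<open>\<open>0\<close>-tails and \<open>2\<close>-heads bound the fans, and half-edges of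
  color \<open>1\<close> are inner spokes. The \<open>0\<close>-heads and \<open>2\<close>-tails
  become path edges at the cursor, right after their vertex is left or attached, and
  \<open>junction\<close> applies. The root face takes the three half-edges that remain.\<close>

lemma slot_cover:
  assumes "d \<in> code_darts"
  shows "d \<in> at_slot ` slots"
proof -
  have slotI: "at_slot ((j, i), m) \<in> at_slot ` slots" if "(j, i) \<in> fan" "m < 3" for j i m
    using that by (auto simp: slots_def)
  have root: "tri (Suc (2 * n)) 0 ! m \<in> at_slot ` slots" if "m < 3" for m
    using that by (intro image_eqI[of _ _ "((Suc (2 * n), 0), m)"]) (auto simp: slots_def at_slot_def)
  have spk: "spoke j i \<in> at_slot ` slots" if "(j, i) \<in> fan" for j i
    using slotI[OF that, of 0] that by (auto simp: at_slot_def tri_def fan_def)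
  have fsp: "flip (spoke j (Suc i)) \<in> at_slot ` slots" if "(j, i) \<in> fan" for j i
    using slotI[OF that, of 2] that by (auto simp: at_slot_def tri_def fan_def)
  have fr: "frontier_dart (front j ! i) (front j ! Suc i) \<in> at_slot ` slots" if "(j, i) \<in> fan" for j i
    using slotI[OF that, of 1] that by (auto simp: at_slot_def tri_def fan_def)
  have jn: "frontier_dart (hd (stk j)) (hd (sky j)) \<in> at_slot ` slots" if "j \<le> 2 * n" for j
    using junction[OF that] fr by metis
  have roots: "Hd 0 (n + 2) \<in> at_slot ` slots" "Tl 2 (n + 2) \<in> at_slot ` slots" "Tl 0 1 \<in> at_slot ` slots"
    using root[of 0] root[of 1] root[of 2] by (auto simp: tri_def)
  have "Tl 0 k \<in> at_slot ` slots" if "2 \<le> k" "k \<le> n + 2" for k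
    using spk[of "tm k" 0] tm[OF that] by (auto simp: fan_def spoke_def)
  moreover have "Hd 2 k \<in> at_slot ` slots" if "2 \<le> k" "k \<le> n + 2" for k
    using fsp[of "tm k" "b k"] tm[OF that] by (auto simp: fan_def spoke_def)
  moreover have "Hd 0 1 \<in> at_slot ` slots" using jn[of 0] by (simp add: frontier_dart_def)
  moreover have "Hd 0 x \<in> at_slot ` slots" "Tl 2 x \<in> at_slot ` slots" if "2 \<le> x" "x \<le> n + 1" for x
    using hd0_junction[OF that] tl2_junction[OF that] jn[of "Suc (tm x)"] jn tm_lt[OF that] by force+
  moreover have "Hd 1 x \<in> at_slot ` slots" "Tl 1 x \<in> at_slot ` slots" if x: "2 \<le> x" "x \<le> n + 1" for x
  proof -
    obtain j i where ji: "(j, Suc i) \<in> fan" "sky j ! i = x"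
      using popped_at[OF x] by blast
    then have "spoke j (Suc i) = Hd 1 x" "(j, i) \<in> fan" by (auto simp: spoke_def fan_def front_def)
    then show "Hd 1 x \<in> at_slot ` slots" "Tl 1 x \<in> at_slot ` slots" using spk[OF ji(1)] fsp[of j i] by simp_all
  qed
  ultimately have all: "Tl i k \<in> at_slot ` slots \<and> Hd i k \<in> at_slot ` slots" if "valid i k" for i k
  proof -
    have "k = 1 \<or> k = n + 2 \<or> 2 \<le> k \<and> k \<le> n + 1" using that by (auto simp: valid_def)
    then show ?thesis using that roots \<open>Hd 0 1 \<in> _\<close>
      \<open>\<And>k. 2 \<le> k \<Longrightarrow> k \<le> n + 2 \<Longrightarrow> Tl 0 k \<in> at_slot ` slots\<close>
      \<open>\<And>k. 2 \<le> k \<Longrightarrow> k \<le> n + 2 \<Longrightarrow> Hd 2 k \<in> at_slot ` slots\<close>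
      \<open>\<And>x. 2 \<le> x \<Longrightarrow> x \<le> n + 1 \<Longrightarrow> Hd 0 x \<in> at_slot ` slots\<close>
      \<open>\<And>x. 2 \<le> x \<Longrightarrow> x \<le> n + 1 \<Longrightarrow> Tl 2 x \<in> at_slot ` slots\<close>
      \<open>\<And>x. 2 \<le> x \<Longrightarrow> x \<le> n + 1 \<Longrightarrow> Hd 1 x \<in> at_slot ` slots\<close>
      \<open>\<And>x. 2 \<le> x \<Longrightarrow> x \<le> n + 1 \<Longrightarrow> Tl 1 x \<in> at_slot ` slots\<close>
      unfolding valid_def by auto
  qed
  show ?thesis using assms all by (cases d) (auto simp: code_darts_def)
qed

lemma valid_set: "{(i, k). valid i k} = {0} \<times> {1..n + 2} \<union> ({1} \<times> {2..n + 1} \<union> {2} \<times> {2..n + 2})"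
  by (auto simp: valid_def)

lemma finite_valid: "finite {(i, k). valid i k}"
  unfolding valid_set by simp

lemma card_valid: "card {(i, k). valid i k} = 3 * n + 3"
proof -
  have "card ({0} \<times> {1..n + 2} \<union> ({1} \<times> {2..n + 1} \<union> {2::nat} \<times> {2..n + 2})) =
      card ({0::nat} \<times> {1..n + 2}) + card ({1} \<times> {2..n + 1} \<union> {2::nat} \<times> {2..n + 2})"
    by (rule card_Un_disjoint) auto
  also have "card ({1} \<times> {2..n + 1} \<union> {2::nat} \<times> {2..n + 2}) =
      card ({1::nat} \<times> {2..n + 1}) + card ({2::nat} \<times> {2..n + 2})"
    by (rule card_Un_disjoint) auto
  finally show ?thesis unfolding valid_set by (simp add: card_cartesian_product)
qed

lemma code_darts_eq:
  "code_darts = case_prod Tl ` {(i, k). valid i k} \<union> case_prod Hd ` {(i, k). valid i k}"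
proof -
  have "d \<in> code_darts \<longleftrightarrow> d \<in> case_prod Tl ` {(i, k). valid i k} \<union> case_prod Hd ` {(i, k). valid i k}" for d
    by (cases d) (auto simp: code_darts_def)
  then show ?thesis by blast
qed

lemma finite_code_darts: "finite code_darts"
  unfolding code_darts_eq using finite_valid by simp

lemma card_code_darts: "card code_darts = 6 * n + 6"
proof -
  have "card code_darts =
      card (case_prod Tl ` {(i, k). valid i k}) + card (case_prod Hd ` {(i, k). valid i k})"
    unfolding code_darts_eq by (rule card_Un_disjoint) (use finite_valid in auto)
  also have "card (case_prod Tl ` {(i, k). valid i k}) = 3 * n + 3"
    by (subst card_image) (auto simp: inj_on_def card_valid)
  also have "card (case_prod Hd ` {(i, k). valid i k}) = 3 * n + 3"
    by (subst card_image) (auto simp: inj_on_def card_valid)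
  finally show ?thesis by simp
qed

text \<open>There are \<open>n + 1\<close> letters N, the extra one included, and by
  \<open>length_balance\<close> and \<open>b_end\<close> their fans cover \<open>n\<close> vertices
  in all.\<close>

lemma card_fan: "card fan = 2 * n + 1"
proof -
  have fan: "fan = (SIGMA j:{j. j \<le> 2 * n \<and> w j = N}. {..b (cnt j)})"
    by (auto simp: fan_def)
  have "card fan = (\<Sum>j | j \<le> 2 * n \<and> w j = N. Suc (b (cnt j)))"
    unfolding fan by (subst card_SigmaI) auto
  also have "{j. j \<le> 2 * n \<and> w j = N} = insert (2 * n) {j. j < 2 * n \<and> w j = N}"
    using last_N by auto
  also have "(\<Sum>j\<in>insert (2 * n) {j. j < 2 * n \<and> w j = N}. Suc (b (cnt j))) =
    Suc (b (n + 2)) + (\<Sum>j | j < 2 * n \<and> w j = N. b (cnt j)) + card {j. j < 2 * n \<and> w j = N}"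
    using cnt_end by (simp add: sum_Suc)
  also have "(\<Sum>j | j < 2 * n \<and> w j = N. b (cnt j)) = (\<Sum>i<2 * n. if w i = N then b (cnt i) else 0)"
    by (subst sum.inter_filter[symmetric]) (auto intro: sum.cong)
  finally show ?thesis
    using length_balance[of "2 * n"] ok cnt_end stk_end b_end by simp
qed

lemma finite_slots: "finite slots" and card_slots: "card slots = 6 * n + 6"
proof -
  have fan: "fan = (SIGMA j:{j. j \<le> 2 * n \<and> w j = N}. {..b (cnt j)})"
    by (auto simp: fan_def)
  then have "finite fan" by auto
  moreover have "(Suc (2 * n), 0) \<notin> fan" by (simp add: fan_def)
  ultimately show "finite slots" "card slots = 6 * n + 6"
    by (simp_all add: slots_def card_cartesian_product card_fan)
qed

text \<open>
  Every dart lies on some triangle, and there are as many corners of triangles as darts, so no dart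
  lies on two of them.
\<close>

theorem slots_bij: "bij_betw at_slot slots code_darts"
proof -
  have sub: "code_darts \<subseteq> at_slot ` slots" using slot_cover by auto
  have le: "card (at_slot ` slots) \<le> card code_darts"
    using card_image_le[OF finite_slots] by (simp add: card_slots card_code_darts)
  have eq: "code_darts = at_slot ` slots"
    using sub le finite_slots by (simp add: card_seteq)
  then have "inj_on at_slot slots"
    using finite_slots by (simp add: eq_card_imp_inj_on card_slots card_code_darts flip: eq)
  with eq show ?thesis by (simp add: bij_betw_def)
qed

section \<open>The rotation determined by the triangles\<close>

definition face_dart :: "dart \<Rightarrow> dart" where
  "face_dart d = (case inv_into slots at_slot d of (t, m) \<Rightarrow> at_slot (t, Suc m mod 3))"

text \<open>\<open>face_next\<close> satisfies \<open>rot (face_next h) = opp h\<close>, so the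
  rotation is \<open>flip\<close> after the inverse of \<open>face_dart\<close>. On triangles this
  inverse is the square of \<open>face_dart\<close>.\<close>

definition rot_dart :: "dart \<Rightarrow> dart" where
  "rot_dart d = (if d \<in> code_darts then flip (face_dart (face_dart d)) else d)"

lemma at_slot_in: "s \<in> slots \<Longrightarrow> at_slot s \<in> code_darts"
  using slots_bij by (auto simp: bij_betw_def)

lemma face_dart_slot: "(t, m) \<in> slots \<Longrightarrow> face_dart (at_slot (t, m)) = at_slot (t, Suc m mod 3)"
  using slots_bij by (simp add: face_dart_def bij_betw_def inv_into_f_f)

lemma rot_dart_slot: "(t, m) \<in> slots \<Longrightarrow> rot_dart (at_slot (t, m)) = flip (at_slot (t, (m + 2) mod 3))"
proof -
  assume a: "(t, m) \<in> slots"
  then have "(t, Suc m mod 3) \<in> slots" by (auto simp: slots_def)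
  with a show ?thesis by (simp add: rot_dart_def at_slot_in face_dart_slot mod_Suc_eq)
qed

lemma code_darts_flip [simp]: "flip d \<in> code_darts \<longleftrightarrow> d \<in> code_darts"
  by (cases d) (auto simp: code_darts_def)

lemma rot_in: "d \<in> code_darts \<Longrightarrow> rot_dart d \<in> code_darts"
proof -
  assume "d \<in> code_darts"
  then obtain t m where tm: "(t, m) \<in> slots" "d = at_slot (t, m)"
    using slots_bij unfolding bij_betw_def by (metis imageE surj_pair)
  then have "(t, (m + 2) mod 3) \<in> slots" by (auto simp: slots_def)
  then show ?thesis using tm rot_dart_slot at_slot_in by simp
qed

lemma rot_permutes: "rot_dart permutes code_darts"
proof -
  have "inj_on rot_dart code_darts"
  proof (rule inj_onI)
    fix d e assume d: "d \<in> code_darts" and e: "e \<in> code_darts" and eq: "rot_dart d = rot_dart e"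
    obtain t m where tm: "(t, m) \<in> slots" "d = at_slot (t, m)"
      using d slots_bij unfolding bij_betw_def by (metis imageE surj_pair)
    obtain t' m' where tm': "(t', m') \<in> slots" "e = at_slot (t', m')"
      using e slots_bij unfolding bij_betw_def by (metis imageE surj_pair)
    have "at_slot (t, (m + 2) mod 3) = at_slot (t', (m' + 2) mod 3)"
      using eq tm tm' by (simp add: rot_dart_slot)
    moreover have "(t, (m + 2) mod 3) \<in> slots" "(t', (m' + 2) mod 3) \<in> slots"
      using tm tm' by (auto simp: slots_def)
    ultimately have "t = t'" "(m + 2) mod 3 = (m' + 2) mod 3"
      using slots_bij by (auto simp: bij_betw_def dest: inj_onD)
    moreover have "m < 3" "m' < 3" using tm tm' by (auto simp: slots_def)
    ultimately have "m = m'" by presburger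
    with \<open>t = t'\<close> tm tm' show "d = e" by simp
  qed
  then have "bij_betw rot_dart code_darts code_darts"
    using rot_in finite_code_darts by (simp add: bij_betw_def endo_inj_surj image_subset_iff)
  then show ?thesis by (rule bij_imp_permutes) (simp add: rot_dart_def)
qed

lemma rot_spoke: "(j, i) \<in> fan \<Longrightarrow> rot_dart (spoke j i) = spoke j (Suc i)"
  using rot_dart_slot[of "(j, i)" 0] by (auto simp: slots_def at_slot_def tri_def fan_def)

lemma rot_frontier: "(j, i) \<in> fan \<Longrightarrow>
    rot_dart (frontier_dart (front j ! i) (front j ! Suc i)) = flip (spoke j i)"
  using rot_dart_slot[of "(j, i)" 1] by (auto simp: slots_def at_slot_def tri_def fan_def)

lemma rot_flip_spoke: "(j, i) \<in> fan \<Longrightarrow>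
    rot_dart (flip (spoke j (Suc i))) = flip (frontier_dart (front j ! i) (front j ! Suc i))"
  using rot_dart_slot[of "(j, i)" 2]
  by (auto simp: slots_def at_slot_def tri_def fan_def)

lemma rot_root: "rot_dart (Hd 0 (n + 2)) = Hd 0 1" "rot_dart (Tl 2 (n + 2)) = Tl 0 (n + 2)"
  "rot_dart (Tl 0 1) = Hd 2 (n + 2)"
proof -
  have t: "at_slot ((Suc (2 * n), 0), 0) = Hd 0 (n + 2)"
    "at_slot ((Suc (2 * n), 0), 1) = Tl 2 (n + 2)" "at_slot ((Suc (2 * n), 0), 2) = Tl 0 1"
    by (simp_all add: at_slot_def tri_def)
  have s: "((Suc (2 * n), 0), m) \<in> slots" if "m < 3" for m
    using that by (simp add: slots_def)
  show "rot_dart (Hd 0 (n + 2)) = Hd 0 1"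
    using rot_dart_slot[OF s, of 0] unfolding t(1) by (simp add: t(3) del: add_2_eq_Suc')
  show "rot_dart (Tl 2 (n + 2)) = Tl 0 (n + 2)"
    using rot_dart_slot[OF s, of 1] unfolding t(2) by (simp add: t(1) del: add_2_eq_Suc')
  show "rot_dart (Tl 0 1) = Hd 2 (n + 2)"
    using rot_dart_slot[OF s, of 2] unfolding t(3) using t(2) by (simp del: add_2_eq_Suc')
qed

lemma rot_junction: "j \<le> 2 * n \<Longrightarrow> rot_dart (frontier_dart (hd (stk j)) (hd (sky j))) = turn j"
  using junction rot_frontier by metis

lemma dart_cases:
  assumes "d \<in> code_darts"
  obtains (spoke) j i where "(j, i) \<in> fan" "d = spoke j i"
    | (frontier) j i where "(j, i) \<in> fan" "d = frontier_dart (front j ! i) (front j ! Suc i)"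
    | (flip_spoke) j i where "(j, i) \<in> fan" "d = flip (spoke j (Suc i))"
    | (root) "d = Hd 0 (n + 2) \<or> d = Tl 2 (n + 2) \<or> d = Tl 0 1"
proof -
  obtain j i m where t: "((j, i), m) \<in> slots" "d = at_slot ((j, i), m)"
    using assms slots_bij unfolding bij_betw_def by (metis imageE surj_pair)
  then have m: "m = 0 \<or> m = 1 \<or> m = 2" by (auto simp: slots_def)
  show thesis
  proof (cases "j = Suc (2 * n)")
    case True
    then show thesis using root t m by (auto simp: at_slot_def tri_def)
  next
    case False
    then have "(j, i) \<in> fan" using t by (auto simp: slots_def)
    then show thesis using spoke frontier flip_spoke t m False by (auto simp: at_slot_def tri_def)
  qed
qed

end

section \<open>Vertices of a coded map\<close>

lemma successively_nth_funpow:
  assumes "successively (\<lambda>x y. y = f x) (a # xs)" "i \<le> length xs"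
  shows "(a # xs) ! i = (f ^^ i) a"
  using assms(2)
proof (induction i)
  case (Suc i)
  then have "(a # xs) ! Suc i = f ((a # xs) ! i)"
    using assms(1) by (simp add: successively_conv_nth)
  with Suc show ?case by simp
qed simp

lemma orbit_list:
  assumes "successively (\<lambda>x y. y = f x) (a # xs @ [a])" "a \<notin> set xs"
  shows "orbit f a = set (a # xs)" "distinct (a # xs)"
    "map (\<lambda>i. (f ^^ i) a) [0..<card (orbit f a)] = a # xs"
proof -
  let ?m = "Suc (length xs)"
  have nth: "(f ^^ i) a = (a # xs) ! i" if "i < ?m" for i
    using successively_nth_funpow[OF assms(1), of i] that by (cases i) (auto simp: nth_append)
  have per: "(f ^^ ?m) a = a"
    using successively_nth_funpow[OF assms(1), of ?m] by (simp add: nth_append)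
  have l: "map (\<lambda>i. (f ^^ i) a) [0..<?m] = a # xs"
    by (rule nth_equalityI) (auto simp: nth simp del: upt_Suc)
  have "orbit f a = (\<lambda>i. (f ^^ i) a) ` {0..<?m}"
    unfolding orbit_altdef_bounded[OF per zero_less_Suc] by auto
  also have "\<dots> = set (map (\<lambda>i. (f ^^ i) a) [0..<?m])" by (simp only: set_map set_upt)
  finally show orb: "orbit f a = set (a # xs)" unfolding l .
  show d: "distinct (a # xs)"
    unfolding distinct_conv_nth
  proof (intro allI impI)
    \<comment> \<open>If two powers agreed, \<open>?m - j\<close> more applications of
      \<open>f\<close> would bring \<open>a\<close> back before the period \<open>?m\<close>, hence
      inside \<open>xs\<close>.\<close>
    have aux: "(f ^^ i) a \<noteq> (f ^^ j) a" if "i < j" "j < ?m" for i j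
    proof
      assume eq: "(f ^^ i) a = (f ^^ j) a"
      have "(f ^^ (?m - j + i)) a = (f ^^ (?m - j)) ((f ^^ i) a)" by (simp add: funpow_add)
      also have "\<dots> = (f ^^ (?m - j + j)) a" unfolding eq by (simp only: funpow_add o_apply)
      also have "\<dots> = a" using that per by simp
      finally have "(a # xs) ! (?m - j + i) = a" using nth[of "?m - j + i"] that by simp
      moreover have "?m - j + i \<noteq> 0" using that by simp
      then obtain q where "?m - j + i = Suc q" by (cases "?m - j + i") auto
      moreover have "?m - j + i < ?m" using that by simp
      ultimately have "xs ! q = a" "q < length xs" by auto
      then show False using assms(2) by (metis nth_mem)
    qed
    fix i j assume "i < length (a # xs)" "j < length (a # xs)" "i \<noteq> j"
    then show "(a # xs) ! i \<noteq> (a # xs) ! j"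
      using aux[of i j] aux[of j i] nth[of i] nth[of j] by (cases i j rule: linorder_cases) simp_all
  qed
  then have "card (orbit f a) = ?m" unfolding orb by (metis distinct_card length_Cons)
  with l show "map (\<lambda>i. (f ^^ i) a) [0..<card (orbit f a)] = a # xs" by metis
qed

lemma successively_orbit:
  "successively (\<lambda>x y. y = f x) (a # xs @ [e]) \<Longrightarrow> e \<in> orbit f a"
proof (induction xs arbitrary: a)
  case Nil
  then show ?case by (auto intro: orbit.base)
next
  case (Cons c xs)
  then have "e \<in> orbit f c" "c = f a" by auto
  then show ?case by (auto intro: orbit_subset)
qed

context coding
begin

definition p1 :: "nat \<Rightarrow> nat" where
  "p1 x = cnt (THE j. j \<le> 2 * n \<and> popped x j)"

definition par :: "nat \<Rightarrow> nat \<Rightarrow> nat" where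
  "par i k = (if i = 0 then p0 k else if i = 1 then p1 k else p2 k)"

primrec org :: "dart \<Rightarrow> nat" where
  "org (Tl i k) = k"
| "org (Hd i k) = par i k"

lemma fanD: "(j, i) \<in> fan \<Longrightarrow> j \<le> 2 * n \<and> w j = N \<and> i \<le> b (cnt j)"
  by (simp add: fan_def)

lemma b_lt: "j \<le> 2 * n \<Longrightarrow> w j = N \<Longrightarrow> b (cnt j) < length (sky j)"
  using ok[of j] by (simp add: ok_def)

lemma popped_nth: "j \<le> 2 * n \<Longrightarrow> w j = N \<Longrightarrow> i < b (cnt j) \<Longrightarrow> popped (sky j ! i) j"
  using b_lt[of j] by (auto simp: popped_def in_set_conv_nth)

lemma p1_eq:
  assumes "j \<le> 2 * n" "w j = N" "i < b (cnt j)"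
  shows "p1 (sky j ! i) = cnt j"
proof -
  have "(THE j'. j' \<le> 2 * n \<and> popped (sky j ! i) j') = j"
  proof (rule the_equality)
    show "j \<le> 2 * n \<and> popped (sky j ! i) j" using popped_nth[OF assms] assms by simp
    show "j' = j" if "j' \<le> 2 * n \<and> popped (sky j ! i) j'" for j'
      using popped_unique[OF oks oks, of j' j "sky j ! i"] that popped_nth[OF assms] assms(1) by simp
  qed
  then show ?thesis by (simp add: p1_def)
qed

lemma org_frontier:
  assumes "(j, i) \<in> fan"
  shows "org (frontier_dart (front j ! i) (front j ! Suc i)) = front j ! i"
    "org (flip (frontier_dart (front j ! i) (front j ! Suc i))) = front j ! Suc i"
  using adj_nth[OF oks fan_length[OF assms]] fanD[OF assms]
  by (auto simp: adj_def frontier_dart_def par_def)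

lemma org_spoke:
  assumes "j \<le> 2 * n" "w j = N" "i \<le> Suc (b (cnt j))"
  shows "org (spoke j i) = cnt j" "org (flip (spoke j i)) = front j ! i"
proof -
  have i: "i = 0 \<or> (\<exists>i'. i = Suc i' \<and> i' < b (cnt j)) \<or> i = Suc (b (cnt j))"
    using assms(3) by (cases i) auto
  have [simp]: "cnt j \<noteq> Suc 0" using cnt_ge[of j] by simp
  show "org (spoke j i) = cnt j" "org (flip (spoke j i)) = front j ! i"
    using i p1_eq[OF assms(1,2)] tm_cnt[OF assms(2)]
    by (auto simp: spoke_def par_def front_def p0_def p2_def)
qed

lemma p2_end: "p2 (n + 2) = 1"
proof -
  have "b (n + 2) = length (sky (2 * n)) - 1" using b_end by simp
  then show ?thesis
    using tm_cnt[OF last_N] cnt_end run(3,4)[of "2 * n"] by (simp add: p2_def last_conv_nth)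
qed

lemma p0_end: "p0 (n + 2) = 0"
  using tm_cnt[OF last_N] cnt_end stk_end by (simp add: p0_def)

text \<open>It suffices to look at the three corners of a triangle. So a cycle of the rotation stays
  at one vertex; \<open>base_orbit\<close> gives the converse.\<close>

lemma org_rot:
  assumes "d \<in> code_darts"
  shows "org (rot_dart d) = org d"
  using assms
proof (cases rule: dart_cases)
  case (spoke j i)
  then show ?thesis using fanD[OF spoke(1)] by (simp add: rot_spoke org_spoke)
next
  case (frontier j i)
  then show ?thesis using fanD[OF frontier(1)] by (simp add: rot_frontier org_frontier org_spoke)
next
  case (flip_spoke j i)
  then show ?thesis using fanD[OF flip_spoke(1)] by (simp add: rot_flip_spoke org_frontier org_spoke)
next
  case root
  have "p0 1 = 0" by (simp add: p0_def)
  then show ?thesis using root rot_root p0_end p2_end by (auto simp: par_def)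
qed

lemma par0:
  assumes "1 \<le> k" "k \<le> n + 2"
  shows "par 0 k < k" "par 0 k = 0 \<or> 2 \<le> par 0 k \<and> par 0 k \<le> n + 1"
proof -
  have "par 0 k < k \<and> par 0 k \<noteq> 1" if "k \<noteq> 1"
  proof -
    have k: "2 \<le> k" using that assms by simp
    note t = tm[OF k assms(2)]
    have "hd (stk (tm k)) \<in> set (stk (tm k))" using run(1)[OF t(3)] by simp
    moreover have "par 0 k = hd (stk (tm k))" using k by (simp add: par_def p0_def)
    ultimately show ?thesis using run(7)[OF t(3)] t(2) zero_one_mem(3)[OF t(3)] by auto
  qed
  moreover have "par 0 1 = 0" by (simp add: par_def p0_def)
  ultimately show "par 0 k < k" "par 0 k = 0 \<or> 2 \<le> par 0 k \<and> par 0 k \<le> n + 1"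
    using assms by (cases "k = 1"; force)+
qed

text \<open>Only \<open>1\<close>-edges lead to a later vertex, because the vertex that covers
  \<open>k\<close> is attached after \<open>k\<close>.\<close>

lemma par1:
  assumes "2 \<le> k" "k \<le> n + 1"
  shows "k < par 1 k" "par 1 k \<le> n + 2"
proof -
  obtain j i where ji: "(j, Suc i) \<in> fan" "sky j ! i = k" using popped_at[OF assms] by auto
  then have j: "j \<le> 2 * n" "w j = N" "i < b (cnt j)" using fanD by fastforce+
  then have "par 1 k = cnt j" using p1_eq ji by (auto simp: par_def)
  moreover have "k \<in> set (sky j)" using ji j b_lt by fastforce
  ultimately show "k < par 1 k" "par 1 k \<le> n + 2" using run(8)[OF j(1)] cnt_le[OF j(1)] by auto
qed

lemma par2:
  assumes "2 \<le> k" "k \<le> n + 2"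
  shows "par 2 k < k" "1 \<le> par 2 k"
proof -
  note t = tm[OF assms]
  have "p2 k \<in> set (sky (tm k))" using b_lt[OF t(3,1)] t(2) by (simp add: p2_def)
  moreover from this have "p2 k \<noteq> 0" using zero_one_mem(4)[OF t(3)] by metis
  ultimately have "p2 k < k" "p2 k \<noteq> 0" using run(8)[OF t(3)] t(2) by auto
  then show "par 2 k < k" "1 \<le> par 2 k" by (auto simp: par_def)
qed

lemma Hd_frontier:
  assumes "Hd 0 y \<in> code_darts" "y \<noteq> n + 2"
  obtains j i where "(j, i) \<in> fan" "front j ! Suc i = y" "front j ! i = par 0 y"
    "Hd 0 y = frontier_dart (front j ! i) (front j ! Suc i)"
  using assms(1)
proof (cases rule: dart_cases)
  case (frontier j i)
  have "front j ! Suc i = y" "front j ! i = par 0 y"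
    using org_frontier[OF frontier(1)] unfolding frontier(2)[symmetric] by simp_all
  with that[OF frontier(1)] frontier(2) show thesis by blast
qed (use assms(2) in \<open>auto simp: spoke_def split: if_splits\<close>)

text \<open>If the path edge to \<open>y\<close> is the first under a fan, the \<open>0\<close>-edge
  of the new vertex comes next at its origin. Otherwise a spoke comes next, and it is the
  \<open>1\<close>-edge of the parent. The increase to \<open>y'\<close> makes the induction of
  \<open>steps_0_aux\<close> work.\<close>

lemma rot_Hd0:
  assumes "1 \<le> y" "y \<le> n + 1"
  shows "(\<exists>y'. y < y' \<and> y' \<le> n + 2 \<and> par 0 y' = par 0 y \<and> rot_dart (Hd 0 y) = Hd 0 y') \<or>
    par 0 y \<noteq> 0 \<and> rot_dart (Hd 0 y) = Tl 1 (par 0 y)"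
proof -
  have d: "Hd 0 y \<in> code_darts" using assms by (simp add: code_darts_def valid_def)
  obtain j i where ji: "(j, i) \<in> fan" "front j ! Suc i = y" "front j ! i = par 0 y"
    "Hd 0 y = frontier_dart (front j ! i) (front j ! Suc i)"
    by (rule Hd_frontier[OF d]) (use assms in simp_all)
  note f = fanD[OF ji(1)]
  then have j: "j \<le> 2 * n" "w j = N" by auto
  have rot: "rot_dart (Hd 0 y) = flip (spoke j i)" using rot_frontier[OF ji(1)] ji(4) by simp
  show ?thesis
  proof (cases "i = 0")
    case True
    then have "y = sky j ! 0" "0 < length (sky j)" using ji(2) b_lt[of j] f by (auto simp: front_def)
    then have "y \<in> set (sky j)" by simp
    then have "y < cnt j" using run(8)[of j] f by auto
    moreover have "rot_dart (Hd 0 y) = Hd 0 (cnt j)" using rot True by (simp add: spoke_def)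
    moreover from this have "par 0 (cnt j) = par 0 y" using org_rot[OF d] by simp
    ultimately show ?thesis using cnt_le[OF j(1)] by auto
  next
    case False
    then have "rot_dart (Hd 0 y) = Tl 1 (par 0 y)" using rot f ji(3) by (simp add: spoke_def)
    moreover from this have "Tl 1 (par 0 y) \<in> code_darts" using rot_in[OF d] by simp
    then have "par 0 y \<noteq> 0" by (simp add: code_darts_def valid_def)
    ultimately show ?thesis by simp
  qed
qed

text \<open>The letter after the one that attaches \<open>k\<close> decides: N brings a first child,
  S ends the visit at \<open>k\<close>.\<close>

lemma rot_Tl2:
  assumes "2 \<le> k" "k \<le> n + 1"
  shows "(\<exists>y. 1 \<le> y \<and> y \<le> n + 1 \<and> par 0 y = k \<and> rot_dart (Tl 2 k) = Hd 0 y) \<or> rot_dart (Tl 2 k) = Tl 1 k"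
proof -
  note t = tm[of k] tm_lt[OF assms]
  then have le: "Suc (tm k) \<le> 2 * n" using assms by simp
  have d: "Tl 2 k \<in> code_darts" using assms by (simp add: code_darts_def valid_def)
  have rot: "rot_dart (Tl 2 k) = turn (Suc (tm k))"
    using rot_junction[OF le] unfolding tl2_junction[OF assms] by simp
  show ?thesis
  proof (cases "w (Suc (tm k)) = N")
    case True
    then have y: "rot_dart (Tl 2 k) = Hd 0 (cnt (Suc (tm k)))" using rot by (simp add: turn_def)
    then have p: "par 0 (cnt (Suc (tm k))) = k" using org_rot[OF d] by simp
    moreover have "par 0 (n + 2) = 0" using p0_end by (simp add: par_def)
    ultimately have "cnt (Suc (tm k)) \<noteq> n + 2" using assms by auto
    then show ?thesis using y p cnt_le[OF le] cnt_ge[of "Suc (tm k)"]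
      by (intro disjI1 exI[of _ "cnt (Suc (tm k))"]) auto
  next
    case False
    then show ?thesis using rot t assms by (simp add: turn_def)
  qed
qed

text \<open>Behind the outer end of a spoke comes the path edge that ends there. It arrives either
  by climbing the \<open>0\<close>-edge of this vertex or by descending a \<open>2\<close>-edge,
  whose tail is then older than the vertex of the fan. This decrease makes the induction of
  \<open>steps_2_aux\<close> work.\<close>

lemma rot_to_2:
  assumes "d = Tl 1 k \<and> 2 \<le> k \<and> k \<le> n + 1 \<or> d = Hd 2 k \<and> 2 \<le> k \<and> k \<le> n + 2"
  shows "rot_dart d = Tl 0 (org d) \<or>
    (\<exists>k'. 2 \<le> k' \<and> k' \<le> n + 2 \<and> (d = Hd 2 k \<longrightarrow> k' < k) \<and> par 2 k' = org d \<and> rot_dart d = Hd 2 k')"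
proof -
  have d: "d \<in> code_darts" using assms by (auto simp: code_darts_def valid_def)
  from d obtain j i where ji: "(j, i) \<in> fan" "d = flip (spoke j (Suc i))"
  proof (cases rule: dart_cases)
    case (flip_spoke j i)
    then show thesis using that by blast
  qed (use assms in \<open>auto simp: spoke_def frontier_dart_def split: if_splits\<close>)
  note f = fanD[OF ji(1)]
  let ?x = "front j ! i" and ?y = "front j ! Suc i"
  have rot: "rot_dart d = flip (frontier_dart ?x ?y)" using rot_flip_spoke[OF ji(1)] ji(2) by simp
  show ?thesis
  proof (cases "?x < ?y")
    case True
    then have "rot_dart d = Tl 0 ?y" using rot by (simp add: frontier_dart_def)
    then show ?thesis using org_rot[OF d] by auto
  next
    case False
    then have r: "rot_dart d = Hd 2 ?x" using rot by (simp add: frontier_dart_def)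
    then have "valid 2 ?x" using rot_in[OF d] by (simp add: code_darts_def)
    moreover have "?x < cnt j"
    proof (cases i)
      case 0
      have "hd (stk j) \<in> set (stk j)" using run(1)[of j] f by simp
      then show ?thesis using run(7)[of j] f 0 by (auto simp: front_def)
    next
      case (Suc i')
      then have "?x \<in> set (sky j)" using f b_lt[of j] by (auto simp: front_def)
      then show ?thesis using run(8)[of j] f by auto
    qed
    moreover have "d = Hd 2 k \<Longrightarrow> k = cnt j"
      using ji(2) by (auto simp: spoke_def split: if_splits)
    ultimately show ?thesis using r org_rot[OF d] by (auto simp: valid_def)
  qed
qed

section \<open>Clockwise order around a vertex\<close>

abbreviation steps :: "dart list \<Rightarrow> bool" where
  "steps \<equiv> successively (\<lambda>d e. e = rot_dart d)"

lemma steps_1: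
  assumes "2 \<le> k" "k \<le> n + 2"
  shows "\<exists>xs. steps (Tl 0 k # xs @ [Tl 2 k]) \<and> set xs \<subseteq> range (Hd 1)"
proof -
  note t = tm[OF assms]
  let ?xs = "map (spoke (tm k)) [1..<Suc (b k)]"
  have "steps (map (spoke (tm k)) [0..<b k + 2])"
    unfolding successively_conv_nth using t rot_spoke[of "tm k"] by (auto simp: fan_def simp del: upt_Suc)
  moreover have "map (spoke (tm k)) [0..<b k + 2] = Tl 0 k # ?xs @ [Tl 2 k]"
    using t by (simp add: spoke_def upt_conv_Cons)
  moreover have "set ?xs \<subseteq> range (Hd 1)" using t by (auto simp: spoke_def)
  ultimately show ?thesis by metis
qed

lemma steps_0_aux:
  assumes "1 \<le> y" "y \<le> n + 1"
  shows "\<exists>xs. steps (Hd 0 y # xs @ [if par 0 y = 0 then Hd 0 (n + 2) else Tl 1 (par 0 y)]) \<and>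
    set xs \<subseteq> range (Hd 0)"
  using assms
proof (induction "n + 2 - y" arbitrary: y rule: less_induct)
  case less
  from rot_Hd0[OF less.prems] show ?case
  proof (elim disjE exE conjE)
    fix y' assume y': "y < y'" "y' \<le> n + 2" "par 0 y' = par 0 y" "rot_dart (Hd 0 y) = Hd 0 y'"
    show ?case
    proof (cases "y' = n + 2")
      case True
      then have "par 0 y = 0" using y'(3) p0_end by (simp add: par_def)
      then show ?thesis using y' True by (intro exI[of _ "[]"]) auto
    next
      case False
      then have "n + 2 - y' < n + 2 - y" "1 \<le> y'" "y' \<le> n + 1" using y'(1,2) less.prems by auto
      from less.hyps[OF this] obtain xs
        where "steps (Hd 0 y' # xs @ [if par 0 y = 0 then Hd 0 (n + 2) else Tl 1 (par 0 y)])"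
        "set xs \<subseteq> range (Hd 0)"
        unfolding y'(3) by blast
      then show ?thesis using y'(4) by (intro exI[of _ "Hd 0 y' # xs"]) auto
    qed
  next
    assume "par 0 y \<noteq> 0" "rot_dart (Hd 0 y) = Tl 1 (par 0 y)"
    then show ?case by (intro exI[of _ "[]"]) auto
  qed
qed

lemma steps_0:
  assumes "2 \<le> k" "k \<le> n + 1"
  shows "\<exists>xs. steps (Tl 2 k # xs @ [Tl 1 k]) \<and> set xs \<subseteq> range (Hd 0)"
  using rot_Tl2[OF assms]
proof (elim disjE exE conjE)
  fix y assume y: "1 \<le> y" "y \<le> n + 1" "par 0 y = k" "rot_dart (Tl 2 k) = Hd 0 y"
  then obtain xs where "steps (Hd 0 y # xs @ [Tl 1 k])" "set xs \<subseteq> range (Hd 0)"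
    using steps_0_aux[OF y(1,2)] assms by auto
  then show ?thesis using y(4) by (intro exI[of _ "Hd 0 y # xs"]) auto
qed (auto intro!: exI[of _ "[]"])

lemma steps_2_aux:
  assumes "2 \<le> k" "k \<le> n + 2"
  shows "\<exists>xs. steps (Hd 2 k # xs @ [Tl 0 (par 2 k)]) \<and> set xs \<subseteq> range (Hd 2)"
  using assms
proof (induction k rule: less_induct)
  case (less k)
  have "rot_dart (Hd 2 k) = Tl 0 (par 2 k) \<or>
      (\<exists>k'. 2 \<le> k' \<and> k' \<le> n + 2 \<and> k' < k \<and> par 2 k' = par 2 k \<and> rot_dart (Hd 2 k) = Hd 2 k')"
    using rot_to_2[of "Hd 2 k" k] less.prems by auto
  then show ?case
  proof (elim disjE exE conjE)
    fix k' assume k': "2 \<le> k'" "k' \<le> n + 2" "k' < k" "par 2 k' = par 2 k" "rot_dart (Hd 2 k) = Hd 2 k'"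
    then obtain xs where "steps (Hd 2 k' # xs @ [Tl 0 (par 2 k)])" "set xs \<subseteq> range (Hd 2)"
      using less.IH[of k'] by auto
    then show ?case using k'(5) by (intro exI[of _ "Hd 2 k' # xs"]) auto
  qed (auto intro!: exI[of _ "[]"])
qed

lemma steps_2:
  assumes "2 \<le> k" "k \<le> n + 1"
  shows "\<exists>xs. steps (Tl 1 k # xs @ [Tl 0 k]) \<and> set xs \<subseteq> range (Hd 2)"
proof -
  have "rot_dart (Tl 1 k) = Tl 0 k \<or>
      (\<exists>k'. 2 \<le> k' \<and> k' \<le> n + 2 \<and> par 2 k' = k \<and> rot_dart (Tl 1 k) = Hd 2 k')"
    using rot_to_2[of "Tl 1 k" k] assms by auto
  then show ?thesis
  proof (elim disjE exE conjE)
    fix k' assume k': "2 \<le> k'" "k' \<le> n + 2" "par 2 k' = k" "rot_dart (Tl 1 k) = Hd 2 k'"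
    then obtain xs where "steps (Hd 2 k' # xs @ [Tl 0 k])" "set xs \<subseteq> range (Hd 2)"
      using steps_2_aux[of k'] by auto
    then show ?thesis using k'(4) by (intro exI[of _ "Hd 2 k' # xs"]) auto
  qed (auto intro!: exI[of _ "[]"])
qed

lemma rotation_list:
  assumes "2 \<le> k" "k \<le> n + 1"
  obtains H1 H0 H2 where
    "map (\<lambda>i. (rot_dart ^^ i) (Tl 0 k)) [0..<card (orbit rot_dart (Tl 0 k))] =
      [Tl 0 k] @ H1 @ [Tl 2 k] @ H0 @ [Tl 1 k] @ H2"
    "orbit rot_dart (Tl 0 k) = set ([Tl 0 k] @ H1 @ [Tl 2 k] @ H0 @ [Tl 1 k] @ H2)"
    "set H1 \<subseteq> range (Hd 1)" "set H0 \<subseteq> range (Hd 0)" "set H2 \<subseteq> range (Hd 2)"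
proof -
  obtain H1 where H1: "steps (Tl 0 k # H1 @ [Tl 2 k])" "set H1 \<subseteq> range (Hd 1)"
    using steps_1[of k] assms by auto
  obtain H0 where H0: "steps (Tl 2 k # H0 @ [Tl 1 k])" "set H0 \<subseteq> range (Hd 0)"
    using steps_0[OF assms] by auto
  obtain H2 where H2: "steps (Tl 1 k # H2 @ [Tl 0 k])" "set H2 \<subseteq> range (Hd 2)"
    using steps_2[OF assms] by auto
  let ?xs = "H1 @ [Tl 2 k] @ H0 @ [Tl 1 k] @ H2"
  have join: "steps (x # ys @ [z] @ zs)" if "steps (x # ys @ [z])" "steps (z # zs)" for x ys z zs
  proof -
    have "x # ys @ [z] @ zs = (x # ys) @ z # zs" "x # ys @ [z] = (x # ys) @ [z]" by simp_all
    with that show ?thesis by (simp only: successively_append_iff) simp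
  qed
  have "steps (Tl 0 k # ?xs @ [Tl 0 k])"
    using join[OF H1(1) join[OF H0(1) H2(1)]] by simp
  moreover have "Tl 0 k \<notin> set ?xs" using H1 H0 H2 by auto
  ultimately have "orbit rot_dart (Tl 0 k) = set (Tl 0 k # ?xs)"
    "map (\<lambda>i. (rot_dart ^^ i) (Tl 0 k)) [0..<card (orbit rot_dart (Tl 0 k))] = Tl 0 k # ?xs"
    by (rule orbit_list)+
  with H1 H0 H2 show thesis by (intro that[of H1 H0 H2]) simp_all
qed

lemma permutation_rot: "permutation rot_dart"
  using rot_permutes finite_code_darts by (auto simp: permutation_permutes)

text \<open>The half-edge of a vertex up to which the rotation is followed. \<open>v\<^sub>0\<close>
  has no \<open>0\<close>-tail and uses the root half-edge.\<close>

definition base :: "nat \<Rightarrow> dart" where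
  "base k = (if k = 0 then Hd 0 (n + 2) else Tl 0 k)"

text \<open>Clockwise, \<open>1\<close>-heads lead to the \<open>2\<close>-tail,
  \<open>0\<close>-heads to the \<open>1\<close>-tail and \<open>2\<close>-heads to the
  \<open>0\<close>-tail. At \<open>v\<^sub>1\<close> the root face leads from the
  \<open>2\<close>-tail straight to the \<open>0\<close>-tail, and at \<open>v\<^sub>0\<close> the
  \<open>0\<close>-heads end in the root.\<close>

lemma base_orbit:
  assumes "d \<in> code_darts"
  shows "base (org d) \<in> orbit rot_dart d"
proof -
  have Hd2: "Tl 0 (par 2 k) \<in> orbit rot_dart (Hd 2 k)" if "2 \<le> k" "k \<le> n + 2" for k
    using steps_2_aux[OF that] successively_orbit by metis
  have Tl1: "Tl 0 k \<in> orbit rot_dart (Tl 1 k)" if "2 \<le> k" "k \<le> n + 1" for k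
    using steps_2[OF that] successively_orbit by metis
  have Hd0: "base (par 0 y) \<in> orbit rot_dart (Hd 0 y)" if y': "1 \<le> y" "y \<le> n + 2" for y
  proof (cases "y = n + 2")
    case True
    then show ?thesis using p0_end permutation_self_in_orbit[OF permutation_rot]
      by (simp add: base_def par_def)
  next
    case False
    then have y: "y \<le> n + 1" using y' by simp
    obtain xs where "steps (Hd 0 y # xs @ [if par 0 y = 0 then Hd 0 (n + 2) else Tl 1 (par 0 y)])"
      using steps_0_aux[OF y'(1) y] by auto
    then have *: "(if par 0 y = 0 then Hd 0 (n + 2) else Tl 1 (par 0 y)) \<in> orbit rot_dart (Hd 0 y)"
      by (rule successively_orbit)
    show ?thesis
    proof (cases "par 0 y = 0")
      case True
      then show ?thesis using * by (simp add: base_def)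
    next
      case False
      then have "Tl 0 (par 0 y) \<in> orbit rot_dart (Tl 1 (par 0 y))"
        using par0(2)[OF y'] Tl1 by simp
      then show ?thesis using * False by (auto simp: base_def intro: orbit_trans)
    qed
  qed
  have Tl2: "Tl 0 k \<in> orbit rot_dart (Tl 2 k)" if k2: "2 \<le> k" "k \<le> n + 2" for k
  proof (cases "k = n + 2")
    case True
    then show ?thesis using rot_root(2) orbit.base[of rot_dart "Tl 2 k"] by simp
  next
    case False
    then have k: "k \<le> n + 1" using k2 by simp
    obtain xs where "steps (Tl 2 k # xs @ [Tl 1 k])" using steps_0[OF k2(1) k] by auto
    then have "Tl 1 k \<in> orbit rot_dart (Tl 2 k)" by (rule successively_orbit)
    then show ?thesis using orbit_trans[OF Tl1[OF k2(1) k]] by simp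
  qed
  have spk: "Tl 2 (cnt j) \<in> orbit rot_dart (spoke j i)" if "(j, i) \<in> fan" for j i
  proof -
    have "spoke j (i' + m) \<in> orbit rot_dart (spoke j i')" if "i' + m \<le> Suc (b (cnt j))" "1 \<le> m" for i' m
      using that(2,1)
    proof (induction m rule: dec_induct)
      case base
      then show ?case using rot_spoke[of j i'] fanD[OF \<open>(j, i) \<in> fan\<close>] orbit.base[of rot_dart "spoke j i'"]
        by (simp add: fan_def)
    next
      case (step m)
      then show ?case using rot_spoke[of j "i' + m"] fanD[OF \<open>(j, i) \<in> fan\<close>]
          orbit.step[of "spoke j (i' + m)" rot_dart "spoke j i'"]
        by (simp add: fan_def)
    qed
    moreover have "i + (Suc (b (cnt j)) - i) = Suc (b (cnt j))" "1 \<le> Suc (b (cnt j)) - i"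
      using fanD[OF that] by auto
    moreover have "spoke j (Suc (b (cnt j))) = Tl 2 (cnt j)" by (simp add: spoke_def)
    ultimately show ?thesis by (metis order_refl)
  qed
  have Hd1: "Tl 0 (par 1 x) \<in> orbit rot_dart (Hd 1 x)" if x: "2 \<le> x" "x \<le> n + 1" for x
  proof -
    obtain j i where ji: "(j, Suc i) \<in> fan" "sky j ! i = x" using popped_at[OF x] by auto
    then have j: "j \<le> 2 * n" "w j = N" "i < b (cnt j)" using fanD by fastforce+
    then have "spoke j (Suc i) = Hd 1 x" "par 1 x = cnt j"
      using ji p1_eq by (auto simp: spoke_def front_def par_def)
    then show ?thesis
      using spk[OF ji(1)] orbit_trans[OF Tl2] cnt_ge[of j] cnt_le[OF j(1)] by metis
  qed
  show ?thesis
  proof (cases d)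
    case (Tl i k)
    then show ?thesis using assms Tl1 Tl2 permutation_self_in_orbit[OF permutation_rot]
      by (auto simp: code_darts_def valid_def base_def)
  next
    case (Hd i k)
    then have "valid i k" using assms by (simp add: code_darts_def)
    then consider "i = 0" "1 \<le> k" "k \<le> n + 2" | "i = 1" "2 \<le> k" "k \<le> n + 1" | "i = 2" "2 \<le> k" "k \<le> n + 2"
      by (auto simp: valid_def)
    then show ?thesis
    proof cases
      case 1
      then show ?thesis using Hd Hd0 by simp
    next
      case 2
      then show ?thesis using Hd Hd1 par1[of k] by (simp add: base_def)
    next
      case 3
      then show ?thesis using Hd Hd2 par2[of k] by (simp add: base_def)
    qed
  qed
qed

theorem orbit_rot:
  assumes "d \<in> code_darts"
  shows "orbit rot_dart d = {e \<in> code_darts. org e = org d}"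
proof (intro equalityI subsetI)
  fix e assume "e \<in> orbit rot_dart d"
  then show "e \<in> {e \<in> code_darts. org e = org d}"
    by induction (use assms org_rot rot_in in auto)
next
  fix e assume "e \<in> {e \<in> code_darts. org e = org d}"
  then have e: "e \<in> code_darts" "org e = org d" by auto
  have "base (org d) \<in> orbit rot_dart e" using base_orbit[OF e(1)] e(2) by simp
  then have "e \<in> orbit rot_dart (base (org d))"
    using orbit_swap[OF permutation_self_in_orbit[OF permutation_rot]] by metis
  then show "e \<in> orbit rot_dart d" using base_orbit[OF assms] by (rule orbit_trans)
qed

text \<open>An edge is a spoke in the fan of its later end. The only exception is the edge of
  \<open>v\<^sub>2\<close> to \<open>v\<^sub>0\<close>, since \<open>v\<^sub>2\<close> has no
  fan.\<close>

lemma downward_dart: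
  assumes "d \<in> code_darts" "org (flip d) < org d"
  shows "d = Tl 0 1 \<or> (\<exists>j i. j \<le> 2 * n \<and> w j = N \<and> i \<le> Suc (b (cnt j)) \<and> d = spoke j i)"
proof -
  have spk: ?thesis if "d = spoke j i" "j \<le> 2 * n" "w j = N" "i \<le> Suc (b (cnt j))" for j i
    using that by blast
  show ?thesis
  proof (cases d)
    case (Tl i k)
    then have v: "valid i k" using assms(1) by (simp add: code_darts_def)
    consider "k = 1" | "2 \<le> k" "i = 0" | "2 \<le> k" "i = 2" | "i = 1"
      using v unfolding valid_def by linarith
    then show ?thesis
    proof cases
      case 1
      then show ?thesis using v Tl by (auto simp: valid_def)
    next
      case 2
      then show ?thesis using v Tl tm[of k] by (intro spk[of "tm k" 0]) (auto simp: valid_def spoke_def)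
    next
      case 3
      then show ?thesis using v Tl tm[of k]
        by (intro spk[of "tm k" "Suc (b k)"]) (auto simp: valid_def spoke_def)
    next
      case 4
      then show ?thesis using v Tl assms(2) par1[of k] by (auto simp: valid_def)
    qed
  next
    case (Hd i k)
    then have v: "valid i k" using assms(1) by (simp add: code_darts_def)
    have "i = 1"
      using v Hd assms(2) par0(1)[of k] par2(1)[of k] by (auto simp: valid_def)
    then have "2 \<le> k" "k \<le> n + 1" using v by (auto simp: valid_def)
    then obtain j i' where ji: "(j, Suc i') \<in> fan" "sky j ! i' = k" using popped_at by blast
    then show ?thesis using Hd \<open>i = 1\<close> fanD[OF ji(1)]
      by (intro spk[of j "Suc i'"]) (auto simp: spoke_def front_def)
  qed
qed

lemma org_flip_neq:
  assumes "d \<in> code_darts"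
  shows "org d \<noteq> org (flip d)"
proof -
  have "k \<noteq> par i k" if "valid i k" for i k
    using that par0(1)[of k] par1(1)[of k] par2(1)[of k] by (auto simp: valid_def)
  then show ?thesis using assms by (cases d) (auto simp: code_darts_def, metis)
qed

lemma distinct_front: "j \<le> 2 * n \<Longrightarrow> distinct (front j)"
  using run(1,6)[of j] by (cases "stk j") (auto simp: front_def)

theorem dart_unique:
  assumes "d \<in> code_darts" "e \<in> code_darts" "org d = org e" "org (flip d) = org (flip e)"
  shows "d = e"
proof -
  have down: "d = e" if "d \<in> code_darts" "e \<in> code_darts" "org d = org e"
    "org (flip d) = org (flip e)" "org (flip d) < org d" for d e
  proof -
    have spk1: "spoke j i \<noteq> Tl 0 1 \<and> org (spoke j i) \<noteq> 1"
      if "j \<le> 2 * n" "w j = N" "i \<le> Suc (b (cnt j))" for j i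
      using org_spoke(1)[OF that] cnt_ge[of j] by auto
    have de: "d = Tl 0 1 \<or> (\<exists>j i. j \<le> 2 * n \<and> w j = N \<and> i \<le> Suc (b (cnt j)) \<and> d = spoke j i)"
      "e = Tl 0 1 \<or> (\<exists>j i. j \<le> 2 * n \<and> w j = N \<and> i \<le> Suc (b (cnt j)) \<and> e = spoke j i)"
      using downward_dart[OF that(1,5)] downward_dart[OF that(2)] that(3-5) by simp_all
    show "d = e"
    proof (cases "d = Tl 0 1 \<or> e = Tl 0 1")
      case True
      then have "org d = 1" "org e = 1" using that(3) by auto
      then show ?thesis using de spk1 by blast
    next
      case False
      then obtain j i j' i' where ji: "j \<le> 2 * n" "w j = N" "i \<le> Suc (b (cnt j))" "d = spoke j i"
        and ji': "j' \<le> 2 * n" "w j' = N" "i' \<le> Suc (b (cnt j'))" "e = spoke j' i'"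
        using de by blast
      then have "cnt j = cnt j'" using org_spoke(1)[OF ji(1-3)] org_spoke(1)[OF ji'(1-3)] that(3) by simp
      then have jj: "j' = j" using cnt_inj[OF ji(2) ji'(2)] by simp
      then have "front j ! i = front j ! i'"
        using org_spoke(2)[OF ji(1-3)] org_spoke(2)[OF ji'(1-3)] that(4) ji(4) ji'(4) by simp
      moreover have "i < length (front j)" "i' < length (front j)"
        using ji ji' jj b_lt[of j] by (auto simp: length_front)
      ultimately have "i = i'"
        using distinct_front[OF ji(1)] by (simp add: nth_eq_iff_index_eq)
      then show ?thesis using ji ji' jj by simp
    qed
  qed
  show ?thesis
  proof (cases "org (flip d) < org d")
    case True
    then show ?thesis by (rule down[OF assms])
  next
    case False
    then have "org d < org (flip d)" using org_flip_neq[OF assms(1)] by simp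
    then have "flip d = flip e" using down[of "flip d" "flip e"] assms by simp
    then show ?thesis by simp
  qed
qed

lemma face_props:
  assumes "d \<in> code_darts"
  shows "face_dart d \<in> code_darts" "rot_dart (face_dart d) = flip d"
    "face_dart (face_dart (face_dart d)) = d" "face_dart d \<noteq> d" "face_dart (face_dart d) \<noteq> d"
proof -
  obtain t m where tm: "(t, m) \<in> slots" "d = at_slot (t, m)"
    using assms slots_bij unfolding bij_betw_def by (metis imageE surj_pair)
  then have m: "m = 0 \<or> m = 1 \<or> m = 2" and s: "\<And>m. m < 3 \<Longrightarrow> (t, m) \<in> slots" by (auto simp: slots_def)
  have f: "face_dart (at_slot (t, 0)) = at_slot (t, 1)" "face_dart (at_slot (t, 1)) = at_slot (t, 2)"
    "face_dart (at_slot (t, 2)) = at_slot (t, 0)"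
    using face_dart_slot[OF s, of 0] face_dart_slot[OF s, of 1] face_dart_slot[OF s, of 2]
    by (simp_all add: Suc_1 del: One_nat_def)
  have inj: "at_slot (t, a) = at_slot (t, c) \<longleftrightarrow> a = c" if "a < 3" "c < 3" for a c
    using slots_bij s that by (auto simp: bij_betw_def dest: inj_onD)
  show "face_dart d \<in> code_darts" "face_dart (face_dart (face_dart d)) = d" "face_dart d \<noteq> d"
    "face_dart (face_dart d) \<noteq> d"
    using m tm f at_slot_in[OF s] inj by auto
  then show "rot_dart (face_dart d) = flip d" by (simp add: rot_dart_def)
qed

end

section \<open>Trees given by parent functions\<close>

text \<open>The rank falls towards the root, which allows the vertices to be treated by induction
  and excludes cycles.\<close>

locale parent_tree =
  fixes V :: "'v set" and r :: 'v and p :: "'v \<Rightarrow> 'v" and rank :: "'v \<Rightarrow> nat"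
  assumes root_in: "r \<in> V"
    and parent: "\<And>x. x \<in> V \<Longrightarrow> x \<noteq> r \<Longrightarrow> p x \<in> V \<and> rank (p x) < rank x"
begin

definition A :: "('v \<times> 'v) set" where
  "A = {(x, p x) | x. x \<in> V \<and> x \<noteq> r} \<union> {(p x, x) | x. x \<in> V \<and> x \<noteq> r}"

lemma A_iff: "(x, y) \<in> A \<longleftrightarrow> x \<in> V \<and> x \<noteq> r \<and> y = p x \<or> y \<in> V \<and> y \<noteq> r \<and> x = p y"
  by (auto simp: A_def)

lemma path_to_root:
  assumes "x \<in> V"
  shows "\<exists>q. is_path A (x # q) \<and> last (x # q) = r \<and> (\<forall>y\<in>set q. rank y < rank x) \<and>
    (x \<noteq> r \<longrightarrow> (\<exists>q'. q = p x # q'))"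
  using assms
proof (induction "rank x" arbitrary: x rule: less_induct)
  case less
  show ?case
  proof (cases "x = r")
    case True
    then show ?thesis by (intro exI[of _ "[]"]) (simp add: is_path_def)
  next
    case False
    with parent less.prems have p: "p x \<in> V" "rank (p x) < rank x" by auto
    then obtain q where q: "is_path A (p x # q)" "last (p x # q) = r" "\<forall>y\<in>set q. rank y < rank (p x)"
      using less.hyps by blast
    have "(x, p x) \<in> A" using False less.prems by (simp add: A_iff)
    moreover have "x \<notin> set (p x # q)" using q(3) p(2) by auto
    ultimately show ?thesis using q p by (intro exI[of _ "p x # q"]) (auto simp: is_path_def)
  qed
qed

text \<open>After a step from a parent to its child, every further step must again go to a child,
  because the parent has been used. Such a path never ends in the root.\<close>

lemma no_downward_path:
  assumes "x \<in> V" "x \<noteq> r" "is_path A (p x # x # q)"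
  shows "last (p x # x # q) \<noteq> r"
  using assms
proof (induction q arbitrary: x)
  case (Cons y q)
  then have "(x, y) \<in> A" "y \<noteq> p x" by (auto simp: is_path_def)
  then have y: "y \<in> V" "y \<noteq> r" "x = p y" by (auto simp: A_iff)
  then show ?case using Cons.IH[of y] Cons.prems by (simp add: is_path_def)
qed auto

lemma to_root: "x \<in> V \<Longrightarrow> (x, r) \<in> A\<^sup>* \<and> (r, x) \<in> A\<^sup>*"
proof (induction "rank x" arbitrary: x rule: less_induct)
  case less
  show ?case
  proof (cases "x = r")
    case False
    with parent less.prems have "p x \<in> V" "rank (p x) < rank x" by auto
    moreover have "(x, p x) \<in> A" "(p x, x) \<in> A" using False less.prems by (auto simp: A_iff)
    ultimately show ?thesis using less.hyps[of "p x"]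
      by (meson converse_rtrancl_into_rtrancl rtrancl.rtrancl_into_rtrancl)
  qed simp
qed

text \<open>A vertex of greatest rank on a cycle has two different neighbours there, and both would
  be its parent.\<close>

lemma no_cycle: "\<not> is_cycle A c"
proof
  assume "is_cycle A c"
  then have c: "distinct c" "3 \<le> length c" "(last c, hd c) \<in> A"
    and succ: "successively (\<lambda>u v. (u, v) \<in> A) c"
    by (auto simp: is_cycle_def is_path_def)
  have step: "(c ! i, c ! Suc i) \<in> A" if "Suc i < length c" for i
    using succ that by (simp add: successively_conv_nth)
  define m where "m = Max (rank ` set c)"
  have "m \<in> rank ` set c" unfolding m_def using c(2) by (intro Max_in) auto
  then obtain i where i: "i < length c" "rank (c ! i) = m" by (auto simp: in_set_conv_nth)
  have top: "y = p (c ! i)" if "y \<in> set c" "(c ! i, y) \<in> A \<or> (y, c ! i) \<in> A" for y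
  proof -
    have "rank y \<le> rank (c ! i)" using that(1) i(2) by (simp add: m_def)
    then show ?thesis using that(2) parent[of y] by (auto simp: A_iff)
  qed
  let ?l = "length c - 1"
  have "c \<noteq> []" using c(2) by auto
  then have ends: "(c ! ?l, c ! 0) \<in> A" using c(3) by (simp add: last_conv_nth hd_conv_nth)
  obtain a d where ad: "a < length c" "d < length c" "a \<noteq> d"
    "(c ! i, c ! a) \<in> A \<or> (c ! a, c ! i) \<in> A" "(c ! i, c ! d) \<in> A \<or> (c ! d, c ! i) \<in> A"
  proof (cases "i = 0")
    case True
    then show thesis using that[of 1 ?l] step[of 0] ends c(2) by auto
  next
    case False
    then have "(c ! (i - 1), c ! i) \<in> A" using step[of "i - 1"] i(1) by simp
    moreover have "(c ! i, c ! (if i = ?l then 0 else Suc i)) \<in> A"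
      using step[of i] ends i(1) by auto
    moreover have "i - 1 \<noteq> (if i = ?l then 0 else Suc i)" "(if i = ?l then 0 else Suc i) < length c"
      using i(1) c(2) by (auto split: if_splits)
    ultimately show thesis
      using that[of "i - 1" "if i = ?l then 0 else Suc i"] i(1) by (meson less_imp_diff_less)
  qed
  then have "c ! a = c ! d" using top nth_mem by metis
  then show False using ad c(1) by (simp add: nth_eq_iff_index_eq)
qed

lemma tree: "is_tree V A"
proof -
  have "A \<subseteq> V \<times> V" using parent by (auto simp: A_def)
  moreover have "(u, v) \<in> A\<^sup>*" if "u \<in> V" "v \<in> V" for u v
    using to_root that by (meson rtrancl_trans)
  ultimately show ?thesis using no_cycle root_in by (auto simp: is_tree_def connected_graph_def)
qed

end

section \<open>Maps presented by a code\<close>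

text \<open>\<open>\<phi>\<close> labels the half-edges. It is injective on the whole type, so that
  equations between labels simplify without side conditions. Colors are prescribed for internal
  edges only, since a coloring is arbitrary elsewhere.\<close>

locale presented = coding +
  fixes M :: "'h rooted_map" and c :: "'h coloring" and \<phi> :: "dart \<Rightarrow> 'h"
  assumes n_pos: "1 \<le> n"
    and inj: "inj \<phi>"
    and darts: "darts M = \<phi> ` code_darts"
    and rot: "\<And>d. d \<in> code_darts \<Longrightarrow> rot M (\<phi> d) = \<phi> (rot_dart d)"
    and opp: "\<And>d. d \<in> code_darts \<Longrightarrow> opp M (\<phi> d) = \<phi> (flip d)"
    and rot_perm: "rot M permutes darts M"
    and opp_perm: "opp M permutes darts M"
    and root: "root M = \<phi> (Hd 0 (n + 2))"
    and col: "\<And>i k. i \<le> 2 \<Longrightarrow> 2 \<le> k \<Longrightarrow> k \<le> n + 1 \<Longrightarrow> c {\<phi> (Tl i k), \<phi> (Hd i k)} = i"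
begin

lemma phi_eq [simp]: "\<phi> d = \<phi> e \<longleftrightarrow> d = e"
  using inj by (simp add: inj_eq)

lemma phi_in [simp]: "\<phi> d \<in> \<phi> ` X \<longleftrightarrow> d \<in> X"
  by auto

lemma finite_darts: "finite (darts M)"
  using finite_code_darts darts by simp

lemma rot_all: "rot M (\<phi> d) = \<phi> (rot_dart d)"
  using rot[of d] permutes_not_in[OF rot_perm, of "\<phi> d"] darts
  by (cases "d \<in> code_darts") (auto simp: rot_dart_def)

definition vs :: "nat \<Rightarrow> 'h set" where
  "vs k = \<phi> ` {d \<in> code_darts. org d = k}"

lemma vert_phi:
  assumes "d \<in> code_darts"
  shows "vert M (\<phi> d) = vs (org d)"
proof -
  have "\<phi> ` orbit rot_dart d = orbit (rot M) (\<phi> d)"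
    by (rule orbit_inverse) (auto simp: rot_all permutation_self_in_orbit[OF permutation_rot])
  then show ?thesis using orbit_rot[OF assms] by (simp add: vert_def vs_def)
qed

lemma base_props: "k \<le> n + 2 \<Longrightarrow> base k \<in> code_darts \<and> org (base k) = k"
  using p0_end by (auto simp: base_def code_darts_def valid_def par_def)

lemma vs_inj: "k \<le> n + 2 \<Longrightarrow> vs k = vs k' \<Longrightarrow> k = k'"
proof -
  assume "k \<le> n + 2" "vs k = vs k'"
  moreover have "\<phi> (base k) \<in> vs k" using base_props[OF \<open>k \<le> n + 2\<close>] by (simp add: vs_def)
  ultimately have "\<phi> (base k) \<in> vs k'" by simp
  then obtain d where "\<phi> (base k) = \<phi> d" "org d = k'" unfolding vs_def by blast
  then have "org (base k) = k'" by simp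
  then show "k = k'" using base_props[OF \<open>k \<le> n + 2\<close>] by simp
qed

lemma vs_eq_iff: "k \<le> n + 2 \<Longrightarrow> vs k = vs k' \<longleftrightarrow> k = k'"
  using vs_inj[of k k'] by auto

lemma org_le: "d \<in> code_darts \<Longrightarrow> org d \<le> n + 2"
proof (cases d)
  case (Hd i k)
  assume "d \<in> code_darts"
  then have "valid i k" using Hd by (simp add: code_darts_def)
  then show ?thesis using Hd par0(1)[of k] par1(2)[of k] par2(1)[of k] by (auto simp: valid_def)
qed (auto simp: code_darts_def valid_def)

section \<open>Vertices, edges and faces of a presented map\<close>

lemma vertices_eq: "vertices M = vs ` {..n + 2}"
proof -
  have "vertices M = (\<lambda>d. vs (org d)) ` code_darts"
    unfolding vertices_def darts image_image by (rule image_cong) (simp_all add: vert_phi)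
  also have "\<dots> = vs ` {..n + 2}"
    using org_le base_props by (auto simp: image_iff) (metis (no_types, lifting))
  finally show ?thesis .
qed

lemma card_vertices: "card (vertices M) = n + 3"
  unfolding vertices_eq by (subst card_image) (auto simp: inj_on_def vs_eq_iff)

lemma edge_phi: "d \<in> code_darts \<Longrightarrow> edge M (\<phi> d) = {\<phi> d, \<phi> (flip d)}"
  by (simp add: edge_def opp)

lemma edges_eq: "edges M = (\<lambda>(i, k). {\<phi> (Tl i k), \<phi> (Hd i k)}) ` {(i, k). valid i k}"
proof -
  have "edges M = edge M ` \<phi> ` code_darts" by (simp add: edges_def darts)
  also have "\<dots> = (\<lambda>d. {\<phi> d, \<phi> (flip d)}) ` code_darts" by (auto simp: edge_phi image_image)
  also have "\<dots> = (\<lambda>(i, k). {\<phi> (Tl i k), \<phi> (Hd i k)}) ` {(i, k). valid i k}"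
  proof -
    have "(\<lambda>d. {\<phi> d, \<phi> (flip d)}) ` case_prod Tl ` X = (\<lambda>(i, k). {\<phi> (Tl i k), \<phi> (Hd i k)}) ` X"
      "(\<lambda>d. {\<phi> d, \<phi> (flip d)}) ` case_prod Hd ` X = (\<lambda>(i, k). {\<phi> (Tl i k), \<phi> (Hd i k)}) ` X" for X
      unfolding image_image by (auto intro!: image_cong)
    then show ?thesis unfolding code_darts_eq image_Un by simp
  qed
  finally show ?thesis .
qed

lemma card_edges: "card (edges M) = 3 * n + 3"
  unfolding edges_eq by (subst card_image) (auto simp: inj_on_def card_valid doubleton_eq_iff)

lemma face_next_phi:
  assumes "d \<in> code_darts"
  shows "face_next M (\<phi> d) = \<phi> (face_dart d)"
proof -
  have "rot M (\<phi> (face_dart d)) = \<phi> (flip d)" using face_props[OF assms] by (simp add: rot_all)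
  then show ?thesis using assms permutes_inj[OF rot_perm] by (simp add: face_next_def opp inv_f_eq)
qed

lemma face_phi:
  assumes "d \<in> code_darts"
  shows "face M (\<phi> d) = \<phi> ` {d, face_dart d, face_dart (face_dart d)}"
proof -
  note f = face_props[OF assms]
  have "successively (\<lambda>x y. y = face_next M x)
      (\<phi> d # [\<phi> (face_dart d), \<phi> (face_dart (face_dart d))] @ [\<phi> d])"
    using f assms face_props[OF f(1)] by (simp add: face_next_phi)
  from orbit_list(1)[OF this] show ?thesis using f by (auto simp: face_def)
qed

lemma card_face: "d \<in> code_darts \<Longrightarrow> card (face M (\<phi> d)) = 3"
  using face_props[of d] face_props(4)[of "face_dart d"] by (simp add: face_phi eq_commute)

lemma faces_eq: "faces M = (\<lambda>d. face M (\<phi> d)) ` code_darts"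
  by (simp add: faces_def darts image_image)

lemma card_faces: "card (faces M) = 2 * n + 2"
proof -
  have un: "\<Union> (faces M) = darts M"
    using face_props(1) by (auto simp: faces_eq face_phi darts)
  have "3 * card (faces M) = card (\<Union> (faces M))"
  proof (rule card_partition)
    show "finite (faces M)" using finite_code_darts by (simp add: faces_eq)
    show "finite (\<Union> (faces M))" using un finite_darts by simp
    show "card f = 3" if "f \<in> faces M" for f using that card_face by (auto simp: faces_eq)
    show "f \<inter> g = {}" if fg: "f \<in> faces M" "g \<in> faces M" "f \<noteq> g" for f g
    proof (rule ccontr)
      assume "f \<inter> g \<noteq> {}"
      then obtain h where h: "h \<in> f" "h \<in> g" by auto
      have "x = face M h" if x: "x \<in> faces M" "h \<in> x" for x
      proof -
        obtain d where d: "d \<in> code_darts" "x = face M (\<phi> d)" using x(1) by (auto simp: faces_eq)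
        note f = face_props[OF d(1)] and f' = face_props[OF face_props(1)[OF d(1)]]
        obtain e where e: "h = \<phi> e" "e = d \<or> e = face_dart d \<or> e = face_dart (face_dart d)"
          using x(2) d by (auto simp: face_phi)
        then have "e \<in> code_darts" using d f f' by auto
        then show ?thesis using e d f f' by (auto simp: face_phi)
      qed
      then show False using h fg by metis
    qed
  qed
  also have "\<dots> = 6 * n + 6" unfolding un darts using inj card_code_darts
    by (subst card_image) (auto intro: inj_on_subset)
  finally show ?thesis by simp
qed

lemma adjacency_phi: "adjacency M (\<phi> ` X) = (\<lambda>d. (vs (org d), vs (org (flip d)))) ` X" if "X \<subseteq> code_darts"
  unfolding adjacency_def image_image using that by (intro image_cong) (auto simp: opp vert_phi)

lemma connected: "connected_graph (vertices M) (adjacency M (darts M))"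
proof -
  let ?A = "adjacency M (darts M)"
  have A: "?A = (\<lambda>d. (vs (org d), vs (org (flip d)))) ` code_darts"
    by (simp add: darts adjacency_phi)
  have "(vs k, vs 0) \<in> ?A\<^sup>* \<and> (vs 0, vs k) \<in> ?A\<^sup>*" if "k \<le> n + 2" for k
    using that
  proof (induction k rule: less_induct)
    case (less k)
    show ?case
    proof (cases "k = 0")
      case False
      then have d: "Tl 0 k \<in> code_darts" "Hd 0 k \<in> code_darts" and p: "par 0 k < k"
        using less.prems par0(1)[of k] by (auto simp: code_darts_def valid_def)
      have "(vs k, vs (par 0 k)) \<in> ?A" "(vs (par 0 k), vs k) \<in> ?A"
        unfolding A using d(1) by (rule image_eqI[rotated], simp) (use d(2) in \<open>rule image_eqI[rotated], simp\<close>)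
      then show ?thesis using less.IH[OF p] p less.prems
        by (meson converse_rtrancl_into_rtrancl le_trans less_imp_le rtrancl.rtrancl_into_rtrancl)
    qed simp
  qed
  then have "(u, v) \<in> ?A\<^sup>*" if "u \<in> vertices M" "v \<in> vertices M" for u v
    using that unfolding vertices_eq by (auto intro: rtrancl_trans)
  moreover have "?A \<subseteq> vertices M \<times> vertices M"
    unfolding A vertices_eq using org_le code_darts_flip by force
  moreover have "vertices M \<noteq> {}" by (simp add: vertices_eq)
  ultimately show ?thesis by (simp add: connected_graph_def)
qed

lemma root_darts: "Hd 0 (n + 2) \<in> code_darts" "Tl 2 (n + 2) \<in> code_darts" "Tl 0 1 \<in> code_darts"
  by (auto simp: code_darts_def valid_def)

text \<open>Euler's formula reads \<open>(n + 3) + (2 * n + 2) = (3 * n + 3) + 2\<close>.\<close>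

theorem is_triangulation: "triangulation M"
proof -
  have "opp M h \<noteq> h \<and> opp M (opp M h) = h" if "h \<in> darts M" for h
    using that by (auto simp: darts opp)
  moreover have "vert M h \<noteq> vert M (opp M h)" if "h \<in> darts M" for h
    using that org_flip_neq org_le by (auto simp: darts opp vert_phi vs_eq_iff)
  moreover have "h = k" if "h \<in> darts M" "k \<in> darts M" "vert M h = vert M k"
    "vert M (opp M h) = vert M (opp M k)" for h k
    using that dart_unique org_le by (auto simp: darts opp vert_phi vs_eq_iff)
  ultimately have "planar_map M"
    unfolding planar_map_def
    using finite_darts root root_darts rot_perm opp_perm connected card_vertices card_faces card_edges
    by (auto simp: darts)
  then show ?thesis using card_face by (auto simp: triangulation_def faces_eq)
qed

lemma face_dart_eqI: "d \<in> code_darts \<Longrightarrow> e \<in> code_darts \<Longrightarrow> rot_dart e = flip d \<Longrightarrow> face_dart d = e"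
  using face_props[of d] permutes_inj[OF rot_permutes] by (metis injD)

lemma root_face_darts: "face_dart (Hd 0 (n + 2)) = Tl 2 (n + 2)" "face_dart (Tl 2 (n + 2)) = Tl 0 1"
  using face_dart_eqI rot_root root_darts by simp_all

lemma ext_vertex_eq: "ext_vertex M 0 = vs 0" "ext_vertex M 1 = vs (n + 2)" "ext_vertex M 2 = vs 1"
proof -
  have e: "face_next M (root M) = \<phi> (Tl 2 (n + 2))"
    "face_next M (\<phi> (Tl 2 (n + 2))) = \<phi> (Tl 0 1)"
    unfolding root face_next_phi[OF root_darts(1)] root_face_darts face_next_phi[OF root_darts(2)]
    by simp_all
  show "ext_vertex M 0 = vs 0"
    using p0_end vert_phi[OF root_darts(1)] by (simp add: ext_vertex_def root par_def)
  have "ext_vertex M 1 = vert M (face_next M (root M))"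
    "ext_vertex M 2 = vert M (face_next M (face_next M (root M)))"
    by (simp_all add: ext_vertex_def numeral_2_eq_2)
  then show "ext_vertex M 1 = vs (n + 2)" "ext_vertex M 2 = vs 1"
    unfolding e vert_phi[OF root_darts(2)] vert_phi[OF root_darts(3)] by simp_all
qed

lemma root_face_eq: "root_face M = \<phi> ` {Hd 0 (n + 2), Tl 2 (n + 2), Tl 0 1}"
  unfolding root_face_def root face_phi[OF root_darts(1)] root_face_darts by simp

lemma internal_vertices_eq: "internal_vertices M = vs ` {2..n + 1}"
proof -
  have "vert M ` root_face M = vs ` {0, 1, n + 2}"
    using root_darts p0_end by (auto simp: root_face_eq vert_phi par_def)
  moreover have "vs ` {..n + 2} - vs ` {0, 1, n + 2} = vs ` ({..n + 2} - {0, 1, n + 2})"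
    by (rule inj_on_image_set_diff[symmetric, of _ "{..n + 2}"]) (auto simp: inj_on_def vs_eq_iff)
  moreover have "{..n + 2} - {0, 1, n + 2} = {2..n + 1}" by auto
  ultimately show ?thesis by (simp add: internal_vertices_def vertices_eq)
qed

lemma size_eq: "size_tri M = n"
  unfolding size_tri_def internal_vertices_eq by (subst card_image) (auto simp: inj_on_def vs_eq_iff)

lemma internal_edge_iff:
  assumes "valid i k"
  shows "{\<phi> (Tl i k), \<phi> (Hd i k)} \<in> internal_edges M \<longleftrightarrow> 2 \<le> k \<and> k \<le> n + 1"
proof -
  have "{\<phi> (Tl i k), \<phi> (Hd i k)} \<in> edges M" using assms by (auto simp: edges_eq)
  then show ?thesis using assms by (auto simp: internal_edges_def root_face_eq valid_def)
qed

section \<open>The three trees and the local rule\<close>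

definition tdarts :: "nat \<Rightarrow> dart set" where
  "tdarts i = Tl i ` {2..n + 1} \<union> Hd i ` {2..n + 1}"

lemma tdarts_sub: "i \<le> 2 \<Longrightarrow> tdarts i \<subseteq> code_darts"
  by (auto simp: tdarts_def code_darts_def valid_def)

lemma color_darts_eq:
  assumes "i \<le> 2"
  shows "color_darts M c i = \<phi> ` tdarts i"
proof -
  have *: "\<phi> d \<in> color_darts M c i \<longleftrightarrow> d \<in> tdarts i" if "d \<in> code_darts" for d
  proof -
    obtain j k where d: "d = Tl j k \<or> d = Hd j k" by (cases d) auto
    then have v: "valid j k" using that by (auto simp: code_darts_def)
    have e: "edge M (\<phi> d) = {\<phi> (Tl j k), \<phi> (Hd j k)}" using d that by (auto simp: edge_phi)
    have "j \<le> 2" using v by (auto simp: valid_def)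
    then show ?thesis using d that internal_edge_iff[OF v] col[of j k]
      by (auto simp: color_darts_def darts e tdarts_def)
  qed
  show ?thesis
  proof (intro equalityI subsetI)
    fix h assume h: "h \<in> color_darts M c i"
    then obtain d where "h = \<phi> d" "d \<in> code_darts" by (auto simp: color_darts_def darts)
    then show "h \<in> \<phi> ` tdarts i" using h * by simp
  next
    fix h assume "h \<in> \<phi> ` tdarts i"
    then show "h \<in> color_darts M c i" using * tdarts_sub[OF assms] by blast
  qed
qed

definition rname :: "nat \<Rightarrow> nat" where
  "rname i = (if i = 0 then 0 else if i = 1 then n + 2 else 1)"

definition name :: "'h set \<Rightarrow> nat" where
  "name = inv_into {..n + 2} vs"

lemma name_vs [simp]: "k \<le> n + 2 \<Longrightarrow> name (vs k) = k"
  unfolding name_def by (rule inv_into_f_f) (auto simp: inj_on_def vs_eq_iff)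

definition tverts :: "nat \<Rightarrow> 'h set set" where
  "tverts i = insert (vs (rname i)) (vs ` {2..n + 1})"

lemma rname_props: "i \<le> 2 \<Longrightarrow> rname i \<le> n + 2 \<and> rname i \<notin> {2..n + 1} \<and> ext_vertex M i = vs (rname i)"
  using ext_vertex_eq by (auto simp: rname_def numeral_2_eq_2 le_Suc_eq)

lemma par_tree:
  assumes "i \<le> 2" "2 \<le> k" "k \<le> n + 1"
  shows "par i k \<in> insert (rname i) {2..n + 1}" "i = 1 \<longrightarrow> k < par i k" "i \<noteq> 1 \<longrightarrow> par i k < k"
proof -
  have "i = 0 \<or> i = 1 \<or> i = 2" using assms(1) by auto
  then show "par i k \<in> insert (rname i) {2..n + 1}" "i = 1 \<longrightarrow> k < par i k" "i \<noteq> 1 \<longrightarrow> par i k < k"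
    using assms(2,3) par0[of k] par1[of k] par2[of k] by (auto simp: rname_def)
qed

lemma vs_notin: "i \<le> 2 \<Longrightarrow> 2 \<le> k \<Longrightarrow> k \<le> n + 1 \<Longrightarrow> vs k \<noteq> vs (rname i)"
  using rname_props[of i] by (auto simp: vs_eq_iff)

text \<open>Parents have smaller numbers for the colors \<open>0\<close> and \<open>2\<close> but
  larger ones for color \<open>1\<close>, hence the reversed rank.\<close>

lemma parent_tree:
  assumes "i \<le> 2"
  shows "parent_tree (tverts i) (vs (rname i)) (\<lambda>X. vs (par i (name X)))
    (\<lambda>X. if i = 1 then n + 2 - name X else name X)"
proof
  show "vs (rname i) \<in> tverts i" by (simp add: tverts_def)
  fix X assume "X \<in> tverts i" "X \<noteq> vs (rname i)"
  then obtain k where k: "2 \<le> k" "k \<le> n + 1" "X = vs k" unfolding tverts_def by fastforce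
  have "par i k \<le> n + 2" using par_tree(1)[OF assms k(1,2)] rname_props[OF assms] by auto
  then show "vs (par i (name X)) \<in> tverts i \<and>
      (if i = 1 then n + 2 - name (vs (par i (name X))) else name (vs (par i (name X))))
      < (if i = 1 then n + 2 - name X else name X)"
    using k par_tree[OF assms k(1,2)] by (auto simp: tverts_def)
qed

lemma color_graph_eq:
  assumes "i \<le> 2"
  shows "color_graph M c i = parent_tree.A (tverts i) (vs (rname i)) (\<lambda>X. vs (par i (name X)))"
proof -
  interpret parent_tree "tverts i" "vs (rname i)" "\<lambda>X. vs (par i (name X))"
    "\<lambda>X. if i = 1 then n + 2 - name X else name X"
    by (rule parent_tree[OF assms])
  have "color_graph M c i = (\<lambda>k. (vs k, vs (par i k))) ` {2..n + 1} \<union> (\<lambda>k. (vs (par i k), vs k)) ` {2..n + 1}"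
    unfolding color_darts_eq[OF assms] adjacency_phi[OF tdarts_sub[OF assms]]
    by (auto simp: tdarts_def image_Un image_image)
  also have "\<dots> = A"
  proof -
    have *: "{x. x \<in> tverts i \<and> x \<noteq> vs (rname i)} = vs ` {2..n + 1}"
      using vs_notin[OF assms] by (auto simp: tverts_def)
    have "A = (\<lambda>x. (x, vs (par i (name x)))) ` vs ` {2..n + 1} \<union>
        (\<lambda>x. (vs (par i (name x)), x)) ` vs ` {2..n + 1}"
      unfolding A_def *[symmetric] by auto
    then show ?thesis unfolding image_image by (auto simp: image_def)
  qed
  finally show ?thesis .
qed

lemma is_tail_Tl:
  assumes "i \<le> 2" "2 \<le> k" "k \<le> n + 1"
  shows "is_tail M c i (\<phi> (Tl i k))"
proof -
  interpret parent_tree "tverts i" "vs (rname i)" "\<lambda>X. vs (par i (name X))"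
    "\<lambda>X. if i = 1 then n + 2 - name X else name X"
    by (rule parent_tree[OF assms(1)])
  have "vs k \<in> tverts i" using assms by (auto simp: tverts_def)
  from path_to_root[OF this] vs_notin[OF assms] obtain q q'
    where "is_path A (vs k # q)" "last (vs k # q) = vs (rname i)" "q = vs (par i (name (vs k))) # q'"
    by blast
  then have q': "is_path A (vs k # vs (par i k) # q')" "last (vs k # vs (par i k) # q') = vs (rname i)"
    using assms(3) by simp_all
  have d: "Tl i k \<in> tdarts i" using assms by (auto simp: tdarts_def)
  then have "Tl i k \<in> code_darts" using tdarts_sub[OF assms(1)] by auto
  then have v: "vert M (\<phi> (Tl i k)) = vs k" "vert M (opp M (\<phi> (Tl i k))) = vs (par i k)"
    using vert_phi[of "Tl i k"] vert_phi[of "Hd i k"] code_darts_flip[of "Tl i k"] by (simp_all add: opp)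
  show ?thesis
    unfolding is_tail_def v color_darts_eq[OF assms(1)] color_graph_eq[OF assms(1), unfolded color_darts_eq[OF assms(1)]]
    using q' d rname_props[OF assms(1)] by (metis phi_in)
qed

lemma not_tail_Hd:
  assumes "i \<le> 2" "2 \<le> k" "k \<le> n + 1"
  shows "\<not> is_tail M c i (\<phi> (Hd i k))"
proof
  interpret parent_tree "tverts i" "vs (rname i)" "\<lambda>X. vs (par i (name X))"
    "\<lambda>X. if i = 1 then n + 2 - name X else name X"
    by (rule parent_tree[OF assms(1)])
  assume "is_tail M c i (\<phi> (Hd i k))"
  moreover have "Hd i k \<in> code_darts" using tdarts_sub[OF assms(1)] assms by (auto simp: tdarts_def)
  then have v: "vert M (\<phi> (Hd i k)) = vs (par i k)" "vert M (opp M (\<phi> (Hd i k))) = vs k"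
    using vert_phi[of "Tl i k"] vert_phi[of "Hd i k"] code_darts_flip[of "Tl i k"] by (simp_all add: opp)
  ultimately obtain q where q: "is_path A (vs (par i k) # vs k # q)"
    "last (vs (par i k) # vs k # q) = vs (rname i)"
    unfolding is_tail_def v color_graph_eq[OF assms(1)] using rname_props[OF assms(1)] by metis
  have "vs k \<in> tverts i" "vs k \<noteq> vs (rname i)"
    using assms vs_notin[OF assms] by (auto simp: tverts_def)
  from no_downward_path[OF this] show False using q assms(3) by simp
qed

lemma is_head_Hd:
  assumes "i \<le> 2" "2 \<le> k" "k \<le> n + 1"
  shows "is_head M c i (\<phi> (Hd i k))"
proof -
  have "Hd i k \<in> tdarts i" using assms by (auto simp: tdarts_def)
  moreover from this have "Hd i k \<in> code_darts" using tdarts_sub[OF assms(1)] by auto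
  ultimately show ?thesis using is_tail_Tl[OF assms] assms(1) by (simp add: is_head_def color_darts_eq opp)
qed

lemma is_head_iff:
  assumes "i \<le> 2"
  shows "is_head M c i h \<longleftrightarrow> (\<exists>k. 2 \<le> k \<and> k \<le> n + 1 \<and> h = \<phi> (Hd i k))"
proof
  assume h: "is_head M c i h"
  then obtain d where d: "d \<in> tdarts i" "h = \<phi> d" by (auto simp: is_head_def color_darts_eq[OF assms])
  have "d \<noteq> Tl i k" if k: "2 \<le> k" "k \<le> n + 1" for k
  proof
    assume "d = Tl i k"
    then have "is_tail M c i (\<phi> (Hd i k))"
      using h d tdarts_sub[OF assms] by (auto simp: is_head_def opp)
    then show False using not_tail_Hd[OF assms k] by simp
  qed
  then show "\<exists>k. 2 \<le> k \<and> k \<le> n + 1 \<and> h = \<phi> (Hd i k)" using d by (force simp: tdarts_def)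
qed (use is_head_Hd[OF assms] in auto)

theorem is_realizer: "realizer M c"
  unfolding realizer_def
proof (intro conjI ballI)
  fix e assume e: "e \<in> internal_edges M"
  then obtain i k where ik: "e = {\<phi> (Tl i k), \<phi> (Hd i k)}" "valid i k"
    by (auto simp: internal_edges_def edges_eq)
  then show "c e \<in> {0, 1, 2}" using internal_edge_iff[OF ik(2)] e col[of i k] by (auto simp: valid_def)
next
  fix i :: nat assume "i \<in> {0, 1, 2}"
  then have i: "i \<le> 2" by auto
  show "is_tree (insert (ext_vertex M i) (internal_vertices M)) (color_graph M c i)"
    using parent_tree.tree[OF parent_tree[OF i]] rname_props[OF i]
    by (simp add: color_graph_eq[OF i] internal_vertices_eq tverts_def)
next
  fix u assume "u \<in> internal_vertices M"
  then obtain k where k: "2 \<le> k" "k \<le> n + 1" "u = vs k" by (auto simp: internal_vertices_eq)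
  obtain H1 H0 H2 where H:
    "map (\<lambda>i. (rot_dart ^^ i) (Tl 0 k)) [0..<card (orbit rot_dart (Tl 0 k))] =
      [Tl 0 k] @ H1 @ [Tl 2 k] @ H0 @ [Tl 1 k] @ H2"
    "orbit rot_dart (Tl 0 k) = set ([Tl 0 k] @ H1 @ [Tl 2 k] @ H0 @ [Tl 1 k] @ H2)"
    "set H1 \<subseteq> range (Hd 1)" "set H0 \<subseteq> range (Hd 0)" "set H2 \<subseteq> range (Hd 2)"
    by (rule rotation_list[OF k(1,2)])
  have d: "Tl 0 k \<in> code_darts" using k by (auto simp: code_darts_def valid_def)
  have orb: "orbit rot_dart (Tl 0 k) = {e \<in> code_darts. org e = k}" using orbit_rot[OF d] by simp
  have pow: "(rot M ^^ m) (\<phi> x) = \<phi> ((rot_dart ^^ m) x)" for m x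
    by (induction m) (auto simp: rot_all)
  have vu: "vert M (\<phi> (Tl 0 k)) = \<phi> ` orbit rot_dart (Tl 0 k)"
    using vert_phi[OF d] orb by (simp add: vs_def)
  have card: "card (vert M (\<phi> (Tl 0 k))) = card (orbit rot_dart (Tl 0 k))"
    unfolding vu using inj by (intro card_image) (auto intro: inj_on_subset)
  have "clockwise_from M (\<phi> (Tl 0 k)) =
      map \<phi> (map (\<lambda>i. (rot_dart ^^ i) (Tl 0 k)) [0..<card (orbit rot_dart (Tl 0 k))])"
    unfolding clockwise_from_def card pow by simp
  also have "\<dots> = [\<phi> (Tl 0 k)] @ map \<phi> H1 @ [\<phi> (Tl 2 k)] @ map \<phi> H0 @ [\<phi> (Tl 1 k)] @ map \<phi> H2"
    unfolding H(1) by simp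
  finally have cw: "clockwise_from M (\<phi> (Tl 0 k)) =
    [\<phi> (Tl 0 k)] @ map \<phi> H1 @ [\<phi> (Tl 2 k)] @ map \<phi> H0 @ [\<phi> (Tl 1 k)] @ map \<phi> H2" .
  have heads: "\<forall>h\<in>set (map \<phi> H). is_head M c i h"
    if "set H \<subseteq> range (Hd i)" "set H \<subseteq> orbit rot_dart (Tl 0 k)" "i \<le> 2" for H i
  proof
    fix h assume "h \<in> set (map \<phi> H)"
    then obtain d where d: "h = \<phi> d" "d \<in> set H" by auto
    then have "d \<in> range (Hd i)" "d \<in> code_darts" "org d = k" using that(1,2) orb by auto
    then obtain k' where k': "h = \<phi> (Hd i k')" "Hd i k' \<in> code_darts" "org (Hd i k') = k"
      using d by auto
    \<comment> \<open>The edges that leave \<open>v\<^sub>2\<close> and \<open>v\<^sub>1\<close> end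
      in external vertices, so their heads are not at \<open>k\<close>.\<close>
    have "k' \<noteq> n + 2 \<and> 2 \<le> k'"
      using k' k p0_end p2_end by (auto simp: code_darts_def valid_def par_def p0_def split: if_splits)
    then show "is_head M c i h" using k' that(3) by (auto simp: code_darts_def valid_def intro: is_head_Hd)
  qed
  have mem: "\<phi> (Tl 0 k) \<in> u" using d k by (auto simp: vs_def)
  have "set H1 \<subseteq> orbit rot_dart (Tl 0 k)" "set H0 \<subseteq> orbit rot_dart (Tl 0 k)"
    "set H2 \<subseteq> orbit rot_dart (Tl 0 k)"
    unfolding H(2) by auto
  then have hds: "\<forall>h\<in>set (map \<phi> H1). is_head M c 1 h" "\<forall>h\<in>set (map \<phi> H0). is_head M c 0 h"
    "\<forall>h\<in>set (map \<phi> H2). is_head M c 2 h"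
    using heads[of H1 1] heads[of H0 0] heads[of H2 2] H(3-5) by simp_all
  have tls: "is_tail M c 0 (\<phi> (Tl 0 k))" "is_tail M c 1 (\<phi> (Tl 1 k))" "is_tail M c 2 (\<phi> (Tl 2 k))"
    using is_tail_Tl k by simp_all
  show "\<exists>t0\<in>u. \<exists>H1 t2 H0 t1 H2.
        clockwise_from M t0 = [t0] @ H1 @ [t2] @ H0 @ [t1] @ H2 \<and>
        is_tail M c 0 t0 \<and> is_tail M c 1 t1 \<and> is_tail M c 2 t2 \<and>
        (\<forall>h\<in>set H0. is_head M c 0 h) \<and>
        (\<forall>h\<in>set H1. is_head M c 1 h) \<and>
        (\<forall>h\<in>set H2. is_head M c 2 h)"
    by (rule bexI[OF _ mem], intro exI conjI, rule cw) (fact tls hds)+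
qed

end

section \<open>The tour of a presented map\<close>

lemma first_hit_list:
  assumes "successively (\<lambda>x y. y = f x) ys" "ys \<noteq> []" "last ys \<in> D" "set (butlast ys) \<inter> D = {}"
  shows "first_hit f D (hd ys) = last ys"
proof -
  obtain a xs where ys: "ys = a # xs" using assms(2) by (cases ys) auto
  have pow: "(f ^^ i) a = ys ! i" if "i \<le> length xs" for i
    using successively_nth_funpow[of f a xs i] assms(1) that ys by simp
  have lst: "last ys = ys ! length xs" by (simp add: ys last_conv_nth)
  have "(LEAST k. (f ^^ k) a \<in> D) = length xs"
  proof (rule Least_equality)
    show "(f ^^ length xs) a \<in> D" using pow[of "length xs"] lst assms(3) by simp
    fix k assume k: "(f ^^ k) a \<in> D"
    show "length xs \<le> k"
    proof (rule ccontr)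
      assume "\<not> length xs \<le> k"
      then have "k < length (butlast ys)" using ys by auto
      then have "ys ! k \<in> set (butlast ys)" by (metis nth_butlast nth_mem)
      then show False using k pow[of k] \<open>\<not> length xs \<le> k\<close> assms(4) by auto
    qed
  qed
  then show ?thesis using pow[of "length xs"] lst ys by (simp add: first_hit_def)
qed

lemma first_occurrences_snoc:
  "first_occurrences (xs @ [x]) = (if x \<in> set xs then first_occurrences xs else first_occurrences xs @ [x])"
  by (simp add: first_occurrences_def)

lemma set_first_occurrences [simp]: "set (first_occurrences xs) = set xs"
  by (simp add: first_occurrences_def)

context presented
begin

text \<open>The half-edge that the tour traverses with letter \<open>j\<close>. It differs from
  \<open>turn j\<close> at a letter S only, where the tour leaves by the \<open>0\<close>-tail and
  not by the \<open>1\<close>-tail.\<close>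

definition tour_dart :: "nat \<Rightarrow> dart" where
  "tour_dart j = (if w j = N then Hd 0 (cnt j) else Tl 0 (hd (stk j)))"

lemma N_before_end: "j < 2 * n \<Longrightarrow> w j = N \<Longrightarrow> 2 \<le> cnt j \<and> cnt j \<le> n + 1"
  using cnt_strict[of j "2 * n"] cnt_end cnt_ge[of j] by simp

lemma S_bounds:
  assumes "j < 2 * n" "w j \<noteq> N"
  obtains a a' A where "stk j = a # a' # A" "a' < a" "2 \<le> a" "a \<le> n + 1" "a < cnt j"
proof -
  have j: "j \<le> 2 * n" using assms by simp
  obtain a a' A where A: "stk j = a # a' # A" "a' < a" "2 \<le> a" using S_step[OF j assms(2)] by metis
  moreover have "a < cnt j" using run(7)[OF j] A by auto
  moreover have "cnt j \<le> n + 2" by (rule cnt_le[OF j])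
  ultimately show thesis using that by simp
qed

text \<open>At a letter N the turn itself has color \<open>0\<close>. At a letter S only
  \<open>2\<close>-heads lie between the \<open>1\<close>-tail and the
  \<open>0\<close>-tail.\<close>

lemma turn_list:
  assumes "j < 2 * n"
  shows "\<exists>ys. ys \<noteq> [] \<and> steps ys \<and> hd ys = turn j \<and> last ys = tour_dart j \<and>
    last ys \<in> tdarts 0 \<and> set (butlast ys) \<inter> tdarts 0 = {}"
proof (cases "w j = N")
  case True
  then show ?thesis using N_before_end[OF assms]
    by (intro exI[of _ "[turn j]"]) (auto simp: turn_def tour_dart_def tdarts_def)
next
  case False
  obtain a a' A where A: "stk j = a # a' # A" "2 \<le> a" "a \<le> n + 1" using S_bounds[OF assms False] by metis
  obtain xs where xs: "steps (Tl 1 a # xs @ [Tl 0 a])" "set xs \<subseteq> range (Hd 2)"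
    using steps_2[OF A(2,3)] by auto
  have "set (butlast (Tl 1 a # xs @ [Tl 0 a])) \<inter> tdarts 0 = {}"
    using xs(2) by (auto simp: butlast_append tdarts_def)
  then show ?thesis using xs A False
    by (intro exI[of _ "Tl 1 a # xs @ [Tl 0 a]"]) (auto simp: turn_def tour_dart_def tdarts_def)
qed

lemma first_hit_phi: "first_hit (rot M) (\<phi> ` X) (\<phi> d) = \<phi> (first_hit rot_dart X d)"
proof -
  have pow: "(rot M ^^ m) (\<phi> d) = \<phi> ((rot_dart ^^ m) d)" for m
    by (induction m) (auto simp: rot_all)
  show ?thesis unfolding first_hit_def pow phi_in ..
qed

text \<open>Between the root half-edge and the first child of \<open>v\<^sub>0\<close> lies only the
  external edge to \<open>v\<^sub>2\<close>.\<close>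

lemma tour_start: "first_hit rot_dart (tdarts 0) (Hd 0 (n + 2)) = tour_dart 0"
proof -
  obtain ys where ys: "ys \<noteq> []" "steps ys" "hd ys = turn 0" "last ys = tour_dart 0"
    "last ys \<in> tdarts 0" "set (butlast ys) \<inter> tdarts 0 = {}"
  proof -
    have "0 < 2 * n" using n_pos by simp
    from turn_list[OF this] show thesis using that by blast
  qed
  have "frontier_dart (hd (stk 0)) (hd (sky 0)) = Hd 0 1" by (simp add: frontier_dart_def)
  then have "rot_dart (Hd 0 1) = turn 0" using rot_junction[of 0] by simp
  then have st: "steps ([Hd 0 (n + 2), Hd 0 1] @ ys)"
    unfolding successively_append_iff using ys(1-3) rot_root(1) by simp
  have "Hd 0 (n + 2) \<notin> tdarts 0" "Hd 0 1 \<notin> tdarts 0" by (auto simp: tdarts_def)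
  then have "set (butlast ([Hd 0 (n + 2), Hd 0 1] @ ys)) \<inter> tdarts 0 = {}"
    using ys(1,6) by (simp add: butlast_append)
  from first_hit_list[OF st _ _ this] show ?thesis using ys(1,4,5) by simp
qed

text \<open>After a letter N the rotation at the new vertex first passes over its fan, which has no
  further half-edge of color \<open>0\<close>. After a letter S it goes on right behind the
  \<open>0\<close>-head of the vertex just left.\<close>

lemma tour_step:
  assumes "Suc j < 2 * n"
  shows "first_hit rot_dart (tdarts 0) (rot_dart (flip (tour_dart j))) = tour_dart (Suc j)"
proof -
  obtain ys where ys: "ys \<noteq> []" "steps ys" "hd ys = turn (Suc j)" "last ys = tour_dart (Suc j)"
    "last ys \<in> tdarts 0" "set (butlast ys) \<inter> tdarts 0 = {}"
    using turn_list[OF assms] by blast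
  have rot: "rot_dart (frontier_dart (hd (stk (Suc j))) (hd (sky (Suc j)))) = turn (Suc j)"
    using rot_junction[of "Suc j"] assms by simp
  show ?thesis
  proof (cases "w j = N")
    case True
    let ?k = "cnt j"
    have k: "2 \<le> ?k" "?k \<le> n + 1" using N_before_end[of j] True assms by auto
    obtain xs where xs: "steps (Tl 0 ?k # xs @ [Tl 2 ?k])" "set xs \<subseteq> range (Hd 1)"
      using steps_1[of ?k] k by auto
    have rot2: "rot_dart (Tl 2 ?k) = turn (Suc j)"
      using rot unfolding tl2_junction[OF k, unfolded tm_cnt[OF True]] .
    have "steps (xs @ [Tl 2 ?k])" using xs(1) by (simp add: successively_Cons)
    then have "steps ((xs @ [Tl 2 ?k]) @ ys)"
      using ys(1-3) rot2 by (simp only: successively_append_iff) simp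
    moreover have "set (butlast ((xs @ [Tl 2 ?k]) @ ys)) \<inter> tdarts 0 = {}"
      using ys(1,6) xs(2) by (auto simp: butlast_append tdarts_def)
    moreover have "hd ((xs @ [Tl 2 ?k]) @ ys) = rot_dart (flip (tour_dart j))"
      using xs(1) True by (cases xs) (auto simp: tour_dart_def)
    ultimately show ?thesis
      using first_hit_list[of rot_dart "(xs @ [Tl 2 ?k]) @ ys" "tdarts 0"] ys by (simp del: append_assoc)
  next
    case False
    then obtain a a' A where A: "stk j = a # a' # A" "a' < a" using S_bounds[of j] assms by (metis Suc_lessD)
    then have "rot_dart (flip (tour_dart j)) = turn (Suc j)"
      using rot False by (simp add: frontier_dart_def tour_dart_def)
    then show ?thesis using first_hit_list[OF ys(2,1,5,6)] ys(3,4) by simp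
  qed
qed

lemma tdarts_props: "d \<in> tdarts 0 \<Longrightarrow> flip d \<in> tdarts 0" "d \<in> tdarts 0 \<Longrightarrow> d \<in> code_darts"
  using tdarts_sub[of 0] by (auto simp: tdarts_def)

lemma tour_dart_in: "j < 2 * n \<Longrightarrow> tour_dart j \<in> tdarts 0"
  using turn_list[of j] by auto

lemma last_S: "w (2 * n - 1) = S" "cnt (2 * n - 1) = n + 2"
proof -
  have e: "2 * n = Suc (2 * n - 1)" using n_pos by simp
  have "w (2 * n - 1) \<noteq> N"
  proof
    assume "w (2 * n - 1) = N"
    then have "stk (2 * n) = cnt (2 * n - 1) # stk (2 * n - 1)" by (subst e) simp
    then show False using stk_end cnt_ge[of "2 * n - 1"] by simp
  qed
  then show "w (2 * n - 1) = S" using letter_cases by metis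
  then have "cnt (2 * n) = cnt (2 * n - 1)" by (subst e) simp
  then show "cnt (2 * n - 1) = n + 2" using cnt_end by simp
qed

lemma T0_simps:
  "darts (T0 M c) = \<phi> ` tdarts 0"
  "d \<in> tdarts 0 \<Longrightarrow> rot (T0 M c) (\<phi> d) = \<phi> (first_hit rot_dart (tdarts 0) (rot_dart d))"
  "d \<in> tdarts 0 \<Longrightarrow> opp (T0 M c) (\<phi> d) = \<phi> (flip d)"
  using tdarts_props(2)
  by (simp_all add: T0_def submap_def color_darts_eq rot_all opp first_hit_phi)

text \<open>The last letter S leaves the last child of \<open>v\<^sub>0\<close>. Its
  \<open>0\<close>-head directly precedes the root half-edge, so it is the root of
  \<open>T0\<close>.\<close>

lemma tour_first: "rot (T0 M c) (root (T0 M c)) = \<phi> (tour_dart 0)"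
proof -
  have e: "2 * n = Suc (2 * n - 1)" using n_pos by simp
  obtain a a' A where A: "stk (2 * n - 1) = a # a' # A" "2 \<le> a" "a \<le> n + 1"
    using S_bounds[of "2 * n - 1"] last_S n_pos by (metis diff_less letter.distinct(1) mult_pos_pos less_le_trans zero_less_numeral zero_less_one)
  have "sky (Suc (2 * n - 1)) = a # sky (2 * n - 1)" using last_S(1) A by (simp only: sky.simps) simp
  then have "sky (2 * n) = a # sky (2 * n - 1)" using e by metis
  then have "rot_dart (Hd 0 a) = Hd 0 (n + 2)"
    using rot_junction[of "2 * n"] stk_end last_N cnt_end A(2) by (simp add: frontier_dart_def turn_def)
  then have r: "rot M (\<phi> (Hd 0 a)) = root M" by (simp add: rot_all root)
  have a: "Hd 0 a \<in> tdarts 0" using A by (simp add: tdarts_def)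
  have "first_hit (inv (rot M)) (\<phi> ` tdarts 0) (hd [root M, \<phi> (Hd 0 a)]) = last [root M, \<phi> (Hd 0 a)]"
  proof (rule first_hit_list)
    show "successively (\<lambda>x y. y = inv (rot M) x) [root M, \<phi> (Hd 0 a)]"
      using r permutes_inj[OF rot_perm] by (auto simp: inv_f_eq)
    show "set (butlast [root M, \<phi> (Hd 0 a)]) \<inter> \<phi> ` tdarts 0 = {}"
      by (auto simp: root tdarts_def)
  qed (use a in auto)
  then have "root (T0 M c) = \<phi> (Hd 0 a)" by (simp add: T0_def submap_def color_darts_eq)
  then show ?thesis
    using T0_simps(2)[OF a] \<open>rot_dart (Hd 0 a) = Hd 0 (n + 2)\<close> tour_start by simp
qed

lemma card_tdarts: "card (tdarts 0) = 2 * n"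
proof -
  have "card (tdarts 0) = card (Tl 0 ` {2..n + 1}) + card (Hd 0 ` {2..n + 1})"
    unfolding tdarts_def by (rule card_Un_disjoint) auto
  then show ?thesis by (simp add: card_image inj_on_def)
qed

lemma tour_eq: "tour (T0 M c) = map (\<lambda>j. \<phi> (tour_dart j)) [0..<2 * n]"
proof -
  let ?f = "\<lambda>h. rot (T0 M c) (opp (T0 M c) h)"
  have "(?f ^^ j) (\<phi> (tour_dart 0)) = \<phi> (tour_dart j)" if "j < 2 * n" for j
    using that
  proof (induction j)
    case (Suc j)
    have d: "tour_dart j \<in> tdarts 0" using tour_dart_in Suc.prems by simp
    then have "?f (\<phi> (tour_dart j)) = \<phi> (tour_dart (Suc j))"
      using tour_step[OF Suc.prems] tdarts_props by (simp add: T0_simps)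
    then show ?case using Suc by simp
  qed simp
  moreover have "card (darts (T0 M c)) = 2 * n"
    unfolding T0_simps(1) using card_tdarts inj by (subst card_image) (auto intro: inj_on_subset)
  ultimately show ?thesis by (simp add: tour_def tour_first)
qed

lemma omega_eq: "omega (T0 M c) = map w [0..<2 * n]"
proof -
  have "opp (T0 M c) (\<phi> (tour_dart k)) \<in> set (take k (map (\<lambda>j. \<phi> (tour_dart j)) [0..<2 * n])) \<longleftrightarrow> w k = S"
    if k: "k < 2 * n" for k
  proof -
    have "opp (T0 M c) (\<phi> (tour_dart k)) \<in> set (take k (map (\<lambda>j. \<phi> (tour_dart j)) [0..<2 * n])) \<longleftrightarrow>
        (\<exists>i<k. flip (tour_dart k) = tour_dart i)"
      using k tour_dart_in[OF k] by (auto simp: take_map T0_simps image_iff)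
    also have "\<dots> \<longleftrightarrow> w k = S"
    proof (cases "w k = N")
      case True
      \<comment> \<open>A vertex left at time \<open>i\<close> has been attached before, so its
        number is below \<open>cnt i\<close>.\<close>
      have "flip (tour_dart k) \<noteq> tour_dart i" if i: "i < k" for i
      proof
        assume "flip (tour_dart k) = tour_dart i"
        then have "w i \<noteq> N" "hd (stk i) = cnt k" using True by (auto simp: tour_dart_def split: if_splits)
        then have "cnt k < cnt i" using S_bounds[of i] i k by (metis less_trans list.sel(1))
        then show False using cnt_mono[of i k] i by simp
      qed
      then show ?thesis using True by auto
    next
      case False
      obtain a a' A where A: "stk k = a # a' # A" "2 \<le> a" "a < cnt k" using S_bounds[OF k False] by metis
      then have "flip (tour_dart k) = tour_dart (tm a)" "tm a < k"
        using tm_props[of a k] False by (auto simp: tour_dart_def)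
      then show ?thesis using False letter_cases[of k] by auto
    qed
    finally show ?thesis .
  qed
  then show ?thesis
    unfolding omega_def tour_eq using letter_cases by (intro nth_equalityI) (auto simp del: take_map, metis)
qed

lemma vert_tour: "j < 2 * n \<Longrightarrow> vert M (\<phi> (tour_dart j)) = vs (hd (stk j))"
proof -
  assume j: "j < 2 * n"
  have "org (tour_dart j) = hd (stk j)"
    using tm_cnt[of j] cnt_ge[of j] by (auto simp: tour_dart_def par_def p0_def)
  then show ?thesis using vert_phi tdarts_props(2)[OF tour_dart_in[OF j]] by metis
qed

text \<open>Only a letter N reaches a new vertex; a letter S returns to an ancestor met before.
  \<open>v\<^sub>2\<close>, with number 1, is not on \<open>T\<^sub>0\<close>.\<close>

lemma first_visits:
  "j < 2 * n \<Longrightarrow> first_occurrences (map (\<lambda>j. vs (hd (stk j))) [0..<Suc j]) = map vs (0 # [2..<cnt j])"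
proof (induction j)
  case 0
  then show ?case by (simp add: first_occurrences_def)
next
  case (Suc j)
  let ?xs = "map (\<lambda>j. vs (hd (stk j))) [0..<Suc j]"
  have j: "j < 2 * n" using Suc.prems by simp
  have set: "set ?xs = vs ` ({0} \<union> {2..<cnt j})"
    using arg_cong[OF Suc.IH[OF j], of set] by (simp only: set_first_occurrences) auto
  have split: "map (\<lambda>j. vs (hd (stk j))) [0..<Suc (Suc j)] = ?xs @ [vs (hd (stk (Suc j)))]" by simp
  have le: "cnt j \<le> n + 2" using cnt_le[of j] j by simp
  show ?case
  proof (cases "w j = N")
    case True
    have "vs (cnt j) \<notin> set ?xs"
      unfolding set using vs_inj[OF le] cnt_ge[of j] by force
    then show ?thesis
      unfolding split first_occurrences_snoc Suc.IH[OF j] using True cnt_ge[of j] by simp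
  next
    case False
    obtain a a' A where A: "stk j = a # a' # A" "a' < a" "a < cnt j" using S_bounds[OF j False] by metis
    have "a' \<noteq> 1" using zero_one_mem(3)[of j] A j by auto
    then have "vs a' \<in> vs ` ({0} \<union> {2..<cnt j})" using A by (intro imageI) auto
    then have "vs (hd (stk (Suc j))) \<in> set ?xs" unfolding set using A(1) False by simp
    then show ?thesis unfolding split first_occurrences_snoc Suc.IH[OF j] by (simp only: if_True cnt.simps False if_False)
  qed
qed

lemma clockwise_vertices_eq: "clockwise_vertices M c = map vs [2..<n + 2]"
proof -
  have e: "2 * n = Suc (2 * n - 1)" using n_pos by simp
  have "map (vert M) (tour (T0 M c)) = map (\<lambda>j. vs (hd (stk j))) [0..<Suc (2 * n - 1)]"
    unfolding tour_eq e[symmetric] by (simp add: vert_tour)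
  then have "first_occurrences (map (vert M) (tour (T0 M c))) = map vs (0 # [2..<n + 2])"
    using first_visits[of "2 * n - 1"] last_S(2) n_pos by simp
  moreover have "vs 0 \<notin> vs ` {2..n + 1}" using vs_inj[of 0] by force
  ultimately show ?thesis
    unfolding clockwise_vertices_def internal_vertices_eq by (auto simp: filter_map intro!: filter_True)
qed

lemma card_heads:
  assumes "2 \<le> k" "k \<le> n + 2"
  shows "card {h \<in> vs k. is_head M c 1 h} = b k"
proof -
  note t = tm[OF assms]
  let ?j = "tm k"
  have bl: "b k < length (sky ?j)" using b_lt[OF t(3,1)] t(2) by simp
  have "{h \<in> vs k. is_head M c 1 h} = (\<lambda>x. \<phi> (Hd 1 x)) ` set (take (b k) (sky ?j))"
  proof (intro equalityI subsetI)
    fix h assume "h \<in> {h \<in> vs k. is_head M c 1 h}"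
    then obtain x where x: "2 \<le> x" "x \<le> n + 1" "h = \<phi> (Hd 1 x)" "p1 x = k"
      by (auto simp: is_head_iff vs_def par_def)
    obtain j i where ji: "(j, Suc i) \<in> fan" "sky j ! i = x" using popped_at[OF x(1,2)] by auto
    then have j: "j \<le> 2 * n" "w j = N" "i < b (cnt j)" using fanD by fastforce+
    then have "cnt j = k" using p1_eq ji x by auto
    then have "j = ?j" using tm_cnt[OF j(2)] by simp
    then have "x \<in> set (take (b k) (sky ?j))"
      using j ji(2) bl \<open>cnt j = k\<close> by (auto simp: in_set_conv_nth intro!: exI[of _ i])
    then show "h \<in> (\<lambda>x. \<phi> (Hd 1 x)) ` set (take (b k) (sky ?j))" using x by simp
  next
    fix h assume "h \<in> (\<lambda>x. \<phi> (Hd 1 x)) ` set (take (b k) (sky ?j))"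
    then obtain i where i: "i < b k" "h = \<phi> (Hd 1 (sky ?j ! i))"
      using bl by (auto simp: in_set_conv_nth)
    let ?x = "sky ?j ! i"
    have mem: "?x \<in> set (sky ?j)" using i bl by simp
    \<comment> \<open>The last entry of \<open>sky\<close> is \<open>v\<^sub>2\<close>. It is never
      covered, as \<open>b k\<close> is less than the length.\<close>
    have "?x \<noteq> last (sky ?j)"
      using run(6)[OF t(3)] run(3)[OF t(3)] i bl
      by (auto simp: last_conv_nth nth_eq_iff_index_eq)
    then have "?x \<noteq> 1" using run(4)[OF t(3)] by simp
    moreover have "?x \<noteq> 0" using mem zero_one_mem(4)[OF t(3)] by metis
    moreover have "?x < k" using mem run(8)[OF t(3)] t(2) by auto
    ultimately have x: "2 \<le> ?x" "?x \<le> n + 1" using assms by auto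
    moreover have "p1 ?x = k" using p1_eq[OF t(3,1)] i t(2) by simp
    ultimately show "h \<in> {h \<in> vs k. is_head M c 1 h}"
      using i by (auto simp: is_head_iff vs_def par_def code_darts_def valid_def)
  qed
  moreover have "inj_on (\<lambda>x. \<phi> (Hd 1 x)) X" for X by (auto simp: inj_on_def)
  moreover have "distinct (take (b k) (sky ?j))" using run(6)[OF t(3)] by simp
  then have "card (set (take (b k) (sky ?j))) = b k" using bl by (simp add: distinct_card)
  ultimately show ?thesis by (simp add: card_image)
qed

theorem Psi_eq: "Psi (M, c) = (map w [0..<2 * n], ns_word (map b [3..<n + 3]))"
proof -
  \<comment> \<open>\<open>u\<^sub>i\<close> has the number \<open>i + 2\<close>, and for
    \<open>i = n\<close> this is the number of \<open>v\<^sub>1\<close>.\<close>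
  have "beta M c i = b (i + 2)" if "1 \<le> i" "i \<le> n" for i
  proof -
    have "(if i < size_tri M then clockwise_vertices M c ! i else ext_vertex M 1) = vs (i + 2)"
    proof (cases "i < n")
      case True
      then have "map vs [2..<n + 2] ! i = vs ([2..<n + 2] ! i)" by (intro nth_map) (simp del: upt_Suc)
      also have "[2..<n + 2] ! i = i + 2" using True by (subst nth_upt) auto
      finally show ?thesis using True by (simp only: size_eq clockwise_vertices_eq if_True)
    next
      case False
      then have "i = n" using that by simp
      then show ?thesis by (simp only: size_eq ext_vertex_eq less_irrefl if_False)
    qed
    then show ?thesis unfolding beta_def using card_heads[of "i + 2"] that by simp
  qed
  then have "map (beta M c) [1..<Suc (size_tri M)] = map (\<lambda>i. b (i + 2)) [1..<Suc n]"
    unfolding size_eq by (intro map_cong) (auto simp del: upt_Suc)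
  also have "\<dots> = map b [3..<n + 3]"
    by (rule nth_equalityI) (auto simp: numeral_3_eq_3 simp del: upt_Suc)
  finally show ?thesis by (simp add: omega_eq)
qed

end

section \<open>The local structure of a realizer\<close>

text \<open>If \<open>x\<close> and \<open>y\<close> differed, the two paths, cut where the first
  one meets the second, would form a cycle with \<open>a\<close>.\<close>

lemma acyclic_unique_exit:
  assumes acyc: "\<nexists>c. is_cycle A c" and sym: "\<And>x y. (x, y) \<in> A \<Longrightarrow> (y, x) \<in> A"
    and p: "is_path A (x # p)" and q: "is_path A (y # q)" and ends: "last (x # p) = last (y # q)"
    and a: "a \<notin> set (x # p)" "a \<notin> set (y # q)" "(a, x) \<in> A" "(a, y) \<in> A"
  shows "x = y"
proof (rule ccontr)
  assume "x \<noteq> y"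
  have "\<exists>z\<in>set (x # p). z \<in> set (y # q)" using ends by (metis last_in_set list.distinct(1))
  then obtain xs z ys where z: "x # p = xs @ z # ys" "z \<in> set (y # q)" "\<forall>t\<in>set xs. t \<notin> set (y # q)"
    using split_list_first_prop[of "x # p" "\<lambda>z. z \<in> set (y # q)"] by metis
  obtain us vs where us: "y # q = us @ z # vs" using z(2) by (meson split_list)
  let ?c = "a # xs @ [z] @ rev us"
  have "successively (\<lambda>u v. (u, v) \<in> A) ((xs @ [z]) @ ys)" "distinct ((xs @ [z]) @ ys)"
    using p unfolding is_path_def z(1) by simp_all
  then have 1: "successively (\<lambda>u v. (u, v) \<in> A) (xs @ [z])" "distinct (xs @ [z])"
    by (simp_all only: successively_append_iff distinct_append)
  have "successively (\<lambda>u v. (u, v) \<in> A) ((us @ [z]) @ vs)" "distinct ((us @ [z]) @ vs)"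
    using q unfolding is_path_def us by simp_all
  then have 2: "successively (\<lambda>u v. (u, v) \<in> A) (us @ [z])" "distinct (us @ [z])"
    by (simp_all only: successively_append_iff distinct_append)
  have "successively (\<lambda>u v. (u, v) \<in> A) (rev (us @ [z]))"
    unfolding successively_rev using 2(1) sym unfolding successively_conv_nth by blast
  then have 3: "successively (\<lambda>u v. (u, v) \<in> A) (z # rev us)" by simp
  have hdx: "hd (xs @ [z]) = x" using z(1) by (cases xs) auto
  have "successively (\<lambda>u v. (u, v) \<in> A) (a # xs @ [z])"
    using 1(1) a(3) hdx by (cases "xs @ [z]") auto
  then have "successively (\<lambda>u v. (u, v) \<in> A) ((a # xs) @ [z])" by simp
  then have "successively (\<lambda>u v. (u, v) \<in> A) ((a # xs) @ z # rev us)"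
    using 3 unfolding successively_append_iff[of _ "a # xs"] by simp
  moreover have "distinct ?c"
  proof -
    have "set xs \<inter> set us = {}" "a \<notin> set xs \<union> set us \<union> {z}" using z us a(1,2) by auto
    then show ?thesis using 1(2) 2(2) by auto
  qed
  moreover have "3 \<le> length ?c"
  proof -
    have "xs \<noteq> [] \<or> us \<noteq> []" using z(1) us \<open>x \<noteq> y\<close> by auto
    then have "1 \<le> length xs + length us" by (cases xs; cases us) auto
    then show ?thesis by simp
  qed
  moreover have "last ?c = y" using us by (cases us) auto
  then have "(last ?c, hd ?c) \<in> A" using sym[OF a(4)] by simp
  ultimately have "is_cycle A ?c" by (simp add: is_cycle_def is_path_def)
  with acyc show False by blast
qed

lemma path_last: "is_path A (x # y # p) \<Longrightarrow> last (x # y # p) \<noteq> x"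
  using last_in_set[of "y # p"] unfolding is_path_def by (metis distinct.simps(2) last_ConsR list.distinct(1))

lemma successively_next_mem:
  assumes "successively (\<lambda>x y. y = f x) (xs @ [z])" "x \<in> set xs"
  shows "f x \<in> set (tl xs) \<union> {z}"
proof -
  obtain i where i: "i < length xs" "xs ! i = x" using assms(2) by (auto simp: in_set_conv_nth)
  have "(xs @ [z]) ! Suc i = f ((xs @ [z]) ! i)"
    using assms(1) i by (simp add: successively_conv_nth)
  then have e: "(xs @ [z]) ! Suc i = f x" using i by (simp add: nth_append)
  show ?thesis
  proof (cases "Suc i = length xs")
    case True
    then show ?thesis using e by (simp add: nth_append)
  next
    case False
    then have "xs ! Suc i = f x" "Suc i < length xs" using e i by (auto simp: nth_append)
    then have "tl xs ! i = f x" "i < length (tl xs)" by (auto simp: nth_tl)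
    then show ?thesis by (metis UnI1 nth_mem)
  qed
qed

lemma self_orbit_list:
  assumes "h \<in> orbit f h"
  shows "set (map (\<lambda>k. (f ^^ k) h) [0..<card (orbit f h)]) = orbit f h"
    "(f ^^ card (orbit f h)) h = h" "0 < card (orbit f h)"
    "successively (\<lambda>x y. y = f x) (map (\<lambda>k. (f ^^ k) h) [0..<card (orbit f h)] @ [h])"
proof -
  let ?m = "funpow_dist1 f h h"
  have orb: "orbit f h = (\<lambda>n. (f ^^ n) h) ` {0..<?m}" by (rule orbit_conv_funpow_dist1[OF assms])
  have card: "card (orbit f h) = ?m"
    using card_image[OF inj_on_funpow_dist1[OF assms]] orb by simp
  show "set (map (\<lambda>k. (f ^^ k) h) [0..<card (orbit f h)]) = orbit f h"
    unfolding card using orb by (simp only: set_map set_upt)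
  show per: "(f ^^ card (orbit f h)) h = h" unfolding card by (rule funpow_dist1_prop[OF assms])
  show "0 < card (orbit f h)" unfolding card by simp
  have "map (\<lambda>k. (f ^^ k) h) [0..<card (orbit f h)] @ [h] = map (\<lambda>k. (f ^^ k) h) [0..<Suc (card (orbit f h))]"
    using per by simp
  then show "successively (\<lambda>x y. y = f x) (map (\<lambda>k. (f ^^ k) h) [0..<card (orbit f h)] @ [h])"
    by (simp only:) (auto simp: successively_conv_nth simp del: upt_Suc)
qed

locale realizer_map =
  fixes M :: "'h rooted_map" and c :: "'h coloring" and n :: nat
  assumes tri: "triangulation M" and real: "realizer M c" and size: "size_tri M = n"
begin

lemma planar: "planar_map M"
  using tri by (simp add: triangulation_def)

lemma basic:
  "finite (darts M)" "root M \<in> darts M" "rot M permutes darts M" "opp M permutes darts M"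
  "h \<in> darts M \<Longrightarrow> opp M h \<noteq> h" "h \<in> darts M \<Longrightarrow> opp M (opp M h) = h"
  "h \<in> darts M \<Longrightarrow> vert M h \<noteq> vert M (opp M h)"
  using planar by (auto simp: planar_map_def)

lemma opp_in: "h \<in> darts M \<Longrightarrow> opp M h \<in> darts M"
  using permutes_in_image[OF basic(4)] by simp

lemma rot_in: "h \<in> darts M \<Longrightarrow> rot M h \<in> darts M"
  using permutes_in_image[OF basic(3)] by simp

lemma perm_rot: "permutation (rot M)"
  using basic(1,3) by (auto simp: permutation_permutes)

lemma rot_eq_iff: "rot M h = rot M h' \<longleftrightarrow> h = h'"
  using permutes_inj[OF basic(3)] by (auto dest: injD)

lemma vert_rot: "vert M (rot M h) = vert M h"
  by (simp add: vert_def permutation_orbit_step[OF perm_rot])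

lemma vert_self: "h \<in> vert M h"
  by (simp add: vert_def permutation_self_in_orbit[OF perm_rot])

lemma vert_eq: "h' \<in> vert M h \<Longrightarrow> vert M h' = vert M h"
  unfolding vert_def
  by (rule orbit_cyclic_eq3[OF cyclic_on_orbit'[OF perm_rot]])

lemma vert_darts: "h \<in> darts M \<Longrightarrow> vert M h \<subseteq> darts M"
  unfolding vert_def by (rule permutes_orbit_subset[OF basic(3)])

lemma vert_mem: "u \<in> vertices M \<Longrightarrow> h \<in> u \<Longrightarrow> h \<in> darts M \<and> vert M h = u"
  using vert_darts vert_eq by (auto simp: vertices_def)

lemma rot_face: "rot M (face_next M h) = opp M h"
  using permutes_inverses(1)[OF basic(3)] by (simp add: face_next_def)

lemma face_nextI: "rot M h' = opp M h \<Longrightarrow> face_next M h = h'"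
  using rot_face rot_eq_iff by metis

lemma face_in: "h \<in> darts M \<Longrightarrow> face_next M h \<in> darts M"
  using opp_in permutes_in_image[OF permutes_inv[OF basic(3)]] by (simp add: face_next_def)

lemma face_perm: "face_next M permutes darts M"
proof -
  have "face_next M = inv (rot M) \<circ> opp M" by (auto simp: face_next_def)
  then show ?thesis using permutes_compose[OF basic(4) permutes_inv[OF basic(3)]] by simp
qed

lemma vert_face: "vert M (face_next M h) = vert M (opp M h)"
  using vert_rot[of "face_next M h"] by (simp add: rot_face)

lemma face3:
  assumes "h \<in> darts M"
  shows "face_next M (face_next M (face_next M h)) = h"
proof -
  have "card (face M h) = 3" using tri assms by (auto simp: triangulation_def faces_def)
  moreover have "h \<in> orbit (face_next M) h"
    using face_perm basic(1) by (intro permutation_self_in_orbit) (auto simp: permutation_permutes)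
  ultimately show ?thesis using self_orbit_list(2)[of h "face_next M"]
    by (simp add: face_def numeral_3_eq_3)
qed

text \<open>In the root face, \<open>root M\<close> runs from \<open>v\<^sub>0\<close> to
  \<open>v\<^sub>1\<close>, \<open>e1\<close> from \<open>v\<^sub>1\<close> to
  \<open>v\<^sub>2\<close> and \<open>e2\<close> from \<open>v\<^sub>2\<close> to
  \<open>v\<^sub>0\<close>.\<close>

definition e1 :: 'h where "e1 = face_next M (root M)"
definition e2 :: 'h where "e2 = face_next M e1"

abbreviation v :: "nat \<Rightarrow> 'h set" where "v \<equiv> ext_vertex M"
abbreviation U :: "'h set set" where "U \<equiv> internal_vertices M"

lemma root_triangle:
  "e1 \<in> darts M" "e2 \<in> darts M" "face_next M e2 = root M"
  "rot M e1 = opp M (root M)" "rot M e2 = opp M e1" "rot M (root M) = opp M e2"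
proof -
  show e: "e1 \<in> darts M" "e2 \<in> darts M" by (auto simp: e1_def e2_def face_in basic)
  show f: "face_next M e2 = root M" using face3[OF basic(2)] by (simp add: e1_def e2_def)
  show "rot M e1 = opp M (root M)" "rot M e2 = opp M e1" "rot M (root M) = opp M e2"
    using rot_face[of "root M"] rot_face[of e1] rot_face[of e2] f by (simp_all add: e1_def e2_def)
qed

lemma v_eqs: "v 0 = vert M (root M)" "v 1 = vert M e1" "v 2 = vert M e2"
  "vert M (opp M (root M)) = v 1" "vert M (opp M e1) = v 2" "vert M (opp M e2) = v 0"
proof -
  show v: "v 0 = vert M (root M)" "v 1 = vert M e1" "v 2 = vert M e2"
    by (simp_all add: ext_vertex_def e1_def e2_def numeral_2_eq_2)
  show "vert M (opp M (root M)) = v 1" "vert M (opp M e1) = v 2" "vert M (opp M e2) = v 0"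
    using vert_face[of "root M"] vert_face[of e1] vert_face[of e2] v root_triangle(3)
    by (simp_all add: e1_def e2_def)
qed

lemma v_distinct: "v 0 \<noteq> v 1" "v 1 \<noteq> v 2" "v 0 \<noteq> v 2"
  using basic(7)[OF basic(2)] basic(7)[OF root_triangle(1)] basic(7)[OF root_triangle(2)] v_eqs by metis+

lemma root_face_eq: "root_face M = {root M, e1, e2}"
proof -
  have "(face_next M ^^ 3) (root M) = root M"
    using root_triangle(3) by (simp add: e1_def e2_def numeral_3_eq_3)
  then have "root_face M = {(face_next M ^^ m) (root M) | m. m < 3}"
    unfolding root_face_def face_def by (rule orbit_altdef_bounded) simp
  also have "\<dots> = (\<lambda>m. (face_next M ^^ m) (root M)) ` {..<3}" by auto
  also have "{..<3} = {0, 1, 2::nat}" by auto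
  finally show ?thesis by (simp add: e1_def e2_def numeral_2_eq_2)
qed

lemma U_eq: "U = vertices M - {v 0, v 1, v 2}"
  unfolding internal_vertices_def root_face_eq v_eqs(1-3) by simp

lemma U_notin: "v 0 \<notin> U" "v 1 \<notin> U" "v 2 \<notin> U"
  by (simp_all add: U_eq)

definition ext :: "'h set" where
  "ext = {root M, e1, e2, opp M (root M), opp M e1, opp M e2}"

lemma opp_ext: "h \<in> ext \<Longrightarrow> opp M h \<in> ext"
  using basic(2,6) root_triangle(1,2) by (auto simp: ext_def)

lemma ext_cases:
  assumes "h \<in> ext"
  shows "vert M h = v 0 \<and> (h = root M \<or> h = opp M e2) \<or>
    vert M h = v 1 \<and> (h = e1 \<or> h = opp M (root M)) \<or>
    vert M h = v 2 \<and> (h = e2 \<or> h = opp M e1)"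
  using assms v_eqs unfolding ext_def by auto

lemma ext_distinct:
  "root M \<noteq> opp M e2" "e1 \<noteq> opp M (root M)" "e2 \<noteq> opp M e1"
  using v_eqs v_distinct basic(6)[OF root_triangle(1)] basic(6)[OF root_triangle(2)] basic(6)[OF basic(2)]
  by metis+

lemma internal_edge_iff:
  assumes "h \<in> darts M"
  shows "edge M h \<in> internal_edges M \<longleftrightarrow> h \<notin> ext"
proof -
  have "opp M h = x \<longleftrightarrow> h = opp M x" if "x \<in> darts M" for x
    using basic(6) assms that by metis
  from this[OF basic(2)] this[OF root_triangle(1)] this[OF root_triangle(2)]
  have "opp M h \<in> {root M, e1, e2} \<longleftrightarrow> h \<in> {opp M (root M), opp M e1, opp M e2}" by simp
  moreover have "edge M h \<inter> root_face M = {} \<longleftrightarrow> h \<notin> {root M, e1, e2} \<and> opp M h \<notin> {root M, e1, e2}"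
    unfolding edge_def root_face_eq by blast
  ultimately have "edge M h \<inter> root_face M = {} \<longleftrightarrow> h \<notin> ext"
    unfolding ext_def by blast
  then show ?thesis using assms by (simp add: internal_edges_def edges_def)
qed

lemma edge_opp: "h \<in> darts M \<Longrightarrow> edge M (opp M h) = edge M h"
  by (auto simp: edge_def basic)

lemma color_iff: "h \<in> color_darts M c i \<longleftrightarrow> h \<in> darts M \<and> h \<notin> ext \<and> c (edge M h) = i"
  using internal_edge_iff by (auto simp: color_darts_def)

lemma color_opp: "h \<in> color_darts M c i \<Longrightarrow> opp M h \<in> color_darts M c i"
  using opp_ext[of "opp M h"] by (auto simp: color_iff edge_opp opp_in basic)

lemma color_ex: "h \<in> darts M \<Longrightarrow> h \<notin> ext \<Longrightarrow> \<exists>i\<le>2. h \<in> color_darts M c i"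
  using real internal_edge_iff[of h] unfolding realizer_def color_iff by (metis insertE le_numeral_extra(3,4) one_le_numeral order_refl singletonD zero_le)

lemma tree: "i \<le> 2 \<Longrightarrow> is_tree (insert (v i) U) (color_graph M c i)"
proof -
  assume "i \<le> 2"
  then have "i \<in> {0, 1, 2}" by auto
  then show ?thesis using real unfolding realizer_def by blast
qed

lemma color_vert:
  assumes "i \<le> 2" "h \<in> color_darts M c i"
  shows "vert M h \<in> insert (v i) U" "vert M (opp M h) \<in> insert (v i) U"
proof -
  have "(vert M h, vert M (opp M h)) \<in> color_graph M c i"
    using assms(2) by (auto simp: adjacency_def)
  then show "vert M h \<in> insert (v i) U" "vert M (opp M h) \<in> insert (v i) U"
    using tree[OF assms(1)] unfolding is_tree_def connected_graph_def by blast+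
qed

lemma tail_color: "is_tail M c i h \<Longrightarrow> h \<in> color_darts M c i"
  and head_color: "is_head M c i h \<Longrightarrow> h \<in> color_darts M c i"
  by (simp_all add: is_tail_def is_head_def)

lemma color_darts_sub: "h \<in> color_darts M c i \<Longrightarrow> h \<in> darts M"
  by (simp add: color_iff)

lemma tail_unique_color: "h \<in> color_darts M c i \<Longrightarrow> h \<in> color_darts M c j \<Longrightarrow> i = j"
  by (simp add: color_iff)

lemma tail_vert:
  assumes "i \<le> 2" "is_tail M c i h"
  shows "vert M h \<in> U"
proof -
  obtain p where p: "is_path (color_graph M c i) (vert M h # vert M (opp M h) # p)"
    "last (vert M h # vert M (opp M h) # p) = v i"
    using assms(2) by (auto simp: is_tail_def)
  then have "vert M h \<noteq> v i" using path_last by metis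
  then show ?thesis using color_vert(1)[OF assms(1) tail_color[OF assms(2)]] by simp
qed

lemma head_opp: "is_head M c i h \<longleftrightarrow> h \<in> darts M \<and> is_tail M c i (opp M h)"
  using color_opp tail_color basic(6) by (metis color_darts_sub is_head_def)

lemma tail_opp: "is_tail M c i h \<longleftrightarrow> h \<in> darts M \<and> is_head M c i (opp M h)"
  using head_opp[of i "opp M h"] tail_color color_darts_sub basic(6) opp_in by metis

lemma color_graph_sym: "(x, y) \<in> color_graph M c i \<Longrightarrow> (y, x) \<in> color_graph M c i"
proof -
  assume "(x, y) \<in> color_graph M c i"
  then obtain h where h: "h \<in> color_darts M c i" "x = vert M h" "y = vert M (opp M h)"
    by (auto simp: adjacency_def)
  then have "opp M h \<in> color_darts M c i" "opp M (opp M h) = h"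
    using color_opp color_darts_sub basic(6) by auto
  then show ?thesis using h unfolding adjacency_def by (metis (mono_tags, lifting) image_eqI)
qed

text \<open>Otherwise the two ends \<open>u\<close> and \<open>w\<close> of the edge would each
  reach \<open>v i\<close> through the other. The path from \<open>w\<close> leaves \<open>u\<close>
  towards some \<open>y\<close>, so both \<open>w\<close> and \<open>y\<close> lead from
  \<open>u\<close> to the root. Acyclicity forces \<open>w = y\<close>, but the path from
  \<open>w\<close> cannot return to \<open>w\<close>.\<close>

lemma not_tail_head:
  assumes "i \<le> 2" "is_tail M c i h"
  shows "\<not> is_head M c i h"
proof
  assume "is_head M c i h"
  then have hd: "is_tail M c i (opp M h)" "h \<in> darts M" by (auto simp: head_opp)
  let ?A = "color_graph M c i" and ?u = "vert M h" and ?w = "vert M (opp M h)"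
  obtain p where p: "is_path ?A (?u # ?w # p)" "last (?u # ?w # p) = v i"
    using assms(2) by (auto simp: is_tail_def)
  obtain q where q: "is_path ?A (?w # ?u # q)" "last (?w # ?u # q) = v i"
    using hd basic(6) by (auto simp: is_tail_def)
  have "?u \<noteq> v i" using p path_last by metis
  then obtain y q' where y: "q = y # q'" using q(2) by (cases q) auto
  have "?w = y"
  proof (rule acyclic_unique_exit[of ?A ?w p y q' ?u])
    show "\<nexists>c. is_cycle ?A c" using tree[OF assms(1)] by (simp add: is_tree_def)
    show "\<And>x y. (x, y) \<in> ?A \<Longrightarrow> (y, x) \<in> ?A" by (rule color_graph_sym)
  qed (use p q y in \<open>auto simp: is_path_def\<close>)
  then show False using q(1) y by (simp add: is_path_def)
qed

definition tau :: "nat \<Rightarrow> 'h set \<Rightarrow> 'h" where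
  "tau i u = (THE h. h \<in> u \<and> is_tail M c i h)"

lemma U_local:
  assumes "u \<in> U"
  obtains t0 H1 t2 H0 t1 H2 where
    "set ([t0] @ H1 @ [t2] @ H0 @ [t1] @ H2) = u"
    "successively (\<lambda>x y. y = rot M x) (([t0] @ H1 @ [t2] @ H0 @ [t1] @ H2) @ [t0])"
    "is_tail M c 0 t0" "is_tail M c 1 t1" "is_tail M c 2 t2"
    "\<forall>h\<in>set H0. is_head M c 0 h" "\<forall>h\<in>set H1. is_head M c 1 h" "\<forall>h\<in>set H2. is_head M c 2 h"
proof -
  obtain t0 H1 t2 H0 t1 H2 where t0: "t0 \<in> u" and
    cw: "clockwise_from M t0 = [t0] @ H1 @ [t2] @ H0 @ [t1] @ H2" and
    rest: "is_tail M c 0 t0" "is_tail M c 1 t1" "is_tail M c 2 t2"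
    "\<forall>h\<in>set H0. is_head M c 0 h" "\<forall>h\<in>set H1. is_head M c 1 h" "\<forall>h\<in>set H2. is_head M c 2 h"
  proof -
    have "\<forall>u\<in>U. \<exists>t0\<in>u. \<exists>H1 t2 H0 t1 H2.
        clockwise_from M t0 = [t0] @ H1 @ [t2] @ H0 @ [t1] @ H2 \<and>
        is_tail M c 0 t0 \<and> is_tail M c 1 t1 \<and> is_tail M c 2 t2 \<and>
        (\<forall>h\<in>set H0. is_head M c 0 h) \<and> (\<forall>h\<in>set H1. is_head M c 1 h) \<and> (\<forall>h\<in>set H2. is_head M c 2 h)"
      using real unfolding realizer_def by (elim conjE)
    from bspec[OF this assms] show thesis by (elim bexE exE conjE) (rule that)
  qed
  have u: "vert M t0 = u" using vert_mem[of u t0] assms t0 by (simp add: U_eq)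
  have orb: "t0 \<in> orbit (rot M) t0" by (rule permutation_self_in_orbit[OF perm_rot])
  note l = self_orbit_list[OF orb]
  have eq: "map (\<lambda>k. (rot M ^^ k) t0) [0..<card (orbit (rot M) t0)] = [t0] @ H1 @ [t2] @ H0 @ [t1] @ H2"
    using cw by (simp add: clockwise_from_def vert_def)
  show thesis
    by (rule that[OF _ _ rest]) (use l(1,4) u in \<open>unfold eq vert_def, simp_all\<close>)
qed

lemma tau_unique:
  assumes "u \<in> U" "i \<le> 2"
  shows "tau i u \<in> u \<and> is_tail M c i (tau i u)" "h \<in> u \<Longrightarrow> is_tail M c i h \<Longrightarrow> h = tau i u"
proof -
  obtain t0 H1 t2 H0 t1 H2 where l:
    "set ([t0] @ H1 @ [t2] @ H0 @ [t1] @ H2) = u"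
    "is_tail M c 0 t0" "is_tail M c 1 t1" "is_tail M c 2 t2"
    "\<forall>h\<in>set H0. is_head M c 0 h" "\<forall>h\<in>set H1. is_head M c 1 h" "\<forall>h\<in>set H2. is_head M c 2 h"
    by (rule U_local[OF assms(1)])
  have tc: "j = i" if "is_tail M c j h" "is_tail M c i h" for h j
    using that tail_unique_color tail_color by metis
  have no_head: "\<not> is_tail M c i h" if "is_head M c j h" for h j
  proof
    assume t: "is_tail M c i h"
    then have "j = i" using that tail_unique_color tail_color head_color by metis
    then show False using that not_tail_head[OF assms(2) t] by simp
  qed
  have i: "i = 0 \<or> i = 1 \<or> i = 2" using assms(2) by auto
  define t where "t = (if i = 0 then t0 else if i = 1 then t1 else t2)"
  have t: "t \<in> u" "is_tail M c i t" using l(1-4) i by (auto simp: t_def)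
  have un: "h = t" if "h \<in> u" "is_tail M c i h" for h
  proof -
    have "h \<notin> set H0 \<union> set H1 \<union> set H2" using no_head that(2) l(5-7) by blast
    then have "h = t0 \<or> h = t1 \<or> h = t2" using that(1) l(1) by auto
    then show ?thesis using tc[OF l(2)] tc[OF l(3)] tc[OF l(4)] that(2) by (auto simp: t_def)
  qed
  have tt: "tau i u = t" unfolding tau_def
    by (rule the_equality) (simp add: t, rule un, simp_all)
  show "tau i u \<in> u \<and> is_tail M c i (tau i u)" unfolding tt using t by simp
  show "h \<in> u \<Longrightarrow> is_tail M c i h \<Longrightarrow> h = tau i u" unfolding tt by (rule un)
qed

lemma tau_props:
  assumes "u \<in> U" "i \<le> 2"
  shows "is_tail M c i (tau i u)" "vert M (tau i u) = u" "tau i u \<in> darts M" "tau i u \<notin> ext"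
proof -
  show t: "is_tail M c i (tau i u)" using tau_unique(1)[OF assms] by simp
  show "vert M (tau i u) = u" using tau_unique(1)[OF assms] vert_mem assms(1) by (simp add: U_eq)
  show "tau i u \<in> darts M" "tau i u \<notin> ext" using tail_color[OF t] by (simp_all add: color_iff)
qed

lemma tail_tau: "i \<le> 2 \<Longrightarrow> is_tail M c i h \<Longrightarrow> h = tau i (vert M h)"
  using tail_vert tau_unique(2) vert_self by metis

lemma head_tau: "i \<le> 2 \<Longrightarrow> is_head M c i h \<Longrightarrow> vert M (opp M h) \<in> U \<and> opp M h = tau i (vert M (opp M h))"
  using head_opp tail_tau tail_vert by metis

text \<open>The local rule as a successor relation: behind a half-edge of a block comes another one
  of this block or the tail that ends it.\<close>

lemma rot_cases:
  assumes "u \<in> U" "vert M h = u"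
  shows "h = tau 0 u \<or> is_head M c 1 h \<Longrightarrow> rot M h = tau 2 u \<or> is_head M c 1 (rot M h)"
    "h = tau 2 u \<or> is_head M c 0 h \<Longrightarrow> rot M h = tau 1 u \<or> is_head M c 0 (rot M h)"
    "h = tau 1 u \<or> is_head M c 2 h \<Longrightarrow> rot M h = tau 0 u \<or> is_head M c 2 (rot M h)"
    "(\<exists>i\<le>2. h = tau i u \<or> is_head M c i h)"
proof -
  obtain t0 H1 t2 H0 t1 H2 where l:
    "set ([t0] @ H1 @ [t2] @ H0 @ [t1] @ H2) = u"
    "successively (\<lambda>x y. y = rot M x) (([t0] @ H1 @ [t2] @ H0 @ [t1] @ H2) @ [t0])"
    "is_tail M c 0 t0" "is_tail M c 1 t1" "is_tail M c 2 t2"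
    "\<forall>h\<in>set H0. is_head M c 0 h" "\<forall>h\<in>set H1. is_head M c 1 h" "\<forall>h\<in>set H2. is_head M c 2 h"
    by (rule U_local[OF assms(1)])
  have t: "t0 = tau 0 u" "t1 = tau 1 u" "t2 = tau 2 u"
    using tau_unique(2)[OF assms(1)] l(1,3-5) by auto
  have hu: "h \<in> u" using vert_self assms(2) by auto
  have s1: "successively (\<lambda>x y. y = rot M x) ((t0 # H1) @ [t2])"
  proof -
    have "([t0] @ H1 @ [t2] @ H0 @ [t1] @ H2) @ [t0] = ((t0 # H1) @ [t2]) @ (H0 @ [t1] @ H2 @ [t0])" by simp
    then show ?thesis using l(2) by (simp only: successively_append_iff)
  qed
  have s0: "successively (\<lambda>x y. y = rot M x) ((t2 # H0) @ [t1])"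
  proof -
    have "([t0] @ H1 @ [t2] @ H0 @ [t1] @ H2) @ [t0] = (t0 # H1) @ (((t2 # H0) @ [t1]) @ (H2 @ [t0]))" by simp
    then show ?thesis using l(2) by (simp only: successively_append_iff)
  qed
  have s2: "successively (\<lambda>x y. y = rot M x) ((t1 # H2) @ [t0])"
  proof -
    have "([t0] @ H1 @ [t2] @ H0 @ [t1] @ H2) @ [t0] = (t0 # H1 @ [t2] @ H0) @ ((t1 # H2) @ [t0])" by simp
    then show ?thesis using l(2) by (simp only: successively_append_iff)
  qed
  have clash: "\<not> is_tail M c j h" if "is_head M c i h" "i \<le> 2" for i j
  proof
    assume a: "is_tail M c j h"
    then have "j = i" using tail_unique_color[OF tail_color[OF a] head_color[OF that(1)]] by simp
    then show False using not_tail_head[OF that(2)] a that(1) by simp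
  qed
  have where_head: "h \<in> set (if i = 0 then H0 else if i = 1 then H1 else H2)"
    if "is_head M c i h" "i \<le> 2" for i
  proof -
    have "h \<noteq> t0" "h \<noteq> t1" "h \<noteq> t2"
      using clash[OF that] l(3-5) by auto
    then have "h \<in> set H0 \<union> set H1 \<union> set H2" using hu l(1) by auto
    moreover have "j = i" if "is_head M c j h" for j
      using tail_unique_color[OF head_color[OF that] head_color[OF \<open>is_head M c i h\<close>]] by simp
    ultimately show ?thesis using l(6-8) that(2) by (auto simp: le_Suc_eq numeral_2_eq_2)
  qed
  show "rot M h = tau 2 u \<or> is_head M c 1 (rot M h)" if "h = tau 0 u \<or> is_head M c 1 h"
    using successively_next_mem[OF s1, of h] that where_head[of 1] t l(7) by auto
  show "rot M h = tau 1 u \<or> is_head M c 0 (rot M h)" if "h = tau 2 u \<or> is_head M c 0 h"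
    using successively_next_mem[OF s0, of h] that where_head[of 0] t l(6) by auto
  show "rot M h = tau 0 u \<or> is_head M c 2 (rot M h)" if "h = tau 1 u \<or> is_head M c 2 h"
    using successively_next_mem[OF s2, of h] that where_head[of 2] t l(8) by auto
  have "h \<in> {t0, t1, t2} \<union> set H0 \<union> set H1 \<union> set H2" using hu l(1) by auto
  then show "\<exists>i\<le>2. h = tau i u \<or> is_head M c i h"
  proof (elim UnE)
    assume "h \<in> {t0, t1, t2}"
    then have "h = tau 0 u \<or> h = tau 1 u \<or> h = tau 2 u" using t by auto
    then show ?thesis by (metis one_le_numeral order_refl zero_le)
  qed (use l(6-8) in \<open>metis one_le_numeral order_refl zero_le\<close>)+
qed

lemma dart_type:
  assumes "h \<in> darts M" "h \<notin> ext"
  shows "\<exists>i\<le>2. is_tail M c i h \<or> is_head M c i h"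
proof -
  obtain i where i: "i \<le> 2" "h \<in> color_darts M c i" using color_ex[OF assms] by auto
  have int: "\<exists>i\<le>2. is_tail M c i g \<or> is_head M c i g" if "vert M g \<in> U" for g
    using rot_cases(4)[OF that refl] tau_props(1)[OF that] by metis
  show ?thesis
  proof (cases "vert M h \<in> U")
    case True
    then show ?thesis by (rule int)
  next
    case False
    then have "vert M h = v i" using color_vert(1)[OF i] by simp
    then have "vert M (opp M h) \<in> U" using color_vert(2)[OF i] basic(7)[OF assms(1)] by auto
    from int[OF this] show ?thesis using head_opp tail_opp basic(6) assms(1) opp_in by metis
  qed
qed

text \<open>\<open>T\<^sub>j\<close> contains no external vertex but \<open>v j\<close>, and tails
  start at internal vertices, so only heads of color \<open>i\<close> remain.\<close>

lemma ext_vertex_type: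
  assumes "i \<le> 2" "h \<in> darts M" "h \<notin> ext" "vert M h = v i"
  shows "is_head M c i h"
proof -
  obtain j where j: "j \<le> 2" "is_tail M c j h \<or> is_head M c j h" using dart_type[OF assms(2,3)] by auto
  have vU: "v i \<notin> U" using U_notin assms(1) by (auto simp: le_Suc_eq numeral_2_eq_2)
  then have h: "is_head M c j h" using j tail_vert[OF j(1), of h] assms(4) by auto
  then have "v i = v j" using color_vert(1)[OF j(1) head_color[OF h]] assms(4) vU by simp
  then have "i = j"
    using v_distinct assms(1) j(1) by (auto simp: le_Suc_eq numeral_2_eq_2)
  then show ?thesis using h by simp
qed

end

section \<open>Reading the code off a realizer\<close>

context realizer_map
begin

text \<open>At \<open>v\<^sub>1\<close> the external edge to \<open>v\<^sub>2\<close> plays the role of the \<open>2\<close>-tail.\<close>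

definition tl2 :: "'h set \<Rightarrow> 'h" where
  "tl2 u = (if u = v 1 then e1 else tau 2 u)"

text \<open>One half-edge per letter: the values that \<open>turn\<close> will have in
  \<open>M\<close>. A \<open>1\<close>-tail serves for the letter S because it directly follows the
  last \<open>0\<close>-head of the vertex, or its \<open>2\<close>-tail if there is none. The root
  serves for the letter of \<open>v\<^sub>1\<close>.\<close>

definition walk_darts :: "'h set" where
  "walk_darts = insert (root M) ({h. is_head M c 0 h} \<union> {h. is_tail M c 1 h})"

text \<open>
  One step of the tour of \<open>T\<^sub>0\<close>: a \<open>0\<close>-head leads up to its child, a \<open>1\<close>-tail stands for leaving a
  vertex. The root dart closes the tour to a cycle.
\<close>

definition G :: "'h \<Rightarrow> 'h" where
  "G h = (if h = root M then rot M (rot M h)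
     else if is_head M c 0 h then rot M (tau 2 (vert M (opp M h)))
     else if is_tail M c 1 h then rot M (opp M (tau 0 (vert M h))) else h)"

lemma colored: "h \<in> color_darts M c i \<Longrightarrow> h \<in> darts M \<and> h \<notin> ext"
  by (simp add: color_iff)

lemma tail_in: "is_tail M c i h \<Longrightarrow> h \<in> darts M" "is_tail M c i h \<Longrightarrow> h \<notin> ext"
  and head_in: "is_head M c i h \<Longrightarrow> h \<in> darts M" "is_head M c i h \<Longrightarrow> h \<notin> ext"
  using colored tail_color head_color by blast+

lemma ext_mem: "root M \<in> ext" "e1 \<in> ext" "e2 \<in> ext" "opp M (root M) \<in> ext" "opp M e1 \<in> ext" "opp M e2 \<in> ext"
  by (simp_all add: ext_def)

lemma v0_cases:
  assumes "h \<in> darts M" "vert M h = v 0"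
  shows "h = root M \<or> h = opp M e2 \<or> is_head M c 0 h"
  using ext_vertex_type[of 0 h] ext_cases[of h] assms v_distinct by auto

lemma v1_cases:
  assumes "h \<in> darts M" "vert M h = v 1"
  shows "h = e1 \<or> h = opp M (root M) \<or> is_head M c 1 h"
proof (cases "h \<in> ext")
  case True
  then show ?thesis using ext_cases[OF True] assms(2) v_distinct by metis
next
  case False
  then show ?thesis using ext_vertex_type[of 1 h] assms by simp
qed

lemma finite_walk_darts: "finite walk_darts"
proof (rule finite_subset)
  show "walk_darts \<subseteq> darts M" using head_in tail_in basic(2) by (auto simp: walk_darts_def)
qed (rule basic(1))

lemma rot_at_v0:
  assumes "h \<in> darts M" "vert M h = v 0" "h \<noteq> root M"
  shows "rot M h = root M \<or> is_head M c 0 (rot M h)"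
proof -
  have "rot M h \<noteq> opp M e2" using assms(3) root_triangle(6) rot_eq_iff by metis
  then show ?thesis using v0_cases[OF rot_in[OF assms(1)]] vert_rot assms(2) by simp
qed

lemma rot_at_v1:
  assumes "h \<in> darts M" "vert M h = v 1" "h \<noteq> e1"
  shows "rot M h = e1 \<or> is_head M c 1 (rot M h)"
proof -
  have "rot M h \<noteq> opp M (root M)" using assms(3) root_triangle(4) rot_eq_iff by metis
  then show ?thesis using v1_cases[OF rot_in[OF assms(1)]] vert_rot assms(2) by simp
qed

lemma opp_tau:
  assumes "u \<in> U" "i \<le> 2"
  shows "is_head M c i (opp M (tau i u))" "opp M (tau i u) \<in> darts M" "opp M (tau i u) \<notin> ext"
    "vert M (opp M (tau i u)) \<in> insert (v i) U" "opp M (opp M (tau i u)) = tau i u"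
proof -
  note t = tau_props[OF assms]
  show h: "is_head M c i (opp M (tau i u))" using t tail_opp by simp
  show "opp M (tau i u) \<in> darts M" "opp M (tau i u) \<notin> ext" using head_in[OF h] by simp_all
  show "vert M (opp M (tau i u)) \<in> insert (v i) U" using color_vert(2)[OF assms(2) tail_color[OF t(1)]] .
  show "opp M (opp M (tau i u)) = tau i u" using basic(6) t by simp
qed

lemma rot_tau2: "u \<in> U \<Longrightarrow> rot M (tau 2 u) \<in> walk_darts"
  using rot_cases(2)[OF _ tau_props(2)[of u 2]] tau_props(1)[of u 1] by (auto simp: walk_darts_def)

lemma rot_head0:
  assumes "is_head M c 0 h"
  shows "rot M h \<in> walk_darts"
proof -
  have "vert M h \<in> insert (v 0) U" using color_vert(1)[of 0 h] head_color[OF assms] by simp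
  moreover have "h \<noteq> root M" using head_in(2)[OF assms] ext_mem by metis
  ultimately show ?thesis
    using rot_at_v0[OF head_in(1)[OF assms]] rot_cases(2)[of "vert M h" h] assms tau_props(1)[of "vert M h" 1]
    by (auto simp: walk_darts_def)
qed

lemma G_simps:
  "G (root M) = rot M (opp M e2)"
  "is_head M c 0 h \<Longrightarrow> G h = rot M (tau 2 (vert M (opp M h)))"
  "is_tail M c 1 h \<Longrightarrow> G h = rot M (opp M (tau 0 (vert M h)))"
proof -
  show "G (root M) = rot M (opp M e2)" by (simp add: G_def root_triangle(6))
  show "G h = rot M (tau 2 (vert M (opp M h)))" if "is_head M c 0 h"
  proof -
    have "h \<noteq> root M" using head_in(2)[OF that] ext_mem by metis
    then show ?thesis using that by (simp add: G_def)
  qed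
  show "G h = rot M (opp M (tau 0 (vert M h)))" if "is_tail M c 1 h"
  proof -
    have "h \<noteq> root M" using tail_in(2)[OF that] ext_mem by metis
    moreover have "\<not> is_head M c 0 h"
      using tail_unique_color[OF tail_color[OF that] head_color[of 0 h]] by auto
    ultimately show ?thesis using that by (simp add: G_def)
  qed
qed

lemma walk_cases:
  assumes "h \<in> walk_darts"
  obtains "h = root M" | "is_head M c 0 h" "vert M (opp M h) \<in> U" "opp M h = tau 0 (vert M (opp M h))"
    | "is_tail M c 1 h" "vert M h \<in> U" "h = tau 1 (vert M h)"
  using assms head_tau[of 0 h] tail_tau[of 1 h] tail_vert[of 1 h] by (auto simp: walk_darts_def)

lemma G_in: "h \<in> walk_darts \<Longrightarrow> G h \<in> walk_darts"
proof (erule walk_cases)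
  assume "h = root M"
  have "opp M e2 \<in> darts M" using opp_in root_triangle(2) by simp
  then show ?thesis using rot_at_v0[of "opp M e2"] v_eqs(6) ext_distinct(1) \<open>h = root M\<close>
    by (auto simp: G_simps(1) walk_darts_def)
next
  assume "is_head M c 0 h" "vert M (opp M h) \<in> U"
  then show ?thesis using rot_tau2 by (simp add: G_simps(2))
next
  assume "is_tail M c 1 h" "vert M h \<in> U"
  then show ?thesis using rot_head0[OF opp_tau(1)] by (simp add: G_simps(3))
qed

text \<open>\<open>G h\<close> comes right behind the external half-edge \<open>opp M e2\<close>, a
  \<open>2\<close>-tail or a \<open>0\<close>-head, according to the type of \<open>h\<close>. These
  cases are disjoint, and in each of them the half-edge determines \<open>h\<close>.\<close>

lemma G_inj: "inj_on G walk_darts"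
proof (rule inj_onI)
  fix h h' assume hh: "h \<in> walk_darts" "h' \<in> walk_darts" "G h = G h'"
  define pre where "pre h = (if h = root M then opp M e2 else if is_head M c 0 h
    then tau 2 (vert M (opp M h)) else opp M (tau 0 (vert M h)))" for h
  have pre: "G h = rot M (pre h) \<and> ((h = root M \<and> pre h = opp M e2) \<or>
      (is_head M c 0 h \<and> is_tail M c 2 (pre h) \<and> opp M h = tau 0 (vert M (pre h))) \<or>
      (is_tail M c 1 h \<and> is_head M c 0 (pre h) \<and> h = tau 1 (vert M (opp M (pre h)))))"
    if "h \<in> walk_darts" for h
    using that
  proof (cases rule: walk_cases)
    case 1
    then show ?thesis by (simp add: G_simps(1) pre_def)
  next
    case 2
    then have "h \<noteq> root M" using head_in(2) ext_mem by metis
    then have "pre h = tau 2 (vert M (opp M h))" using 2 by (simp add: pre_def)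
    then show ?thesis using 2 tau_props[OF 2(2), of 2] by (simp add: G_simps(2))
  next
    case 3
    then have "h \<noteq> root M" using tail_in(2) ext_mem by metis
    moreover have "\<not> is_head M c 0 h"
      using tail_unique_color[OF tail_color[OF 3(1)] head_color[of 0 h]] by auto
    ultimately have "pre h = opp M (tau 0 (vert M h))" by (simp add: pre_def)
    then show ?thesis using 3 opp_tau[OF 3(2), of 0] tau_props[OF 3(2), of 0] by (simp add: G_simps(3))
  qed
  have eq: "pre h = pre h'" using hh(3) pre[OF hh(1)] pre[OF hh(2)] rot_eq_iff by metis
  have no1: "\<not> is_tail M c 2 (opp M e2)" "\<not> is_head M c 0 (opp M e2)"
    using tail_in(2) head_in(2) ext_mem by metis+
  have no2: "\<not> (is_tail M c 2 x \<and> is_head M c 0 x)" for x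
    using tail_unique_color tail_color head_color by (metis zero_neq_numeral)
  from pre[OF hh(1)] pre[OF hh(2)] show "h = h'"
  proof (elim conjE disjE)
    assume "opp M h = tau 0 (vert M (pre h))" "opp M h' = tau 0 (vert M (pre h'))"
    then have "opp M h = opp M h'" using eq by simp
    then show ?thesis using permutes_inj[OF basic(4)] by (auto dest: injD)
  next
    assume "h = tau 1 (vert M (opp M (pre h)))" "h' = tau 1 (vert M (opp M (pre h')))"
    then show ?thesis using eq by simp
  qed (use eq no1 no2 in simp_all)
qed

lemma G_permutes: "G permutes walk_darts"
proof (rule bij_imp_permutes)
  have "finite walk_darts" by (rule finite_walk_darts)
  then show "bij_betw G walk_darts walk_darts"
    using G_inj G_in by (simp add: bij_betw_def endo_inj_surj image_subset_iff)
qed (auto simp: G_def walk_darts_def)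

text \<open>\<open>g\<close> starts at \<open>G (root M)\<close>, so \<open>m\<close> is one less
  than the length of the cycle, and \<open>g m\<close> is the root again.\<close>

definition m :: nat where
  "m = funpow_dist G (G (root M)) (root M)"

definition g :: "nat \<Rightarrow> 'h" where
  "g j = (G ^^ Suc j) (root M)"

lemma g_Suc: "g (Suc j) = G (g j)"
  by (simp add: g_def)

lemma g_0: "g 0 = rot M (opp M e2)"
  by (simp add: g_def G_simps(1))

lemma root_orbit: "root M \<in> orbit G (root M)"
proof -
  have "finite walk_darts" by (rule finite_walk_darts)
  then show ?thesis using G_permutes by (intro permutation_self_in_orbit) (auto simp: permutation_permutes)
qed

lemma g_m: "g m = root M"
  using funpow_dist1_prop[OF root_orbit] by (simp add: g_def m_def)

lemma g_in: "g j \<in> walk_darts"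
proof (induction j)
  case 0
  then show ?case using G_in[of "root M"] by (simp add: g_def walk_darts_def)
qed (simp add: g_Suc G_in)

lemma g_dart: "g j \<in> darts M"
  using g_in[of j] head_in tail_in basic(2) by (auto simp: walk_darts_def)

lemma g_inj: "i \<le> m \<Longrightarrow> j \<le> m \<Longrightarrow> g i = g j \<Longrightarrow> i = j"
proof -
  have inj: "inj_on (\<lambda>n. (G ^^ n) (root M)) {0..<Suc m}"
    using inj_on_funpow_dist1[OF root_orbit] by (simp add: m_def)
  define idx where "idx j = (if j = m then 0 else Suc j)" for j
  have idx: "g j = (G ^^ idx j) (root M) \<and> idx j \<in> {0..<Suc m}" if "j \<le> m" for j
    using that g_m by (auto simp: idx_def g_def)
  assume "i \<le> m" "j \<le> m" "g i = g j"
  then have "idx i = idx j" using idx inj by (metis inj_onD)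
  then show "i = j" by (auto simp: idx_def split: if_splits)
qed

text \<open>From \<open>m\<close> on the letters are N, the default of \<open>letters\<close>, so
  that both can be equal as functions.\<close>

definition wd :: "nat \<Rightarrow> letter" where
  "wd j = (if j < m \<and> \<not> is_head M c 0 (g j) then S else N)"

definition nu :: "nat \<Rightarrow> 'h set" where
  "nu k = (if k = 0 then v 0 else if k = 1 then v 2 else vert M (opp M (g (walk.tm wd k))))"

text \<open>The number of \<open>1\<close>-heads between the \<open>0\<close>-tail and the
  \<open>2\<close>-tail, or between the external edges at \<open>v\<^sub>1\<close>. The
  \<open>0\<close> outside the range is the default of \<open>pops\<close>.\<close>

definition bb :: "nat \<Rightarrow> nat" where
  "bb k = (if 2 \<le> k \<and> k \<le> walk.cnt wd m
     then LEAST i. (rot M ^^ Suc i) (opp M (g (walk.tm wd k))) = tl2 (nu k) else 0)"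

sublocale walk wd bb .

definition tld :: "nat \<Rightarrow> nat \<Rightarrow> 'h" where
  "tld i k = (if i = 0 then if k = 1 then e2 else opp M (g (tm k))
     else if i = 1 then tau 1 (nu k) else tl2 (nu k))"

primrec psi :: "dart \<Rightarrow> 'h" where
  "psi (Tl i k) = tld i k"
| "psi (Hd i k) = opp M (tld i k)"

section \<open>The run along a realizer\<close>

lemma wd_m: "wd m = N"
  by (simp add: wd_def)

lemma wd_S: "wd j = S \<Longrightarrow> is_tail M c 1 (g j) \<and> vert M (g j) \<in> U \<and> g j = tau 1 (vert M (g j))"
proof -
  assume "wd j = S"
  then have j: "j < m" "\<not> is_head M c 0 (g j)" by (auto simp: wd_def split: if_splits)
  then have "g j \<noteq> root M" using g_inj[of j m] g_m by auto
  then show ?thesis using walk_cases[OF g_in[of j]] j(2) by metis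
qed

lemma wd_N:
  assumes "j < m" "wd j = N"
  shows "is_head M c 0 (g j)" "vert M (opp M (g j)) \<in> U" "opp M (g j) = tau 0 (vert M (opp M (g j)))"
proof -
  show h: "is_head M c 0 (g j)" using assms by (simp add: wd_def split: if_splits)
  then show "vert M (opp M (g j)) \<in> U" "opp M (g j) = tau 0 (vert M (opp M (g j)))"
    using head_tau[of 0 "g j"] by simp_all
qed

lemma nu_ext: "nu 0 = v 0" "nu 1 = v 2"
  by (simp_all add: nu_def)

lemma cnt_neq: "cnt j \<noteq> 0" "cnt j \<noteq> Suc 0"
  using cnt_ge[of j] by auto

lemma nu_cnt: "wd j = N \<Longrightarrow> nu (cnt j) = vert M (opp M (g j))"
  by (simp add: nu_def tm_cnt cnt_neq)

lemma tld0_cnt: "wd j = N \<Longrightarrow> tld 0 (cnt j) = opp M (g j)"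
  by (simp add: tld_def tm_cnt cnt_neq)

lemma named:
  assumes "2 \<le> k" "k < cnt m"
  shows "nu k \<in> U" "tld 0 k = tau 0 (nu k)" "psi (Hd 0 k) = g (tm k)" "is_head M c 0 (g (tm k))"
    "wd (tm k) = N" "cnt (tm k) = k" "tm k < m"
proof -
  show t: "wd (tm k) = N" "cnt (tm k) = k" "tm k < m" using tm_props[OF assms] by auto
  note w = wd_N[OF t(3,1)]
  show "nu k \<in> U" "tld 0 k = tau 0 (nu k)" "is_head M c 0 (g (tm k))"
    using nu_cnt[OF t(1)] tld0_cnt[OF t(1)] t(2) w by simp_all
  have "psi (Hd 0 k) = opp M (opp M (g (tm k)))" using tld0_cnt[OF t(1)] t(2) by simp
  then show "psi (Hd 0 k) = g (tm k)" using basic(6) head_in(1)[OF w(1)] by simp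
qed

lemma named_eq_iff:
  assumes "2 \<le> k" "k < cnt m" "2 \<le> k'" "k' < cnt m" "nu k = nu k'"
  shows "k = k'"
proof -
  have "opp M (g (tm k)) = opp M (g (tm k'))"
    using named(2)[OF assms(1,2)] named(2)[OF assms(3,4)] assms by (simp add: tld_def)
  then have "g (tm k) = g (tm k')" using permutes_inj[OF basic(4)] by (auto dest: injD)
  then have "tm k = tm k'"
    using named(7)[OF assms(1,2)] named(7)[OF assms(3,4)] by (intro g_inj) simp_all
  then have "cnt (tm k) = cnt (tm k')" by (rule arg_cong)
  then show ?thesis unfolding named(6)[OF assms(1,2)] named(6)[OF assms(3,4)] .
qed

text \<open>From the \<open>0\<close>-tail, or from the root edge at \<open>v\<^sub>1\<close>, the
  rotation meets only \<open>1\<close>-heads until \<open>tl2\<close>. It reaches \<open>tl2\<close>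
  because both lie in one orbit.\<close>

lemma spokes_heads:
  assumes "j \<le> m" "wd j = N"
  shows "(rot M ^^ Suc (bb (cnt j))) (opp M (g j)) = tl2 (nu (cnt j))"
    "1 \<le> i \<Longrightarrow> i \<le> bb (cnt j) \<Longrightarrow> is_head M c 1 ((rot M ^^ i) (opp M (g j)))"
    "vert M ((rot M ^^ i) (opp M (g j))) = nu (cnt j)"
    "(rot M ^^ i) (opp M (g j)) \<in> darts M"
proof -
  let ?a = "opp M (g j)" and ?u = "nu (cnt j)"
  have u: "vert M ?a = ?u" by (simp add: nu_cnt[OF assms(2)])
  note gd = g_dart[of j]
  have vert: "vert M ((rot M ^^ i) ?a) = ?u" for i
    by (induction i) (auto simp: u vert_rot)
  have dart: "(rot M ^^ i) ?a \<in> darts M" for i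
    by (induction i) (auto simp: rot_in opp_in gd)
  show "vert M ((rot M ^^ i) ?a) = ?u" "(rot M ^^ i) ?a \<in> darts M" by (rule vert, rule dart)
  have "?a \<noteq> tl2 ?u \<and> tl2 ?u \<in> ?u \<and>
      (\<forall>h. vert M h = ?u \<longrightarrow> h \<in> darts M \<longrightarrow> h = ?a \<or> is_head M c 1 h \<longrightarrow> rot M h = tl2 ?u \<or> is_head M c 1 (rot M h))"
  proof (cases "j = m")
    case True
    then have a: "?a = opp M (root M)" "?u = v 1" using g_m u v_eqs(4) by simp_all
    have "?a \<noteq> e1" using ext_distinct(2) a by simp
    moreover have "e1 \<in> v 1" using vert_self[of e1] by (simp add: v_eqs(2)[unfolded One_nat_def])
    moreover have "is_head M c 1 h \<Longrightarrow> h \<noteq> e1" for h using head_in(2) ext_mem by metis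
    ultimately show ?thesis using rot_at_v1 a unfolding tl2_def by simp
  next
    case False
    then have w: "vert M ?a \<in> U" "?a = tau 0 (vert M ?a)" using wd_N[of j] assms by simp_all
    then have uU: "?u \<in> U" "?a = tau 0 ?u" using u by simp_all
    then have t: "tl2 ?u = tau 2 ?u" using U_notin(2) by (auto simp: tl2_def)
    have "tau 0 ?u \<noteq> tau 2 ?u"
      using tau_props(1)[OF uU(1), of 0] tau_props(1)[OF uU(1), of 2] tail_color tail_unique_color
      by (metis le_numeral_extra(3) order_refl zero_le zero_neq_numeral)
    then show ?thesis
      using t uU rot_cases(1)[OF uU(1)] tau_props(2)[OF uU(1), of 2] vert_self[of "tau 2 ?u"] by simp
  qed
  then have ne: "?a \<noteq> tl2 ?u" and mem: "tl2 ?u \<in> ?u" and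
    step: "\<And>h. vert M h = ?u \<Longrightarrow> h \<in> darts M \<Longrightarrow> h = ?a \<or> is_head M c 1 h \<Longrightarrow>
      rot M h = tl2 ?u \<or> is_head M c 1 (rot M h)" by auto
  have "tl2 ?u \<in> orbit (rot M) ?a" using mem u by (simp add: vert_def)
  then obtain q where "(rot M ^^ q) ?a = tl2 ?u" "0 < q" by (auto simp: orbit_altdef)
  then have ex: "\<exists>i. (rot M ^^ Suc i) ?a = tl2 ?u" by (metis Suc_pred)
  have bb: "bb (cnt j) = (LEAST i. (rot M ^^ Suc i) ?a = tl2 ?u)"
    using cnt_ge[of j] cnt_mono[OF assms(1)] tm_cnt[OF assms(2)] by (simp add: bb_def)
  show "(rot M ^^ Suc (bb (cnt j))) ?a = tl2 ?u" unfolding bb using ex by (rule LeastI_ex)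
  have not: "(rot M ^^ Suc i) ?a \<noteq> tl2 ?u" if "i < bb (cnt j)" for i
    using that unfolding bb by (rule not_less_Least)
  show "is_head M c 1 ((rot M ^^ i) ?a)" if "1 \<le> i" "i \<le> bb (cnt j)"
    using that
  proof (induction i rule: dec_induct)
    case base
    then show ?case using not[of 0] step[OF u _] dart[of 0] by auto
  next
    case (step i)
    then show ?case using not[of i] \<open>\<And>h. vert M h = ?u \<Longrightarrow> h \<in> darts M \<Longrightarrow> h = ?a \<or> is_head M c 1 h \<Longrightarrow>
      rot M h = tl2 ?u \<or> is_head M c 1 (rot M h)\<close>[OF vert dart, of i] by auto
  qed
qed

text \<open>The facts about \<open>M\<close> that the next letter needs: \<open>g j\<close> follows
  the path edge at the cursor, as in \<open>rot_junction\<close>; a vertex of \<open>sky\<close> has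
  its \<open>1\<close>-tail right behind its path edge; path edges end at the expected vertices. The
  last clause names the parents on the stack, to which a letter S returns.\<close>

definition run_inv :: "nat \<Rightarrow> bool" where
  "run_inv j \<longleftrightarrow> (\<forall>i<j. ok i) \<and>
     rot M (psi (frontier_dart (hd (stk j)) (hd (sky j)))) = g j \<and>
     vert M (g j) = nu (hd (stk j)) \<and>
     successively (\<lambda>x y. rot M (psi (frontier_dart x y)) = tld 1 x) (sky j) \<and>
     successively (\<lambda>x y. psi (frontier_dart x y) \<in> darts M \<and>
       vert M (opp M (psi (frontier_dart x y))) = nu y) (front j) \<and>
     successively (\<lambda>x y. vert M (g (tm x)) = nu y) (stk j)"

lemma sky_mem:
  assumes "\<forall>i<j. ok i" "x \<in> set (sky j)" "j \<le> m" "x \<noteq> 1"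
  shows "2 \<le> x" "x < cnt j" "nu x \<in> U"
proof -
  note inv = run_invariant[OF assms(1)]
  have "0 \<in> set (stk j)" using inv last_in_set by metis
  then have "x \<noteq> 0" using inv assms(2) by auto
  then show x: "2 \<le> x" using assms(4) by simp
  show "x < cnt j" using inv assms(2) by auto
  then show "nu x \<in> U" using named(1)[of x] x cnt_mono[OF assms(3)] by simp
qed

text \<open>In the triangle at spoke \<open>i\<close> the base is known, so the third side starts
  where the base ends. If spoke \<open>Suc i\<close> is a \<open>1\<close>-head, this side is a
  \<open>1\<close>-tail and starts at an internal vertex. This is not \<open>v\<^sub>2\<close>, so
  the path goes on and offers a base for the next triangle.\<close>

lemma fan_run:
  assumes "j \<le> m" "wd j = N" "run_inv j" "i \<le> bb (cnt j)"
  shows "Suc i < length (front j) \<and> psi (spoke j i) = (rot M ^^ i) (opp M (g j)) \<and>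
    face_next M (psi (spoke j i)) = psi (frontier_dart (front j ! i) (front j ! Suc i))"
  using assms(4)
proof (induction i)
  case 0
  have ne: "sky j \<noteq> []" using run_invariant[of j] assms(3) by (simp add: run_inv_def)
  note gd = g_dart[of j]
  have s: "psi (spoke j 0) = opp M (g j)" by (simp add: spoke_def tld0_cnt[OF assms(2)])
  have "rot M (psi (frontier_dart (hd (stk j)) (hd (sky j)))) = opp M (opp M (g j))"
    using assms(3) basic(6)[OF gd] by (simp add: run_inv_def)
  then have "face_next M (opp M (g j)) = psi (frontier_dart (hd (stk j)) (hd (sky j)))"
    by (rule face_nextI)
  then show ?case using ne s by (simp add: front_def hd_conv_nth)
next
  case (Suc i)
  let ?s = "\<lambda>i. (rot M ^^ i) (opp M (g j))"
  let ?x = "front j ! Suc i"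
  note sp = spokes_heads[OF assms(1,2)]
  have IH: "Suc i < length (front j)" "psi (spoke j i) = ?s i"
    "face_next M (?s i) = psi (frontier_dart (front j ! i) ?x)"
    using Suc by auto
  let ?D = "psi (frontier_dart (front j ! i) ?x)"
  define z where "z = opp M (?s (Suc i))"
  have oks: "\<forall>i<j. ok i" using assms(3) by (simp add: run_inv_def)
  have D: "?D \<in> darts M" "vert M (opp M ?D) = nu ?x"
    using assms(3) IH(1) by (auto simp: run_inv_def successively_conv_nth)
  have sd: "?s (Suc i) \<in> darts M" "?s i \<in> darts M" using sp(4) by blast+
  have hd: "is_head M c 1 (?s (Suc i))" using sp(2)[of "Suc i"] Suc.prems by simp
  then have zt: "is_tail M c 1 z" using head_opp z_def by simp
  have oz: "opp M z = ?s (Suc i)" using basic(6)[OF sd(1)] z_def by simp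
  have "face_next M z = ?s i" using oz by (intro face_nextI) simp
  then have "face_next M ?D = z" using face3[OF opp_in[OF sd(1)]] IH(3) z_def by simp
  then have zv: "vert M z = nu ?x" using vert_face[of ?D] D(2) by simp
  have xs: "?x = sky j ! i" "i < length (sky j)" using IH(1) by (simp_all add: front_def)
  then have mem: "?x \<in> set (sky j)" by simp
  have "nu ?x \<in> U" using tail_vert[of 1 z] zt zv by simp
  then have x1: "?x \<noteq> 1" using U_notin(3) by (auto simp: nu_def)
  have "i \<noteq> length (sky j) - 1"
    using run_invariant[OF oks] x1 xs by (metis last_conv_nth)
  then have len: "Suc i < length (sky j)" using xs(2) by simp
  have ztau: "z = tld 1 ?x" using tail_tau[of 1 z] zt zv by (simp add: tld_def)
  have spk: "psi (spoke j (Suc i)) = ?s (Suc i)"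
    using Suc.prems oz ztau by (simp add: spoke_def)
  have "rot M (psi (frontier_dart (sky j ! i) (sky j ! Suc i))) = tld 1 (sky j ! i)"
    using assms(3) len by (simp add: run_inv_def successively_conv_nth)
  then have "rot M (psi (frontier_dart ?x (front j ! Suc (Suc i)))) = opp M (?s (Suc i))"
    using ztau xs(1) z_def by (simp add: front_def)
  then have "face_next M (?s (Suc i)) = psi (frontier_dart ?x (front j ! Suc (Suc i)))"
    by (rule face_nextI)
  then show ?case using spk len by (simp add: front_def)
qed

text \<open>The same walk around the last triangle of the fan, whose second spoke is
  \<open>tl2\<close>, identifies the \<open>2\<close>-parent.\<close>

lemma fan_end:
  assumes "j \<le> m" "wd j = N" "run_inv j"
  shows "bb (cnt j) < length (sky j)" "psi (spoke j (Suc (bb (cnt j)))) = tl2 (nu (cnt j))"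
    "vert M (opp M (tl2 (nu (cnt j)))) = nu (sky j ! bb (cnt j))"
    "tl2 (nu (cnt j)) \<in> darts M" "vert M (tl2 (nu (cnt j))) = nu (cnt j)"
proof -
  let ?b = "bb (cnt j)" and ?s = "\<lambda>i. (rot M ^^ i) (opp M (g j))"
  note sp = spokes_heads[OF assms(1,2)] and fr = fan_run[OF assms order_refl]
  show len: "?b < length (sky j)" using fr by (simp add: front_def)
  show "psi (spoke j (Suc ?b)) = tl2 (nu (cnt j))" by (simp add: spoke_def tld_def)
  show d: "tl2 (nu (cnt j)) \<in> darts M" using sp(1) sp(4)[of "Suc ?b"] by simp
  show "vert M (tl2 (nu (cnt j))) = nu (cnt j)" using sp(1) sp(3)[of "Suc ?b"] by simp
  let ?D = "psi (frontier_dart (front j ! ?b) (front j ! Suc ?b))"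
  define z where "z = opp M (tl2 (nu (cnt j)))"
  have "opp M z = rot M (?s ?b)" using basic(6)[OF d] sp(1) z_def by simp
  then have "face_next M z = ?s ?b" by (intro face_nextI) simp
  moreover have "face_next M (?s ?b) = ?D" using fr by metis
  ultimately have "face_next M ?D = z" using face3[OF opp_in[OF d]] z_def by simp
  moreover have "vert M (opp M ?D) = nu (front j ! Suc ?b)"
    using assms(3) fr by (auto simp: run_inv_def successively_conv_nth)
  ultimately show "vert M (opp M (tl2 (nu (cnt j)))) = nu (sky j ! ?b)"
    using vert_face[of ?D] z_def by (simp add: front_def)
qed

lemma successively_drop: "successively P xs \<Longrightarrow> successively P (drop q xs)"
  by (metis append_take_drop_id successively_append_iff)

lemma run_inv_step:
  assumes "j < m" "run_inv j"
  shows "run_inv (Suc j)"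
proof -
  have oks: "\<forall>i<j. ok i" using assms(2) by (simp add: run_inv_def)
  note run = run_invariant[OF oks]
  have I: "rot M (psi (frontier_dart (hd (stk j)) (hd (sky j)))) = g j" "vert M (g j) = nu (hd (stk j))"
    "successively (\<lambda>x y. rot M (psi (frontier_dart x y)) = tld 1 x) (sky j)"
    "successively (\<lambda>x y. psi (frontier_dart x y) \<in> darts M \<and>
       vert M (opp M (psi (frontier_dart x y))) = nu y) (front j)"
    "successively (\<lambda>x y. vert M (g (tm x)) = nu y) (stk j)"
    using assms(2) by (auto simp: run_inv_def)
  obtain a A where A: "stk j = a # A" using run by (cases "stk j") auto
  note gd = g_dart[of j]
  show ?thesis
  proof (cases "wd j = N")
    case True
    let ?k = "cnt j"
    let ?y = "sky j ! bb ?k"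
    have j: "j \<le> m" using assms(1) by simp
    note fe = fan_end[OF j True assms(2)] and w = wd_N[OF assms(1) True]
    have ok: "ok j" using fe(1) True by (simp add: ok_def)
    have kU: "nu ?k \<in> U" using w(2) nu_cnt[OF True] by simp
    then have t2: "tl2 (nu ?k) = tau 2 (nu ?k)" using U_notin(2) by (auto simp: tl2_def)
    have g': "g (Suc j) = rot M (tl2 (nu ?k))"
      using G_simps(2)[OF w(1)] nu_cnt[OF True] t2 by (simp add: g_Suc)
    have "?y \<in> set (sky j)" using fe(1) by simp
    then have y: "?y < ?k" using run by auto
    have fd: "psi (frontier_dart ?k ?y) = tl2 (nu ?k)" using y by (simp add: frontier_dart_def tld_def)
    have sky: "sky (Suc j) = ?y # drop (Suc (bb ?k)) (sky j)" "sky (Suc j) = drop (bb ?k) (sky j)"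
      using fe(1) True by (simp_all add: Cons_nth_drop_Suc)
    have stk: "stk (Suc j) = ?k # stk j" using True by simp
    have tailE: "successively (\<lambda>x y. psi (frontier_dart x y) \<in> darts M \<and>
       vert M (opp M (psi (frontier_dart x y))) = nu y) (sky (Suc j))"
    proof -
      have "sky (Suc j) = drop (Suc (bb ?k)) (front j)" unfolding sky(2) by (simp add: front_def)
      then show ?thesis using successively_drop[OF I(4)] by simp
    qed
    show ?thesis
      unfolding run_inv_def
    proof (intro conjI)
      show "\<forall>i<Suc j. ok i" using oks ok less_Suc_eq by auto
      show "rot M (psi (frontier_dart (hd (stk (Suc j))) (hd (sky (Suc j))))) = g (Suc j)"
        unfolding stk sky(1) g' by (simp add: fd)
      show "vert M (g (Suc j)) = nu (hd (stk (Suc j)))" using True by (simp add: g' vert_rot fe(5))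
      show "successively (\<lambda>x y. rot M (psi (frontier_dart x y)) = tld 1 x) (sky (Suc j))"
        unfolding sky(2) by (rule successively_drop[OF I(3)])
      show "successively (\<lambda>x y. psi (frontier_dart x y) \<in> darts M \<and>
          vert M (opp M (psi (frontier_dart x y))) = nu y) (front (Suc j))"
      proof -
        have "front (Suc j) = ?k # sky (Suc j)" using True by (simp add: front_def)
        then show ?thesis using tailE fe(3,4) fd unfolding sky(1) by simp
      qed
      show "successively (\<lambda>x y. vert M (g (tm x)) = nu y) (stk (Suc j))"
        unfolding stk using I(2,5) A tm_cnt[OF True] by simp
    qed
  next
    case False
    then have wS: "wd j = S" using letter_cases by metis
    note t = wd_S[OF wS, THEN conjunct1] wd_S[OF wS, THEN conjunct2, THEN conjunct1]
      wd_S[OF wS, THEN conjunct2, THEN conjunct2]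
    \<comment> \<open>A \<open>1\<close>-tail sits at an internal vertex, so the cursor is not at
      \<open>v\<^sub>0\<close> and the stack can shrink.\<close>
    have aU: "nu a \<in> U" using t(2) I(2) A by simp
    then have "a \<noteq> 0" "a \<noteq> 1" using U_notin(1,3) nu_ext by metis+
    then have a2: "2 \<le> a" by simp
    obtain a' A' where A': "A = a' # A'" using run A \<open>a \<noteq> 0\<close> by (cases A) auto
    have ok: "ok j" using A A' False by (simp add: ok_def)
    have ac: "a < cnt m" using run A cnt_mono[of j m] assms(1) by auto
    note nm = named[OF a2 ac]
    have a'a: "a' < a" using run A A' by simp
    have "tau 0 (nu a) = opp M (g (tm a))" using nm(2) a2 by (simp add: tld_def)
    then have oa: "opp M (tau 0 (nu a)) = g (tm a)" using basic(6) head_in(1)[OF nm(4)] by simp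
    have g': "g (Suc j) = rot M (g (tm a))"
      using G_simps(3)[OF t(1)] I(2) A oa by (simp add: g_Suc)
    have fd: "psi (frontier_dart a' a) = g (tm a)" using a'a nm(3) by (simp add: frontier_dart_def)
    have stk: "stk (Suc j) = a' # A'" and sky: "sky (Suc j) = a # sky j" using False A A' by simp_all
    have ne: "sky j \<noteq> []" using run by simp
    have va: "vert M (g (tm a)) = nu a'" using I(5) A A' by simp
    show ?thesis
      unfolding run_inv_def
    proof (intro conjI)
      show "\<forall>i<Suc j. ok i" using oks ok less_Suc_eq by auto
      show "rot M (psi (frontier_dart (hd (stk (Suc j))) (hd (sky (Suc j))))) = g (Suc j)"
        unfolding stk sky g' by (simp add: fd)
      show "vert M (g (Suc j)) = nu (hd (stk (Suc j)))" using A A' False by (simp add: g' vert_rot va)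
      show "successively (\<lambda>x y. rot M (psi (frontier_dart x y)) = tld 1 x) (sky (Suc j))"
      proof -
        have "rot M (psi (frontier_dart a (hd (sky j)))) = tld 1 a"
          using I(1,2) A t(3) by (simp add: tld_def)
        then show ?thesis unfolding sky using I(3) ne by (cases "sky j") auto
      qed
      show "successively (\<lambda>x y. psi (frontier_dart x y) \<in> darts M \<and>
          vert M (opp M (psi (frontier_dart x y))) = nu y) (front (Suc j))"
      proof -
        have f: "front (Suc j) = a' # front j" using A A' False by (simp add: front_def)
        have "vert M (opp M (g (tm a))) = nu a" using nu_cnt[OF nm(5)] nm(6) by simp
        then show ?thesis unfolding f using I(4) fd head_in(1)[OF nm(4)] A by (simp add: front_def)
      qed
      show "successively (\<lambda>x y. vert M (g (tm x)) = nu y) (stk (Suc j))"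
        unfolding stk using I(5) A A' by simp
    qed
  qed
qed

lemma run_inv_all: "j \<le> m \<Longrightarrow> run_inv j"
proof (induction j)
  case 0
  have "vert M (rot M (opp M e2)) = v 0" using v_eqs(6) by (simp add: vert_rot)
  moreover have "opp M (opp M e2) = e2" "opp M e2 \<in> darts M" using basic(6) root_triangle(2) opp_in by auto
  ultimately show ?case
    using v_eqs(3) by (simp add: run_inv_def frontier_dart_def tld_def g_0 nu_def front_def)
next
  case (Suc j)
  then show ?case by (intro run_inv_step) simp_all
qed

text \<open>The tour ends with the root half-edge, hence at \<open>v\<^sub>0\<close>, whose only
  number on the stack is \<open>0\<close>. The last spoke is the external edge from
  \<open>v\<^sub>1\<close> to \<open>v\<^sub>2\<close>, so it ends at the last entry of
  \<open>sky\<close>.\<close>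

lemma end_state: "stk m = [0]" "Suc (bb (cnt m)) = length (sky m)"
proof -
  have im: "run_inv m" by (rule run_inv_all) simp
  then have oks: "\<forall>i<m. ok i" by (simp add: run_inv_def)
  note run = run_invariant[OF oks]
  obtain a A where A: "stk m = a # A" using run by (cases "stk m") auto
  have "nu a = v 0" using im g_m A v_eqs(1) by (simp add: run_inv_def)
  then have "a \<noteq> 1" "\<not> 2 \<le> a"
    using nu_ext v_distinct(3) named(1)[of a] U_notin(1) run A by auto
  then have "a = 0" by simp
  then have "A = []" using run A by (cases A) auto
  with A \<open>a = 0\<close> show "stk m = [0]" by simp
  note fe = fan_end[OF order_refl wd_m im]
  let ?y = "sky m ! bb (cnt m)"
  have "nu (cnt m) = v 1" using nu_cnt[OF wd_m] g_m v_eqs(4) by simp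
  then have "nu ?y = v 2" using fe(3) v_eqs(5) by (simp add: tl2_def)
  moreover have "?y \<in> set (sky m)" using fe(1) by simp
  ultimately have "?y = 1" using sky_mem(3)[OF oks, of ?y] U_notin(3) by auto
  then have "sky m ! bb (cnt m) = sky m ! (length (sky m) - 1)" using run last_conv_nth[of "sky m"] by metis
  then have "bb (cnt m) = length (sky m) - 1"
    using run fe(1) by (subst (asm) nth_eq_iff_index_eq) auto
  then show "Suc (bb (cnt m)) = length (sky m)" using fe(1) by simp
qed

text \<open>The number of internal vertices that the tour meets. It equals \<open>n\<close> by
  \<open>q_eq\<close>, whose proof already uses the code of length \<open>2 * q\<close>.\<close>

definition q :: nat where "q = cnt m - 2"

lemma m_eq: "m = 2 * q" and cnt_m: "cnt m = q + 2"
proof -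
  have oks: "\<forall>i<m. ok i" using run_inv_all[of m] by (simp add: run_inv_def)
  have *: "card {i. i < m \<and> wd i = S} = card {i. i < m \<and> wd i = N}"
    "cnt m = 2 + card {i. i < m \<and> wd i = N}"
    using length_balance[OF oks] end_state(1) by simp_all
  have "card ({i. i < m \<and> wd i = S} \<union> {i. i < m \<and> wd i = N}) =
      card {i. i < m \<and> wd i = S} + card {i. i < m \<and> wd i = N}"
    by (rule card_Un_disjoint) auto
  moreover have "{i. i < m \<and> wd i = S} \<union> {i. i < m \<and> wd i = N} = {..<m}"
    using letter_cases by blast
  ultimately have "card {..<m} = card {i. i < m \<and> wd i = S} + card {i. i < m \<and> wd i = N}" by simp
  then show "m = 2 * q" "cnt m = q + 2" using * by (simp_all add: q_def)
qed

sublocale R: coding wd bb q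
proof
  fix j assume "j \<le> 2 * q"
  then have j: "j \<le> m" by (simp add: m_eq)
  show "ok j"
  proof (cases "j = m")
    case True
    then show ?thesis using end_state(2) wd_m by (simp add: ok_def)
  next
    case False
    then show ?thesis using run_inv_all[of "Suc j"] j by (simp add: run_inv_def)
  qed
qed (use cnt_m end_state wd_m in \<open>simp_all flip: m_eq\<close>)

text \<open>\<open>x\<close> is left by some letter S, and the next turn is the half-edge behind the
  \<open>0\<close>-head of the edge of \<open>x\<close>. So the tour meets the
  \<open>0\<close>-heads of a vertex without gaps.\<close>

lemma rot_root_chain:
  assumes "2 \<le> x" "x < cnt m"
  shows "\<exists>j\<le>m. rot M (g (tm x)) = g j"
proof -
  obtain j where j: "j < m" "wd j = S" "hd (stk j) = x"
    using R.closed_at[of x] assms cnt_m m_eq by auto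
  have "vert M (g j) = nu x" using run_inv_all[of j] j by (simp add: run_inv_def)
  then have "g (Suc j) = rot M (opp M (tau 0 (nu x)))"
    using G_simps(3)[of "g j"] wd_S[OF j(2)] by (metis g_Suc)
  also have "opp M (tau 0 (nu x)) = g (tm x)"
    using named(2,3)[OF assms] by simp
  finally show ?thesis using j(1) by (intro exI[of _ "Suc j"]) auto
qed

lemma head_in_run:
  assumes "j \<le> m" "is_head M c 0 (g j)"
  shows "\<exists>x. 2 \<le> x \<and> x < cnt m \<and> g j = g (tm x)"
proof -
  have "j \<noteq> m" using assms(2) g_m head_in(2) ext_mem by metis
  moreover have N: "wd j = N" using assms(2) by (simp add: wd_def)
  ultimately show ?thesis
    using tm_cnt[OF N] cnt_ge[of j] cnt_strict[of j m] assms(1) by (intro exI[of _ "cnt j"]) simp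
qed

lemma heads_at_v0:
  assumes "is_head M c 0 h" "vert M h = v 0"
  shows "\<exists>j\<le>m. h = g j"
proof -
  have chain: "(rot M ^^ i) (root M) = opp M e2 \<or> (\<exists>j\<le>m. (rot M ^^ i) (root M) = g j)" for i
  proof (induction i)
    case 0
    then show ?case using g_m by auto
  next
    case (Suc i)
    let ?h = "(rot M ^^ i) (root M)"
    have v: "vert M ?h = v 0" by (induction i) (auto simp: vert_rot v_eqs)
    have hd: "?h \<in> darts M" by (induction i) (auto simp: rot_in basic)
    show ?case
    proof (cases "?h = root M \<or> ?h = opp M e2")
      case True
      then show ?thesis using root_triangle(6) g_0 by auto
    next
      case False
      then have "is_head M c 0 ?h" using v0_cases[OF hd v] by blast
      moreover obtain j where "j \<le> m" "?h = g j" using Suc.IH False by blast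
      ultimately obtain x where "2 \<le> x" "x < cnt m" "?h = g (tm x)" using head_in_run by metis
      then show ?thesis using rot_root_chain[of x] by auto
    qed
  qed
  have "h \<in> vert M (root M)" using vert_self[of h] assms(2) v_eqs(1) by simp
  then obtain i where "h = (rot M ^^ i) (root M)" by (auto simp: vert_def orbit_altdef)
  then show ?thesis using chain[of i] head_in(2)[OF assms(1)] ext_mem(6) by auto
qed

lemma heads_at_named:
  assumes "2 \<le> k" "k < cnt m" "is_head M c 0 h" "vert M h = nu k"
  shows "\<exists>j\<le>m. h = g j"
proof -
  let ?u = "nu k" and ?t = "tau 2 (nu k)"
  note nm = named[OF assms(1,2)]
  have tv: "vert M ?t = ?u" by (rule tau_props(2)[OF nm(1)]) simp
  have v: "vert M ((rot M ^^ i) ?t) = ?u" for i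
    by (induction i) (auto simp: vert_rot tv)
  have no: "\<not> is_head M c 0 x" if "is_head M c i x \<or> is_tail M c i x" "i \<noteq> 0" for x i
    using that tail_unique_color[of x i 0] head_color tail_color by blast
  have no0: "\<not> is_head M c 0 (tau i ?u)" if "i \<le> 2" for i
    using not_tail_head[of 0] no[of i "tau i ?u"] tau_props(1)[OF nm(1) that] by (cases "i = 0") auto
  have chain: "is_head M c 0 ((rot M ^^ i) ?t) \<Longrightarrow> \<exists>j\<le>m. (rot M ^^ i) ?t = g j" for i
  proof (induction i)
    case 0
    then show ?case using no0[of 2] by simp
  next
    case (Suc i)
    let ?h = "(rot M ^^ i) ?t"
    have hd: "is_head M c 0 (rot M ?h)" using Suc.prems by simp
    note rc = rot_cases[OF nm(1) v[of i]]
    obtain l where l: "l \<le> 2" "?h = tau l ?u \<or> is_head M c l ?h" using rc(4) by auto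
    have "rot M ?h \<noteq> tau 0 ?u" "rot M ?h \<noteq> tau 2 ?u" using no0[of 0] no0[of 2] hd by auto
    moreover have "\<not> is_head M c 1 (rot M ?h)" "\<not> is_head M c 2 (rot M ?h)"
      using no[of 1 "rot M ?h"] no[of 2 "rot M ?h"] hd by auto
    ultimately have "\<not> (?h = tau 0 ?u \<or> is_head M c 1 ?h)" "\<not> (?h = tau 1 ?u \<or> is_head M c 2 ?h)"
      using rc(1,3) by blast+
    then consider "?h = ?t" | "is_head M c 0 ?h" using l by (auto simp: le_Suc_eq numeral_2_eq_2)
    then show ?case
    proof cases
      case 1
      have "g (Suc (tm k)) = rot M (tau 2 (vert M (opp M (g (tm k)))))"
        using G_simps(2)[OF nm(4)] by (simp add: g_Suc)
      also have "vert M (opp M (g (tm k))) = ?u" using nu_cnt[OF nm(5)] nm(6) by simp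
      finally show ?thesis using 1 nm(7) by (intro exI[of _ "Suc (tm k)"]) simp
    next
      case 2
      then obtain j where "j \<le> m" "?h = g j" using Suc.IH by auto
      then obtain x where "2 \<le> x" "x < cnt m" "?h = g (tm x)" using head_in_run 2 by metis
      then show ?thesis using rot_root_chain[of x] by auto
    qed
  qed
  have "h \<in> vert M ?t" using vert_self[of h] assms(4) tv by simp
  then obtain i where "h = (rot M ^^ i) ?t" by (auto simp: vert_def orbit_altdef)
  then show ?thesis using chain assms(3) by metis
qed

text \<open>Induction along the path in \<open>T\<^sub>0\<close> to \<open>v\<^sub>0\<close>. At a
  vertex that the tour meets, it meets all \<open>0\<close>-heads by \<open>heads_at_v0\<close> and
  \<open>heads_at_named\<close>, and each of them takes it to the child.\<close>

lemma all_named: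
  assumes "u \<in> U"
  shows "\<exists>k. 2 \<le> k \<and> k < cnt m \<and> nu k = u"
proof -
  have "\<exists>k. 2 \<le> k \<and> k < cnt m \<and> nu k = u"
    if "is_path (color_graph M c 0) (u # p)" "last (u # p) = v 0" "u \<in> U" for p u
    using that
  proof (induction p arbitrary: u)
    case Nil
    then show ?case using U_notin by simp
  next
    case (Cons u' p)
    then have "(u, u') \<in> color_graph M c 0" by (simp add: is_path_def)
    then obtain h where h: "h \<in> color_darts M c 0" "vert M h = u" "vert M (opp M h) = u'"
      by (auto simp: adjacency_def)
    then have t: "is_tail M c 0 h" using Cons.prems(1,2) unfolding is_tail_def by blast
    have hd: "h \<in> darts M" using tail_in[OF t] by simp
    have oh: "is_head M c 0 (opp M h)" using t tail_opp by simp
    have "u' \<in> insert (v 0) U" using color_vert(2)[of 0 h] h by simp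
    then have "\<exists>j\<le>m. opp M h = g j"
    proof
      assume "u' = v 0"
      then show ?thesis using heads_at_v0[OF oh] h(3) by simp
    next
      assume "u' \<in> U"
      moreover have "is_path (color_graph M c 0) (u' # p)" "last (u' # p) = v 0"
        using Cons.prems(1,2) by (simp_all add: is_path_def)
      ultimately obtain k where "2 \<le> k" "k < cnt m" "nu k = u'" using Cons.IH by blast
      then show ?thesis using heads_at_named[OF _ _ oh] h(3) by simp
    qed
    then obtain j where j: "j \<le> m" "opp M h = g j" by auto
    then obtain x where x: "2 \<le> x" "x < cnt m" "g j = g (tm x)" using head_in_run oh by metis
    have "nu x = vert M (opp M (g (tm x)))" using nu_cnt[OF named(5)[OF x(1,2)]] named(6)[OF x(1,2)] by simp
    also have "\<dots> = u" using x(3) j(2) basic(6)[OF hd] h(2) by metis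
    finally show ?case using x by blast
  qed
  moreover obtain p where "is_path (color_graph M c 0) (u # p)" "last (u # p) = v 0"
    using tau_props(1,2)[OF assms, of 0] unfolding is_tail_def by auto
  ultimately show ?thesis using assms by blast
qed

lemma q_eq: "q = n"
proof -
  have "U = nu ` {2..<cnt m}"
  proof (intro equalityI subsetI)
    fix u assume "u \<in> U"
    then obtain k where "2 \<le> k" "k < cnt m" "nu k = u" using all_named by blast
    then show "u \<in> nu ` {2..<cnt m}" by auto
  qed (use named(1) in auto)
  moreover have "inj_on nu {2..<cnt m}" using named_eq_iff by (auto simp: inj_on_def)
  ultimately have "card U = cnt m - 2" by (simp add: card_image)
  then show ?thesis using size by (simp add: size_tri_def q_def)
qed

lemma cnt_m_n: "cnt m = n + 2" and m_n: "m = 2 * n"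
  using cnt_m m_eq q_eq by simp_all

lemma tm_end: "tm (n + 2) = m"
  using tm_cnt[OF wd_m] cnt_m_n by simp

lemma psi_ext: "tld 0 1 = e2" "tld 0 (n + 2) = opp M (root M)" "tld 2 (n + 2) = e1" "nu (n + 2) = v 1"
proof -
  show "tld 0 1 = e2" by (simp add: tld_def)
  show "tld 0 (n + 2) = opp M (root M)" using tm_end g_m by (simp add: tld_def)
  show nu: "nu (n + 2) = v 1" using nu_cnt[OF wd_m] cnt_m_n g_m v_eqs(4) by simp
  have "tld 2 (n + 2) = tl2 (nu (n + 2))" by (simp add: tld_def)
  also have "\<dots> = e1" unfolding nu by (simp add: tl2_def)
  finally show "tld 2 (n + 2) = e1" .
qed

section \<open>The labelling of the half-edges\<close>

lemma tld_internal:
  assumes "2 \<le> k" "k \<le> n + 1" "i \<le> 2"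
  shows "tld i k = tau i (nu k)" "nu k \<in> U" "is_tail M c i (tld i k)" "is_head M c i (opp M (tld i k))"
    "vert M (tld i k) = nu k" "opp M (opp M (tld i k)) = tld i k"
proof -
  note nm = named[of k]
  have k: "k < cnt m" using assms cnt_m_n by simp
  show U: "nu k \<in> U" using nm(1) assms k by simp
  have t2: "tl2 (nu k) = tau 2 (nu k)" using U U_notin(2) by (auto simp: tl2_def)
  have "i = 0 \<or> i = 1 \<or> i = 2" using assms(3) by auto
  then show t: "tld i k = tau i (nu k)"
    using nm(2)[OF assms(1) k] t2 by (auto simp: tld_def)
  show "is_tail M c i (tld i k)" "is_head M c i (opp M (tld i k))" "vert M (tld i k) = nu k"
    "opp M (opp M (tld i k)) = tld i k"
    unfolding t using tau_props[OF U assms(3)] opp_tau[OF U assms(3)] by simp_all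
qed

lemma valid_iff: "R.valid i k \<longleftrightarrow> i = 0 \<and> 1 \<le> k \<and> k \<le> n + 2 \<or> i = 1 \<and> 2 \<le> k \<and> k \<le> n + 1
     \<or> i = 2 \<and> 2 \<le> k \<and> k \<le> n + 2"
  unfolding R.valid_def unfolding q_eq ..

lemma valid_cases:
  assumes "R.valid i k"
  shows "i \<le> 2 \<and> 2 \<le> k \<and> k \<le> n + 1 \<or> i = 0 \<and> k = 1 \<or> i = 0 \<and> k = n + 2 \<or> i = 2 \<and> k = n + 2"
  using assms unfolding valid_iff by linarith

lemma tld_dart:
  assumes "R.valid i k"
  shows "tld i k \<in> darts M"
  using valid_cases[OF assms]
proof (elim disjE conjE)
  assume a: "i \<le> 2" "2 \<le> k" "k \<le> n + 1"
  show ?thesis using tail_in(1)[OF tld_internal(3)[OF a(2,3,1)]] .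
qed (use psi_ext root_triangle opp_in basic(2) in simp_all)

lemma psi_dart: "d \<in> R.code_darts \<Longrightarrow> psi d \<in> darts M"
  by (cases d) (auto simp: R.code_darts_def tld_dart opp_in)

lemma psi_flip: "d \<in> R.code_darts \<Longrightarrow> psi (flip d) = opp M (psi d)"
  by (cases d) (auto simp: R.code_darts_def tld_dart basic(6))

lemma psi_onto: "darts M \<subseteq> psi ` R.code_darts"
proof
  fix h assume h: "h \<in> darts M"
  have imgI: "tld i k \<in> psi ` R.code_darts" "opp M (tld i k) \<in> psi ` R.code_darts" if "R.valid i k" for i k
  proof -
    have "Tl i k \<in> R.code_darts" "Hd i k \<in> R.code_darts" using that by (simp_all add: R.code_darts_def)
    then show "tld i k \<in> psi ` R.code_darts" "opp M (tld i k) \<in> psi ` R.code_darts"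
      using image_eqI[of _ psi] psi.simps by metis+
  qed
  have vl: "R.valid 0 1" "R.valid 0 (n + 2)" "R.valid 2 (n + 2)" by (auto simp: valid_iff)
  have int: "\<exists>k. R.valid i k \<and> x = tld i k" if x: "is_tail M c i x" "i \<le> 2" for x i
  proof -
    have "vert M x \<in> U" using tail_vert x by simp
    then obtain k where k: "2 \<le> k" "k < cnt m" "nu k = vert M x" using all_named by blast
    then have k': "k \<le> n + 1" using cnt_m_n by simp
    have "x = tld i k" unfolding tld_internal(1)[OF k(1) k' x(2)] k(3) by (rule tail_tau[OF x(2,1)])
    moreover have "R.valid i k" using k k' x(2) by (auto simp: valid_iff le_Suc_eq numeral_2_eq_2)
    ultimately show ?thesis by blast
  qed
  show "h \<in> psi ` R.code_darts"
  proof (cases "h \<in> ext")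
    case True
    then have "h \<in> {tld 0 1, opp M (tld 0 1), tld 0 (n + 2), opp M (tld 0 (n + 2)), tld 2 (n + 2), opp M (tld 2 (n + 2))}"
      unfolding psi_ext ext_def basic(6)[OF basic(2)] by blast
    then show ?thesis using imgI vl by blast
  next
    case False
    then obtain i where i: "i \<le> 2" "is_tail M c i h \<or> is_head M c i h" using dart_type h by blast
    show ?thesis
    proof (cases "is_tail M c i h")
      case True
      then show ?thesis using int[OF True i(1)] imgI by blast
    next
      case False
      then have "is_tail M c i (opp M h)" using i head_opp by simp
      then obtain k where "R.valid i k" "opp M h = tld i k" using int i(1) by blast
      then show ?thesis using imgI(2) basic(6)[OF h] by metis
    qed
  qed
qed

text \<open>There are \<open>3 * n\<close> tails, their opposite heads and six external half-edges.
  With \<open>psi_onto\<close> this bound makes \<open>psi\<close> injective by counting.\<close>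

lemma card_darts_ge: "6 * n + 6 \<le> card (darts M)"
proof -
  let ?I = "{0, 1, 2} \<times> {2..n + 1}"
  let ?Z = "case_prod tld ` ?I"
  have Z: "is_tail M c i (tld i k) \<and> vert M (tld i k) = nu k" if "(i, k) \<in> ?I" for i k
    using tld_internal(3,5)[of k i] that by auto
  have "inj_on (case_prod tld) ?I"
  proof (rule inj_onI)
    fix x y assume xy: "x \<in> ?I" "y \<in> ?I" "case_prod tld x = case_prod tld y"
    obtain i k i' k' where p: "x = (i, k)" "y = (i', k')" by (meson surj_pair)
    then have a: "(i, k) \<in> ?I" "(i', k') \<in> ?I" "tld i k = tld i' k'" using xy by simp_all
    have "i = i'" using tail_unique_color tail_color Z[OF a(1)] Z[OF a(2)] a(3) by metis
    moreover have "nu k = nu k'" using Z[OF a(1)] Z[OF a(2)] a(3) by metis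
    then have "k = k'" using named_eq_iff[of k k'] a(1,2) cnt_m_n by simp
    ultimately show "x = y" using p by simp
  qed
  then have cZ: "card ?Z = 3 * n" by (simp add: card_image card_cartesian_product)
  have fin: "finite ?Z" by simp
  have cO: "card (opp M ` ?Z) = 3 * n"
    using cZ permutes_inj[OF basic(4)] by (metis card_image inj_on_subset subset_UNIV)
  have tl: "\<exists>i\<le>2. is_tail M c i x" if xZ: "x \<in> ?Z" for x
  proof -
    obtain y where y: "x = case_prod tld y" "y \<in> ?I" using xZ by (rule imageE)
    obtain i k where "y = (i, k)" by (rule prod.exhaust)
    with y have ik: "(i, k) \<in> ?I" "x = tld i k" by simp_all
    then have "i \<le> 2" by auto
    then show ?thesis using Z[OF ik(1)] ik(2) by blast
  qed
  have disj: "?Z \<inter> opp M ` ?Z = {}"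
  proof (rule ccontr)
    assume "?Z \<inter> opp M ` ?Z \<noteq> {}"
    then obtain x y where xy: "x \<in> ?Z" "y \<in> ?Z" "x = opp M y" by blast
    obtain i where i: "i \<le> 2" "is_tail M c i x" using tl[OF xy(1)] by (elim exE conjE)
    obtain j where j: "j \<le> 2" "is_tail M c j y" using tl[OF xy(2)] by (elim exE conjE)
    note ij = i j
    have h: "is_head M c j x" using xy(3) tail_opp[of j y] ij(4) by simp
    have "i = j" using tail_unique_color[OF tail_color[OF ij(2)] head_color[OF h]] .
    then show False using not_tail_head[OF ij(1,2)] h by simp
  qed
  have ext6: "card ext = 6"
  proof -
    have o: "opp M x = opp M y \<longleftrightarrow> x = y" for x y using permutes_inj[OF basic(4)] by (auto dest: injD)
    have "distinct [root M, e1, e2, opp M (root M), opp M e1, opp M e2]"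
      using v_eqs v_distinct ext_distinct basic(5)[OF basic(2)] basic(5)[OF root_triangle(1)]
        basic(5)[OF root_triangle(2)] by (simp add: o) metis
    then have "card (set [root M, e1, e2, opp M (root M), opp M e1, opp M e2]) = 6"
      by (subst distinct_card) simp_all
    then show ?thesis by (simp add: ext_def)
  qed
  have dE: "(?Z \<union> opp M ` ?Z) \<inter> ext = {}"
  proof -
    have "x \<notin> ext" if "x \<in> ?Z" for x using tl[OF that] tail_in(2) by blast
    moreover have "opp M x \<notin> ext" if "x \<in> ?Z" for x using tl[OF that] tail_opp head_in(2) by blast
    ultimately show ?thesis by blast
  qed
  have "card ((?Z \<union> opp M ` ?Z) \<union> ext) = card (?Z \<union> opp M ` ?Z) + card ext"
    by (rule card_Un_disjoint) (use fin dE in \<open>auto simp: ext_def\<close>)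
  also have "card (?Z \<union> opp M ` ?Z) = card ?Z + card (opp M ` ?Z)"
    by (rule card_Un_disjoint) (use fin disj in auto)
  finally have "card ((?Z \<union> opp M ` ?Z) \<union> ext) = 6 * n + 6" using cZ cO ext6 by simp
  moreover have "(?Z \<union> opp M ` ?Z) \<union> ext \<subseteq> darts M"
  proof -
    have "x \<in> darts M" if "x \<in> ?Z" for x using tl[OF that] tail_in(1) by blast
    then show ?thesis using opp_in basic(2) root_triangle(1,2) by (auto simp: ext_def)
  qed
  ultimately show ?thesis using basic(1) card_mono by metis
qed

lemma psi_bij: "bij_betw psi R.code_darts (darts M)"
proof -
  have "psi ` R.code_darts = darts M" using psi_onto psi_dart by blast
  moreover from this have "inj_on psi R.code_darts"
    using R.finite_code_darts R.card_code_darts q_eq card_darts_ge card_image_le[OF R.finite_code_darts, of psi]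
    by (intro eq_card_imp_inj_on) simp_all
  ultimately show ?thesis by (simp add: bij_betw_def)
qed

lemma fan_steps:
  assumes "(j, i) \<in> R.fan"
  shows "rot M (psi (spoke j i)) = psi (spoke j (Suc i))"
    "face_next M (psi (spoke j i)) = psi (frontier_dart (front j ! i) (front j ! Suc i))"
proof -
  have j: "j \<le> m" "wd j = N" "i \<le> bb (cnt j)" using R.fanD[OF assms] m_eq by auto
  note fr = fan_run[OF j(1,2) run_inv_all[OF j(1)]]
  show "face_next M (psi (spoke j i)) = psi (frontier_dart (front j ! i) (front j ! Suc i))"
    using fr[OF j(3)] by blast
  have s: "psi (spoke j i) = (rot M ^^ i) (opp M (g j))" using fr[OF j(3)] by blast
  show "rot M (psi (spoke j i)) = psi (spoke j (Suc i))"
  proof (cases "i = bb (cnt j)")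
    case True
    then show ?thesis
      using spokes_heads(1)[OF j(1,2)] fan_end(2)[OF j(1,2) run_inv_all[OF j(1)]] s by simp
  next
    case False
    then show ?thesis using fr[of "Suc i"] s j(3) by simp
  qed
qed

text \<open>The rotation along the spokes and the base of each triangle are known from
  \<open>fan_steps\<close>. Since faces have degree 3, these give the other two corners.\<close>

lemma psi_rot:
  assumes "d \<in> R.code_darts"
  shows "rot M (psi d) = psi (R.rot_dart d)"
  using assms
proof (cases rule: R.dart_cases)
  case (spoke j i)
  then show ?thesis using fan_steps(1)[OF spoke(1)] R.rot_spoke[OF spoke(1)] by simp
next
  case (frontier j i)
  have sp: "local.spoke j i \<in> R.code_darts"
    using assms R.rot_in[OF assms] R.rot_frontier[OF frontier(1)] frontier(2) R.code_darts_flip by metis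
  have "rot M (psi d) = opp M (psi (local.spoke j i))"
    using rot_face fan_steps(2)[OF frontier(1)] frontier(2) by metis
  then show ?thesis
    using R.rot_frontier[OF frontier(1)] frontier(2) psi_flip[OF sp] by simp
next
  case (flip_spoke j i)
  let ?a = "psi (local.spoke j i)" and ?a' = "psi (local.spoke j (Suc i))"
  let ?fd = "frontier_dart (front j ! i) (front j ! Suc i)"
  have sp: "local.spoke j (Suc i) \<in> R.code_darts" using assms flip_spoke(2) R.code_darts_flip by metis
  have fd: "?fd \<in> R.code_darts"
    using R.rot_in[OF assms] R.rot_flip_spoke[OF flip_spoke(1)] flip_spoke(2) R.code_darts_flip by metis
  have d: "psi d = opp M ?a'" using psi_flip[OF sp] flip_spoke(2) by simp
  have "rot M ?a = opp M (opp M ?a')"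
    using fan_steps(1)[OF flip_spoke(1)] basic(6)[OF psi_dart[OF sp]] by simp
  then have "face_next M (opp M ?a') = ?a" by (rule face_nextI)
  then have "face_next M (psi ?fd) = opp M ?a'"
    using fan_steps(2)[OF flip_spoke(1)] face3[OF opp_in[OF psi_dart[OF sp]]] by simp
  then have "rot M (opp M ?a') = opp M (psi ?fd)" using rot_face by metis
  then show ?thesis
    using d R.rot_flip_spoke[OF flip_spoke(1)] flip_spoke(2) psi_flip[OF fd] by simp
next
  case root
  have r: "psi (Hd 0 (n + 2)) = root M" "psi (Tl 2 (n + 2)) = e1" "psi (Tl 0 1) = e2"
    "psi (Hd 0 1) = opp M e2" "psi (Tl 0 (n + 2)) = opp M (root M)" "psi (Hd 2 (n + 2)) = opp M e1"
    using psi_ext basic(6)[OF basic(2)] by (simp_all del: One_nat_def add_2_eq_Suc')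
  show ?thesis
    using root R.rot_root root_triangle(4-6) r unfolding q_eq by metis
qed

lemma psi_root: "psi (Hd 0 (n + 2)) = root M"
  using psi_ext(2) basic(6)[OF basic(2)] by (simp del: add_2_eq_Suc')

lemma psi_color:
  assumes "i \<le> 2" "2 \<le> k" "k \<le> n + 1"
  shows "c {psi (Tl i k), psi (Hd i k)} = i"
  using tail_color[OF tld_internal(3)[OF assms(2,3,1)]] by (simp add: color_iff edge_def)

end

section \<open>Words and codes\<close>

lemma ns_word_simps [simp]:
  "ns_word [] = []" "ns_word (a # as) = N # replicate a S @ ns_word as"
  "ns_word (as @ bs) = ns_word as @ ns_word bs"
  by (simp_all add: ns_word_def)

lemma count_replicate_letter [simp]: "count_list (replicate a x) y = (if x = y then a else 0)"
  by (induction a) auto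

lemma count_ns_word [simp]:
  "count_list (ns_word as) N = length as" "count_list (ns_word as) S = sum_list as"
  by (induction as) auto

lemma length_letters: "length xs = count_list xs N + count_list xs S"
proof (induction xs)
  case (Cons x xs)
  then show ?case by (cases x) auto
qed simp

lemma replicate_S_N_eq:
  assumes "replicate a S @ xs = replicate b S @ ys" "xs = [] \<or> hd xs = N" "ys = [] \<or> hd ys = N"
  shows "a = b \<and> xs = ys"
  using assms(1)
proof (induction a arbitrary: b)
  case 0
  then show ?case using assms(2) by (cases b) auto
next
  case (Suc a)
  then show ?case using assms(3) by (cases b) auto
qed

lemma hd_ns_word: "ns_word as = [] \<or> hd (ns_word as) = N"
  by (cases as) auto

lemma ns_word_inj: "ns_word as = ns_word bs \<longleftrightarrow> as = bs"
proof
  show "ns_word as = ns_word bs \<Longrightarrow> as = bs"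
  proof (induction as arbitrary: bs)
    case Nil
    then show ?case by (cases bs) auto
  next
    case (Cons a as)
    then obtain b bs' where "bs = b # bs'" by (cases bs) auto
    then show ?case
      using Cons replicate_S_N_eq[of a "ns_word as" b "ns_word bs'"] hd_ns_word by auto
  qed
qed simp

lemma exponents_ns_word: "exponents (ns_word as) = as"
  unfolding exponents_def ns_word_inj by simp

lemma ex_ns_word: "xs = [] \<or> hd xs = N \<Longrightarrow> \<exists>as. xs = ns_word as"
proof (induction xs rule: rev_induct)
  case Nil
  show ?case by (rule exI[of _ "[]"]) simp
next
  case (snoc x xs)
  then have "xs = [] \<or> hd xs = N" by (cases xs) auto
  then obtain as where as: "xs = ns_word as" using snoc.IH by auto
  show ?case
  proof (cases x)
    case N
    then show ?thesis using as by (intro exI[of _ "as @ [0]"]) simp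
  next
    case S
    then have "as \<noteq> []" using snoc.prems as by auto
    then obtain as' a where "as = as' @ [a]" by (metis rev_exhaust)
    then show ?thesis using as S by (intro exI[of _ "as' @ [Suc a]"]) (simp add: replicate_append_same)
  qed
qed

text \<open>All blocks of a prefix are complete except perhaps the last, and that one is complete if
  the next letter is N. The appended N makes the end of the word such a place.\<close>

lemma ns_word_prefix:
  assumes "k \<le> length (ns_word as)"
  defines "cN \<equiv> count_list (take k (ns_word as)) N" and "cS \<equiv> count_list (take k (ns_word as)) S"
  shows "cN \<le> length as \<and> cS \<le> sum_list (take cN as) \<and>
    ((ns_word as @ [N]) ! k = N \<longrightarrow> cS = sum_list (take cN as))"
  using assms(1) unfolding cN_def cS_def
proof (induction as arbitrary: k)
  case Nil
  then show ?case by simp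
next
  case (Cons a as)
  show ?case
  proof (cases k)
    case 0
    then show ?thesis by simp
  next
    case (Suc k')
    show ?thesis
    proof (cases "k' < a")
      case True
      then have "(ns_word (a # as) @ [N]) ! k = S" using Suc by (simp add: nth_append)
      then show ?thesis using True Suc by simp
    next
      case False
      then obtain k'' where k'': "k' = a + k''" using le_Suc_ex not_less by blast
      have le: "k'' \<le> length (ns_word as)" using Cons.prems Suc k'' by simp
      have "(ns_word (a # as) @ [N]) ! k = (ns_word as @ [N]) ! k''"
        using Suc k'' by (simp add: nth_append)
      then show ?thesis using Cons.IH[OF le] Suc k'' by simp
    qed
  qed
qed

text \<open>Within a block the height falls after its N, so the prefix condition has to be tested at
  the ends of blocks only.\<close>

lemma dyck_ns_word:
  "dyck_path n (ns_word as) \<longleftrightarrow>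
    length as = n \<and> sum_list as = n \<and> (\<forall>i\<le>n. sum_list (take i as) \<le> i)"
proof
  assume d: "dyck_path n (ns_word as)"
  then have n: "length as = n" "sum_list as = n" by (simp_all add: dyck_path_def)
  have "sum_list (take i as) \<le> i" if "i \<le> n" for i
  proof -
    let ?k = "length (ns_word (take i as))"
    have e: "ns_word as = ns_word (take i as) @ ns_word (drop i as)"
      by (metis append_take_drop_id ns_word_simps(3))
    then have "take ?k (ns_word as) = ns_word (take i as)" "?k \<le> length (ns_word as)" by simp_all
    then show ?thesis using d n(1) that unfolding dyck_path_def by fastforce
  qed
  with n show "length as = n \<and> sum_list as = n \<and> (\<forall>i\<le>n. sum_list (take i as) \<le> i)" by simp
next
  assume a: "length as = n \<and> sum_list as = n \<and> (\<forall>i\<le>n. sum_list (take i as) \<le> i)"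
  then have "count_list (take k (ns_word as)) S \<le> count_list (take k (ns_word as)) N"
    if "k \<le> length (ns_word as)" for k
    using ns_word_prefix[OF that] by (meson le_trans)
  then show "dyck_path n (ns_word as)" using a by (simp add: dyck_path_def)
qed

lemma stays_below_ns_word:
  "stays_below n (ns_word as) (ns_word bs) \<longleftrightarrow>
    (\<forall>i\<le>n. sum_list (take i bs) \<le> sum_list (take i as))"
  by (simp add: stays_below_def height_def exponents_ns_word)

definition interval_code :: "nat \<Rightarrow> nat list \<Rightarrow> nat list \<Rightarrow> bool" where
  "interval_code n as bs \<longleftrightarrow> length as = n \<and> sum_list as = n \<and> length bs = n \<and> sum_list bs = n \<and>
     (\<forall>i\<le>n. sum_list (take i bs) \<le> sum_list (take i as) \<and> sum_list (take i as) \<le> i)"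

lemma interval_pairs:
  assumes "1 \<le> n"
  shows "{(P, Q). dyck_path n P \<and> dyck_path n Q \<and> stays_below n P Q} =
    {(ns_word as, ns_word bs) | as bs. interval_code n as bs}"
proof -
  have ex: "\<exists>as. P = ns_word as" if "dyck_path n P" for P
  proof (rule ex_ns_word)
    have "P \<noteq> []" using that assms by (auto simp: dyck_path_def)
    then obtain x xs where P: "P = x # xs" by (cases P) auto
    have "count_list (take 1 P) S \<le> count_list (take 1 P) N"
      using that P unfolding dyck_path_def by (metis One_nat_def Suc_le_mono le0 length_Cons)
    then show "P = [] \<or> hd P = N" using P by (cases x) auto
  qed
  show ?thesis
  proof (intro equalityI subsetI)
    fix x assume "x \<in> {(P, Q). dyck_path n P \<and> dyck_path n Q \<and> stays_below n P Q}"
    then obtain P Q where x: "x = (P, Q)" "dyck_path n P" "dyck_path n Q" "stays_below n P Q" by auto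
    obtain as bs where "P = ns_word as" "Q = ns_word bs" using ex x by metis
    then show "x \<in> {(ns_word as, ns_word bs) | as bs. interval_code n as bs}"
      using x unfolding interval_code_def by (auto simp: dyck_ns_word stays_below_ns_word)
  next
    fix x assume "x \<in> {(ns_word as, ns_word bs) | as bs. interval_code n as bs}"
    then obtain as bs where x: "x = (ns_word as, ns_word bs)" "interval_code n as bs" by auto
    have "sum_list (take i bs) \<le> i" if "i \<le> n" for i
      using x(2) that unfolding interval_code_def by (meson le_trans)
    then show "x \<in> {(P, Q). dyck_path n P \<and> dyck_path n Q \<and> stays_below n P Q}"
      using x unfolding interval_code_def by (simp add: dyck_ns_word stays_below_ns_word)
  qed
qed

text \<open>The letter \<open>N\<close> after the end of the word attaches \<open>v\<^sub>1\<close>.\<close>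

definition letters :: "nat list \<Rightarrow> nat \<Rightarrow> letter" where
  "letters as j = (if j < length (ns_word as) then ns_word as ! j else N)"

text \<open>The list \<open>bs\<close> starts with the vertex \<open>3\<close>, since \<open>u\<^sub>0\<close>, numbered \<open>2\<close>, has no \<open>1\<close>-heads.\<close>

definition pops :: "nat list \<Rightarrow> nat \<Rightarrow> nat" where
  "pops bs k = (if 3 \<le> k \<and> k < length bs + 3 then bs ! (k - 3) else 0)"

section \<open>From pairs of words to codes and back\<close>

lemma count_list_prefix: "k \<le> l \<Longrightarrow> count_list (take k (map f [0..<l])) x = card {i. i < k \<and> f i = x}"
proof (induction k)
  case (Suc k)
  have "{i. i < Suc k \<and> f i = x} = (if f k = x then insert k {i. i < k \<and> f i = x} else {i. i < k \<and> f i = x})"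
    by (auto simp: less_Suc_eq)
  then show ?case using Suc by (simp add: take_Suc_conv_app_nth)
qed simp

lemma sum_pops: "i \<le> length bs \<Longrightarrow> (\<Sum>k=2..<i + 3. pops bs k) = sum_list (take i bs)"
proof (induction i)
  case 0
  then show ?case by (simp add: pops_def numeral_3_eq_3 numeral_2_eq_2)
next
  case (Suc i)
  have "(\<Sum>k=2..<Suc i + 3. pops bs k) = (\<Sum>k=2..<i + 3. pops bs k) + pops bs (i + 3)"
    using sum.atLeastLessThan_Suc[of 2 "i + 3" "pops bs"] by simp
  then show ?case using Suc by (simp add: pops_def take_Suc_conv_app_nth)
qed

context walk
begin

lemma sum_cnt: "(\<Sum>i<j. if w i = N then b (cnt i) else 0) = (\<Sum>k=2..<cnt j. b k)"
proof (induction j)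
  case (Suc j)
  then show ?case using cnt_ge[of j] by simp
qed simp

end

text \<open>At a letter N the earlier letters S form complete blocks, so \<open>ok\<close> is the
  comparison of the two words. At a letter S it is the prefix condition of the first word.\<close>

theorem code_of_interval:
  assumes "interval_code n as bs"
  shows "coding (letters as) (pops bs) n"
proof -
  let ?P = "ns_word as"
  have ic: "length as = n" "sum_list as = n" "length bs = n" "sum_list bs = n"
    "\<And>i. i \<le> n \<Longrightarrow> sum_list (take i bs) \<le> sum_list (take i as)" "\<And>i. i \<le> n \<Longrightarrow> sum_list (take i as) \<le> i"
    using assms by (auto simp: interval_code_def)
  have len: "length ?P = 2 * n" using length_letters[of ?P] ic by simp
  have letter: "letters as j = (?P @ [N]) ! j" if "j \<le> 2 * n" for j
    using that len by (auto simp: letters_def nth_append)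
  interpret walk "letters as" "pops bs" .
  have P: "?P = map (letters as) [0..<2 * n]"
    by (rule nth_equalityI) (auto simp: len letters_def)
  define cN where "cN j = card {i. i < j \<and> letters as i = N}" for j
  define cS where "cS j = card {i. i < j \<and> letters as i = S}" for j
  have pre: "cN j \<le> n" "cS j \<le> sum_list (take (cN j) as)"
    "letters as j = N \<Longrightarrow> cS j = sum_list (take (cN j) as)" if "j \<le> 2 * n" for j
  proof -
    have "count_list (take j ?P) N = cN j" "count_list (take j ?P) S = cS j"
      unfolding P cN_def cS_def by (rule count_list_prefix[OF that])+
    then show "cN j \<le> n" "cS j \<le> sum_list (take (cN j) as)"
      "letters as j = N \<Longrightarrow> cS j = sum_list (take (cN j) as)"
      using ns_word_prefix[of j as] that len ic(1) letter[OF that] by auto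
  qed
  have tot: "cN (2 * n) = n" "cS (2 * n) = n"
  proof -
    have "count_list (take (2 * n) ?P) x = card {i. i < 2 * n \<and> letters as i = x}" for x
      unfolding P by (rule count_list_prefix) simp
    from this[of N] this[of S] show "cN (2 * n) = n" "cS (2 * n) = n"
      using ic by (simp_all add: len cN_def cS_def)
  qed
  have bal: "length (stk j) + cS j = 1 + cN j" "cnt j = 2 + cN j"
    "length (sky j) + (\<Sum>k=2..<cnt j. pops bs k) = 1 + cS j" if "\<forall>i<j. ok i" for j
    using length_balance[OF that] unfolding cN_def cS_def sum_cnt by blast+
  have ok: "ok j" if "j \<le> 2 * n" for j
    using that
  proof (induction j rule: less_induct)
    case (less j)
    then have "\<forall>i<j. ok i" by simp
    note bj = bal[OF this]
    show ?case
    proof (cases "letters as j = N")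
      case True
      have "(\<Sum>k=2..<cN j + 3. pops bs k) \<le> cS j"
        using sum_pops[of "cN j" bs] ic(3,5) pre[OF less.prems] True by simp
      moreover have "(\<Sum>k=2..<cN j + 3. pops bs k) = (\<Sum>k=2..<cnt j. pops bs k) + pops bs (cnt j)"
        using bj(2) by (simp add: numeral_3_eq_3)
      ultimately show ?thesis using True bj by (simp add: ok_def)
    next
      case False
      then have S: "letters as j = S" using letter_cases by metis
      have jl: "j < 2 * n"
        using False less.prems by (cases "j = 2 * n") (auto simp: letters_def len)
      then have "cS (Suc j) \<le> cN (Suc j)"
        using pre[of "Suc j"] ic(6) by (meson Suc_leI le_trans)
      moreover have "cS (Suc j) = Suc (cS j)" "cN (Suc j) = cN j"
      proof -
        have "{i. i < Suc j \<and> letters as i = S} = insert j {i. i < j \<and> letters as i = S}"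
          "{i. i < Suc j \<and> letters as i = N} = {i. i < j \<and> letters as i = N}"
          using S by (auto simp: less_Suc_eq)
        then show "cS (Suc j) = Suc (cS j)" "cN (Suc j) = cN j" by (simp_all add: cS_def cN_def)
      qed
      ultimately show ?thesis using S bj by (simp add: ok_def)
    qed
  qed
  then have oks: "\<forall>i<2 * n. ok i" by simp
  note be = bal[OF oks]
  show ?thesis
  proof unfold_locales
    show "ok j" if "j \<le> 2 * n" for j by (rule ok[OF that])
    show c: "cnt (2 * n) = n + 2" using be tot by simp
    have "length (stk (2 * n)) = 1" using be tot by simp
    then show "stk (2 * n) = [0]"
      using run_invariant[OF oks] by (cases "stk (2 * n)") auto
    show "letters as (2 * n) = N" by (simp add: letters_def len)
    have "(\<Sum>k=2..<n + 3. pops bs k) = n" using sum_pops[of n bs] ic by simp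
    moreover have "(\<Sum>k=2..<n + 3. pops bs k) = (\<Sum>k=2..<n + 2. pops bs k) + pops bs (n + 2)"
      by (simp add: numeral_3_eq_3)
    ultimately show "Suc (pops bs (n + 2)) = length (sky (2 * n))"
      using be tot c by simp
  qed
qed

context coding
begin

text \<open>At the first letter \<open>sky\<close> consists of \<open>v\<^sub>2\<close>
  alone.\<close>

lemma b_2: "b 2 = 0"
  using tm(3)[of 2] b_lt[of 0] ok[of 0] by (simp add: ok_def split: if_splits)

theorem interval_of_code:
  assumes "1 \<le> n"
  obtains as where "map w [0..<2 * n] = ns_word as" "interval_code n as (map b [3..<n + 3])"
proof -
  let ?P = "map w [0..<2 * n]"
  define bs where "bs = map b [3..<n + 3]"
  define cN where "cN j = card {i. i < j \<and> w i = N}" for j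
  define cS where "cS j = card {i. i < j \<and> w i = S}" for j
  have bal: "length (stk j) + cS j = 1 + cN j" "cnt j = 2 + cN j"
    "length (sky j) + (\<Sum>k=2..<cnt j. b k) = 1 + cS j" if "j \<le> 2 * n" for j
  proof -
    have "\<forall>i<j. ok i" using that ok by simp
    from length_balance[OF this] show "length (stk j) + cS j = 1 + cN j" "cnt j = 2 + cN j"
      "length (sky j) + (\<Sum>k=2..<cnt j. b k) = 1 + cS j"
      unfolding cN_def cS_def sum_cnt by blast+
  qed
  have cp: "count_list (take j ?P) N = cN j" "count_list (take j ?P) S = cS j" if "j \<le> 2 * n" for j
    unfolding cN_def cS_def by (rule count_list_prefix[OF that])+
  have tot: "cN (2 * n) = n" "cS (2 * n) = n" using bal[of "2 * n"] cnt_end stk_end by simp_all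
  have dyck: "dyck_path n ?P"
    unfolding dyck_path_def
  proof (intro conjI allI impI)
    show "count_list ?P N = n" "count_list ?P S = n" using cp[of "2 * n"] tot by simp_all
    fix k assume "k \<le> length ?P"
    then have k: "k \<le> 2 * n" by simp
    have "1 \<le> length (stk k)" using run(1)[OF k] by (cases "stk k") auto
    then show "count_list (take k ?P) S \<le> count_list (take k ?P) N"
      using bal(1)[OF k] cp[OF k] by simp
  qed
  have "w 0 = N" using ok[of 0] by (auto simp: ok_def split: if_splits)
  then have "hd ?P = N" using assms by (simp add: hd_map)
  then obtain as where as: "?P = ns_word as" using ex_ns_word by blast
  have da: "length as = n" "sum_list as = n" "\<And>i. i \<le> n \<Longrightarrow> sum_list (take i as) \<le> i"
    using dyck unfolding as dyck_ns_word by auto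
  have sums: "(\<Sum>k=2..<i + 3. b k) = sum_list (take i bs)" if "i \<le> n" for i
    using that
  proof (induction i)
    case 0
    then show ?case using b_2 by (simp add: numeral_3_eq_3 numeral_2_eq_2)
  next
    case (Suc i)
    have "take (Suc i) bs = take i bs @ [b (i + 3)]"
      using Suc.prems by (simp add: bs_def take_Suc_conv_app_nth add.commute)
    then show ?case using Suc sum.atLeastLessThan_Suc[of 2 "i + 3" b] by simp
  qed
  have split: "(\<Sum>k=2..<i + 3. b k) = (\<Sum>k=2..<i + 2. b k) + b (i + 2)" for i
    by (simp add: numeral_3_eq_3)
  have "sum_list (take i bs) \<le> sum_list (take i as)" if i: "i \<le> n" for i
  proof -
    have t': "w (tm (i + 2)) = N" "cnt (tm (i + 2)) = i + 2" "tm (i + 2) \<le> 2 * n" using tm[of "i + 2"] i by auto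
    let ?j = "tm (i + 2)"
    have cN: "cN ?j = i" using bal(2)[OF t'(3)] t'(2) by simp
    have "b (i + 2) < length (sky ?j)" using b_lt[OF t'(3,1)] t'(2) by simp
    then have "(\<Sum>k=2..<i + 3. b k) \<le> cS ?j" using bal(3)[OF t'(3)] t'(2) split[of i] by simp
    also have "cS ?j \<le> sum_list (take i as)"
    proof -
      have "?j \<le> length (ns_word as)" using t'(3) unfolding as[symmetric] by simp
      from ns_word_prefix[OF this] show ?thesis
        using cp[OF t'(3)] cN unfolding as by simp
    qed
    finally show ?thesis using sums[OF i] by simp
  qed
  moreover have "sum_list bs = n"
  proof -
    have "sum_list bs = (\<Sum>k=2..<n + 3. b k)" using sums[of n] by (simp add: bs_def)
    then show ?thesis using split[of n] bal(3)[of "2 * n"] cnt_end b_end tot by simp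
  qed
  moreover have "length bs = n" by (simp add: bs_def)
  ultimately have "interval_code n as bs" using da by (simp add: interval_code_def)
  then show thesis using that as by (simp add: bs_def)
qed

end

section \<open>The bijection\<close>

definition dart_code :: "dart \<Rightarrow> nat" where
  "dart_code d = (case d of Tl i k \<Rightarrow> 2 * prod_encode (i, k) | Hd i k \<Rightarrow> Suc (2 * prod_encode (i, k)))"

lemma inj_dart_code: "inj dart_code"
proof (rule injI)
  fix d e assume "dart_code d = dart_code e"
  moreover have "2 * x \<noteq> Suc (2 * y)" "Suc (2 * x) \<noteq> 2 * y" for x y :: nat by presburger+
  ultimately show "d = e" by (cases d; cases e) (auto simp: dart_code_def prod_encode_eq)
qed

text \<open>\<open>presented\<close> asks for an injection on the whole type, so the values outside
  \<open>D\<close> are moved above those on \<open>D\<close>.\<close>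

lemma extend_injection:
  fixes \<chi> :: "dart \<Rightarrow> nat"
  assumes "finite D" "inj_on \<chi> D"
  obtains \<phi> where "inj \<phi>" "\<And>d. d \<in> D \<Longrightarrow> \<phi> d = \<chi> d"
proof
  define B where "B = Suc (Max (insert 0 (\<chi> ` D)))"
  have B: "\<chi> d < B" if "d \<in> D" for d
    using that assms(1) by (simp add: B_def less_Suc_eq_le)
  show "inj (\<lambda>d. if d \<in> D then \<chi> d else B + dart_code d)"
  proof (rule injI)
    fix d e assume eq: "(if d \<in> D then \<chi> d else B + dart_code d) = (if e \<in> D then \<chi> e else B + dart_code e)"
    consider "d \<in> D" "e \<in> D" | "d \<notin> D" "e \<notin> D" | "d \<in> D" "e \<notin> D" | "d \<notin> D" "e \<in> D" by blast
    then show "d = e"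
    proof cases
      case 1
      then show ?thesis using eq assms(2) by (simp add: inj_on_eq_iff)
    next
      case 2
      then show ?thesis using eq inj_dart_code by (simp add: inj_eq)
    next
      case 3
      then show ?thesis using eq B[of d] by simp
    next
      case 4
      then show ?thesis using eq B[of e] by simp
    qed
  qed
qed simp

lemma (in coding) presentedI:
  fixes M :: "nat rooted_map"
  assumes "1 \<le> n" "triangulation M" "bij_betw \<chi> code_darts (darts M)"
    and "\<And>d. d \<in> code_darts \<Longrightarrow> rot M (\<chi> d) = \<chi> (rot_dart d)"
    and "\<And>d. d \<in> code_darts \<Longrightarrow> opp M (\<chi> d) = \<chi> (flip d)"
    and "root M = \<chi> (Hd 0 (n + 2))"
    and "\<And>i k. i \<le> 2 \<Longrightarrow> 2 \<le> k \<Longrightarrow> k \<le> n + 1 \<Longrightarrow> c {\<chi> (Tl i k), \<chi> (Hd i k)} = i"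
  shows "\<exists>\<phi>. presented w b n M c \<phi>"
proof -
  obtain \<phi> where \<phi>: "inj \<phi>" "\<And>d. d \<in> code_darts \<Longrightarrow> \<phi> d = \<chi> d"
    using extend_injection[OF finite_code_darts bij_betw_imp_inj_on[OF assms(3)]] by blast
  have root_in: "Hd 0 (n + 2) \<in> code_darts" by (simp add: code_darts_def valid_def)
  have ints: "Tl i k \<in> code_darts" "Hd i k \<in> code_darts" if "i \<le> 2" "2 \<le> k" "k \<le> n + 1" for i k
    using that by (auto simp: code_darts_def valid_def)
  have "presented w b n M c \<phi>"
  proof unfold_locales
    have "darts M = \<chi> ` code_darts" using bij_betw_imp_surj_on[OF assms(3)] by simp
    also have "\<dots> = \<phi> ` code_darts" using \<phi>(2) by simp
    finally show "darts M = \<phi> ` code_darts" .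
    show "rot M permutes darts M" "opp M permutes darts M"
      using assms(2) by (auto simp: triangulation_def planar_map_def)
    show "1 \<le> n" "inj \<phi>" by fact+
    show "rot M (\<phi> d) = \<phi> (rot_dart d)" if "d \<in> code_darts" for d
      using that rot_in[OF that] assms(4) \<phi>(2) by simp
    show "opp M (\<phi> d) = \<phi> (flip d)" if "d \<in> code_darts" for d
      using that assms(5) \<phi>(2) by simp
    show "root M = \<phi> (Hd 0 (n + 2))" using assms(6) \<phi>(2)[OF root_in] by simp
    show "c {\<phi> (Tl i k), \<phi> (Hd i k)} = i" if "i \<le> 2" "2 \<le> k" "k \<le> n + 1" for i k
      using assms(7)[OF that] ints[OF that] \<phi>(2) by simp
  qed
  then show ?thesis by (intro exI[of _ \<phi>])
qed

lemma presented_in_realizer_set: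
  assumes "presented w b n M c \<phi>"
  shows "(M, c) \<in> realizer_set n"
  using presented.is_triangulation[OF assms] presented.is_realizer[OF assms] presented.size_eq[OF assms]
  by (simp add: realizer_set_def)

text \<open>A code consists of total functions, so \<open>wd\<close> and \<open>bb\<close> have to
  agree with \<open>letters\<close> and \<open>pops\<close> beyond the ends as well; their default
  values are chosen for this.\<close>

lemma realizer_presented:
  assumes "1 \<le> n" "(M, c) \<in> realizer_set n"
  shows "\<exists>as bs \<phi>. interval_code n as bs \<and> presented (letters as) (pops bs) n M c \<phi>"
proof -
  interpret realizer_map M c n
    using assms(2) by unfold_locales (auto simp: realizer_set_def)
  have coding: "coding wd bb n" using R.coding_axioms unfolding q_eq .
  obtain as where as: "map wd [0..<2 * n] = ns_word as" "interval_code n as (map bb [3..<n + 3])"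
    by (rule coding.interval_of_code[OF coding assms(1)])
  let ?bs = "map bb [3..<n + 3]"
  have "wd = letters as"
  proof
    fix j
    have "length (ns_word as) = 2 * n" unfolding as(1)[symmetric] by simp
    moreover have "j < 2 * n \<Longrightarrow> ns_word as ! j = wd j" unfolding as(1)[symmetric] by simp
    ultimately show "wd j = letters as j" using m_n by (auto simp: letters_def wd_def)
  qed
  moreover have "bb = pops ?bs"
  proof
    fix k
    consider "k = 2" | "3 \<le> k \<and> k < n + 3" | "k < 2" | "n + 3 \<le> k" by linarith
    then show "bb k = pops ?bs k"
    proof cases
      case 1
      then show ?thesis using coding.b_2[OF coding] by (simp add: pops_def)
    next
      case 2
      then have k: "k = 3 + (k - 3)" "k - 3 < n" using assms(1) by linarith+
      then have "[3..<n + 3] ! (k - 3) = k" "k - 3 < length [3..<n + 3]"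
        using nth_upt[of 3 "k - 3" "n + 3"] by (simp_all del: upt_Suc)
      then have "?bs ! (k - 3) = bb k" by (simp only: nth_map)
      then show ?thesis using 2 by (simp add: pops_def del: upt_Suc)
    qed (use cnt_m_n in \<open>auto simp: pops_def bb_def\<close>)
  qed
  moreover have "\<exists>\<phi>. presented wd bb n M c \<phi>"
  proof (rule coding.presentedI[OF coding assms(1) tri])
    show "bij_betw psi (coding.code_darts n) (darts M)" using psi_bij unfolding q_eq .
    show "rot M (psi d) = psi (coding.rot_dart wd bb n d)" if "d \<in> coding.code_darts n" for d
      using psi_rot that unfolding q_eq by blast
    show "opp M (psi d) = psi (flip d)" if "d \<in> coding.code_darts n" for d
      using psi_flip that unfolding q_eq by simp
    show "root M = psi (Hd 0 (n + 2))" using psi_root by simp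
  qed (use psi_color in blast)
  ultimately show ?thesis using as(2) by metis
qed

lemma (in presented) Psi_code:
  assumes "w = letters as" "b = pops bs" "interval_code n as bs"
  shows "Psi (M, c) = (ns_word as, ns_word bs)"
proof -
  have ic: "length as = n" "sum_list as = n" "length bs = n" using assms(3) by (auto simp: interval_code_def)
  have len: "length (ns_word as) = 2 * n" using length_letters[of "ns_word as"] ic by simp
  have "map w [0..<2 * n] = ns_word as"
    by (rule nth_equalityI) (auto simp: len assms(1) letters_def)
  moreover have "map b [3..<n + 3] = bs"
    by (rule nth_equalityI) (auto simp: ic assms(2) pops_def simp del: upt_Suc)
  ultimately show ?thesis using Psi_eq by simp
qed

lemma presented_iso:
  assumes "presented w b n M c \<phi>" "presented w b n M' c' \<psi>"
  shows "((M, c), (M', c')) \<in> realizer_iso n"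
proof -
  interpret A: presented w b n M c \<phi> by fact
  interpret B: presented w b n M' c' \<psi> by fact
  let ?f = "\<lambda>h. \<psi> (inv \<phi> h)"
  have f: "?f (\<phi> d) = \<psi> d" for d using A.inj by simp
  have "bij_betw ?f (darts M) (darts M')"
  proof -
    have "inj_on ?f (darts M)" unfolding A.darts by (auto simp: inj_on_def f)
    moreover have "?f ` darts M = darts M'" unfolding A.darts B.darts by (simp add: image_image f)
    ultimately show ?thesis by (simp add: bij_betw_def)
  qed
  moreover have "?f (rot M h) = rot M' (?f h) \<and> ?f (opp M h) = opp M' (?f h)" if h: "h \<in> darts M" for h
  proof -
    obtain d where "h = \<phi> d" "d \<in> A.code_darts" using h unfolding A.darts by auto
    then show ?thesis by (simp add: f A.rot B.rot A.opp B.opp)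
  qed
  ultimately have "rooted_map_iso ?f M M'"
    by (simp add: rooted_map_iso_def A.root B.root f)
  moreover have "c' (?f ` e) = c e" if e: "e \<in> internal_edges M" for e
  proof -
    obtain i k where ik: "e = {\<phi> (Tl i k), \<phi> (Hd i k)}" "A.valid i k"
      using e by (auto simp: internal_edges_def A.edges_eq)
    then have "2 \<le> k" "k \<le> n + 1" "i \<le> 2"
      using A.internal_edge_iff[OF ik(2)] e by (auto simp: A.valid_def)
    then show ?thesis using A.col B.col ik(1) by (simp add: f)
  qed
  ultimately show ?thesis
    using presented_in_realizer_set[OF assms(1)] presented_in_realizer_set[OF assms(2)]
    by (auto simp: realizer_iso_def)
qed

lemma iso_presented:
  assumes "1 \<le> n" "((M, c), (M', c')) \<in> realizer_iso n" "presented w b n M c \<phi>"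
  shows "\<exists>\<psi>. presented w b n M' c' \<psi>"
proof -
  interpret presented w b n M c \<phi> by fact
  obtain f where f: "rooted_map_iso f M M'" "\<forall>e\<in>internal_edges M. c' (f ` e) = c e"
    and M': "(M', c') \<in> realizer_set n"
    using assms(2) by (auto simp: realizer_iso_def)
  have fb: "bij_betw f (darts M) (darts M')" "f (root M) = root M'"
    "\<And>h. h \<in> darts M \<Longrightarrow> f (rot M h) = rot M' (f h) \<and> f (opp M h) = opp M' (f h)"
    using f(1) by (auto simp: rooted_map_iso_def)
  have dm: "\<phi> d \<in> darts M" if "d \<in> code_darts" for d using that darts by simp
  show ?thesis
  proof (rule presentedI[of M' "\<lambda>d. f (\<phi> d)"])
    show "1 \<le> n" by fact
    show "triangulation M'" using M' by (simp add: realizer_set_def)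
    have "bij_betw \<phi> code_darts (darts M)"
      unfolding darts using inj by (intro bij_betw_imageI) (auto intro: inj_on_subset)
    from bij_betw_trans[OF this fb(1)] show "bij_betw (\<lambda>d. f (\<phi> d)) code_darts (darts M')"
      by (simp add: comp_def)
    show "rot M' (f (\<phi> d)) = f (\<phi> (rot_dart d))" "opp M' (f (\<phi> d)) = f (\<phi> (flip d))"
      if "d \<in> code_darts" for d
      using fb(3)[OF dm[OF that]] that by (simp_all add: rot opp)
    show "root M' = f (\<phi> (Hd 0 (n + 2)))" using fb(2) root by simp
    fix i k :: nat assume ik: "i \<le> 2" "2 \<le> k" "k \<le> n + 1"
    then have "valid i k" by (auto simp: valid_def)
    then have "{\<phi> (Tl i k), \<phi> (Hd i k)} \<in> internal_edges M" using internal_edge_iff ik by simp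
    from bspec[OF f(2) this] have "c' (f ` {\<phi> (Tl i k), \<phi> (Hd i k)}) = i" using col[OF ik] by (rule trans)
    then show "c' {f (\<phi> (Tl i k)), f (\<phi> (Hd i k))} = i" by simp
  qed
qed

lemma (in coding) presentation_exists:
  assumes "1 \<le> n"
  shows "\<exists>(M :: nat rooted_map) c \<phi>. presented w b n M c \<phi>"
proof -
  let ?D = "dart_code ` code_darts"
  define lift where "lift p x = (if x \<in> ?D then dart_code (p (inv_into code_darts dart_code x)) else x)" for p x
  have bij: "bij_betw dart_code code_darts ?D"
    using inj_dart_code by (intro bij_betw_imageI) (auto intro: inj_on_subset)
  have lift: "lift p (dart_code d) = dart_code (p d)" if "d \<in> code_darts" for p d
    using that bij by (simp add: lift_def bij_betw_def inv_into_f_f)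
  have perm: "lift p permutes ?D" if "p permutes code_darts" for p
    using permutes_bij_inv_into[OF that bij] by (simp add: lift_def [abs_def])
  define fl where "fl d = (if d \<in> code_darts then flip d else d)" for d
  have "fl permutes code_darts"
  proof (rule bij_imp_permutes)
    show "bij_betw fl code_darts code_darts"
      by (rule bij_betw_byWitness[where f' = fl]) (auto simp: fl_def)
  qed (simp add: fl_def)
  define M where "M = \<lparr>darts = ?D, rot = lift rot_dart, opp = lift fl, root = dart_code (Hd 0 (n + 2))\<rparr>"
  \<comment> \<open>Both halves of an edge carry its color, so it does not matter which of them is
    chosen.\<close>
  define c where "c e = (case inv dart_code (SOME x. x \<in> e) of Tl i k \<Rightarrow> i | Hd i k \<Rightarrow> i)" for e
  have "presented w b n M c dart_code"
  proof unfold_locales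
    show "c {dart_code (Tl i k), dart_code (Hd i k)} = i" for i k
    proof -
      have "(SOME x. x \<in> {dart_code (Tl i k), dart_code (Hd i k)}) \<in> {dart_code (Tl i k), dart_code (Hd i k)}"
        by (rule someI_ex) auto
      then show ?thesis using inj_dart_code by (auto simp: c_def)
    qed
  qed (use assms inj_dart_code perm rot_permutes \<open>fl permutes code_darts\<close> in
      \<open>auto simp: M_def lift fl_def\<close>)
  then show ?thesis by blast
qed

text \<open>For the kernel of \<open>f\<close>, well-definedness and injectivity on the classes are
  immediate; what remains is to identify the kernel and the image.\<close>

lemma bij_betw_kernel_quotient:
  assumes r: "r = {(x, y). x \<in> X \<and> y \<in> X \<and> f x = f y}" and img: "f ` X = T"
  shows "f respects r" "bij_betw (\<lambda>C. the_elem (f ` C)) (X // r) T"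
proof -
  show "f respects r" by (auto simp: congruent_def r)
  have cls: "the_elem (f ` (r `` {x})) = f x" if "x \<in> X" for x
  proof -
    have "f ` (r `` {x}) = {f x}" using that by (auto simp: r)
    then show ?thesis by simp
  qed
  have "inj_on (\<lambda>C. the_elem (f ` C)) (X // r)"
  proof (rule inj_onI)
    fix C D assume "C \<in> X // r" "D \<in> X // r" and eq: "the_elem (f ` C) = the_elem (f ` D)"
    then obtain x y where xy: "x \<in> X" "y \<in> X" "C = r `` {x}" "D = r `` {y}" by (auto simp: quotient_def)
    then have "f x = f y" using eq cls by simp
    then show "C = D" using xy by (auto simp: r)
  qed
  moreover have "(\<lambda>C. the_elem (f ` C)) ` (X // r) = T"
    using cls img by (auto simp: quotient_def image_iff)
  ultimately show "bij_betw (\<lambda>C. the_elem (f ` C)) (X // r) T" by (simp add: bij_betw_def)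
qed

theorem theorem3p3:
  fixes n :: nat
  assumes "n \<ge> 1"
  shows "Psi respects realizer_iso n \<and>
    bij_betw (\<lambda>R. the_elem (Psi ` R)) (realizer_set n // realizer_iso n)
      {(P, Q). dyck_path n P \<and> dyck_path n Q \<and> stays_below n P Q}"
proof -
  \<comment> \<open>Isomorphic realizers are presented by the same code. Conversely, equal words
    have equal exponents by \<open>ns_word_inj\<close>, so two realizers with equal values of
    \<open>Psi\<close> share their code.\<close>
  have ker: "realizer_iso n = {(x, y). x \<in> realizer_set n \<and> y \<in> realizer_set n \<and> Psi x = Psi y}"
  proof (intro equalityI subsetI)
    fix z assume z: "z \<in> realizer_iso n"
    obtain M c M' c' where zz: "z = ((M, c), (M', c'))" by (metis surj_pair)
    have in': "(M, c) \<in> realizer_set n" "(M', c') \<in> realizer_set n"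
      using z unfolding zz realizer_iso_def by auto
    obtain as bs \<phi> where p: "interval_code n as bs" "presented (letters as) (pops bs) n M c \<phi>"
      using realizer_presented[OF assms in'(1)] by blast
    obtain \<psi> where p': "presented (letters as) (pops bs) n M' c' \<psi>"
      using iso_presented[OF assms z[unfolded zz] p(2)] by blast
    show "z \<in> {(x, y). x \<in> realizer_set n \<and> y \<in> realizer_set n \<and> Psi x = Psi y}"
      using in' presented.Psi_code[OF p(2) refl refl p(1)] presented.Psi_code[OF p' refl refl p(1)] zz
      by simp
  next
    fix z assume z: "z \<in> {(x, y). x \<in> realizer_set n \<and> y \<in> realizer_set n \<and> Psi x = Psi y}"
    obtain M c M' c' where zz: "z = ((M, c), (M', c'))" by (metis surj_pair)
    then have in': "(M, c) \<in> realizer_set n" "(M', c') \<in> realizer_set n" "Psi (M, c) = Psi (M', c')"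
      using z by auto
    obtain as bs \<phi> where p: "interval_code n as bs" "presented (letters as) (pops bs) n M c \<phi>"
      using realizer_presented[OF assms in'(1)] by blast
    obtain as' bs' \<psi> where p': "interval_code n as' bs'" "presented (letters as') (pops bs') n M' c' \<psi>"
      using realizer_presented[OF assms in'(2)] by blast
    have "as' = as" "bs' = bs"
      using in'(3) presented.Psi_code[OF p(2) refl refl p(1)] presented.Psi_code[OF p'(2) refl refl p'(1)]
      by (simp_all add: ns_word_inj)
    then show "z \<in> realizer_iso n" using presented_iso[OF p(2)] p'(2) zz by simp
  qed
  have img: "Psi ` realizer_set n = {(P, Q). dyck_path n P \<and> dyck_path n Q \<and> stays_below n P Q}"
    unfolding interval_pairs[OF assms]
  proof (intro equalityI subsetI)
    fix z assume "z \<in> Psi ` realizer_set n"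
    then obtain M c where z: "(M, c) \<in> realizer_set n" "z = Psi (M, c)" by (metis imageE surj_pair)
    obtain as bs \<phi> where p: "interval_code n as bs" "presented (letters as) (pops bs) n M c \<phi>"
      using realizer_presented[OF assms z(1)] by blast
    show "z \<in> {(ns_word as, ns_word bs) | as bs. interval_code n as bs}"
      using presented.Psi_code[OF p(2) refl refl p(1)] z(2) p(1) by blast
  next
    fix z assume "z \<in> {(ns_word as, ns_word bs) | as bs. interval_code n as bs}"
    then obtain as bs where z: "z = (ns_word as, ns_word bs)" "interval_code n as bs" by blast
    obtain M :: "nat rooted_map" and c \<phi> where p: "presented (letters as) (pops bs) n M c \<phi>"
      using coding.presentation_exists[OF code_of_interval[OF z(2)] assms] by blast
    have "z = Psi (M, c)" using presented.Psi_code[OF p refl refl z(2)] z(1) by metis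
    then show "z \<in> Psi ` realizer_set n" using presented_in_realizer_set[OF p] by blast
  qed
  show ?thesis using bij_betw_kernel_quotient[OF ker img] by blast
qed

end
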